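(* Let $W$ be a complex algebraic scheme, $X$ a closed subscheme of $W$, and let $p,\lambda,\mu,\nu$ be non-negative integers. Let $$0 \to G \xrightarrow{\alpha} F \xrightarrow{\beta} E \to 0$$ be an exact sequence of coherent $\mathcal{O}_W$-modules with $\mathcal{O}_W$-linear homomorphisms $\alpha,\beta$, and assume that this sequence splits differentially of order $\leq\lambda$. If the $H^p$-global lifting criterion of $F$ holds at level $\mu$ along $(X_{(\nu)},X)$, then the $H^p$-global lifting criterion of $E$ holds at level $\lambda+\mu$ along $(X_{(\nu)},X)$.
   Context: Differential splitting: an $\mathcal{O}_W$-linear exact sequence $0\to G\xrightarrow{\alpha}F\xrightarrow{\beta}E\to 0$ of coherent sheaves splits differentially of order $\leq\lambda$ if there is a $\mathbb{C}$-linear (holomorphic) differential operator $\nabla_\beta:E\to F$ of order $\leq\lambda$ with $\beta\circ\nabla_\beta=\mathrm{Id}_E$. Infinitesimal neighborhoods: if $X\subset W$ is defined by the ideal sheaf $I_X$, then for $k\geq 0$ put $X_{(k)}=(|X|,\mathcal{O}_W/I_X^{k+1})$, and for a coherent $\mathcal{O}_W$-module $E$ put $E_{(k)}=E/I_X^{k+1}E$. $H^p$-global lifting criterion: the $H^p$-global lifting criterion ($H^p$-G.L.C.) of $E$ holds at (infinitesimal lifting) level $\lambda$ along $(X_{(\nu)},X)$ if $$\mathrm{Im}[H^p(W,E)\to H^p(X_{(\nu)},E_{(\nu)})]=\mathrm{Im}[H^p(X_{(\nu+\lambda)},E_{(\nu+\lambda)})\to H^p(X_{(\nu)},E_{(\nu)})]$$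 as subspaces of $H^p(X_{(\nu)},E_{(\nu)})$, the maps being the natural restriction maps. *)

theory Defs
  imports "HOL-Analysis.Analysis" "HOL-Algebra.Algebra" "HOL-Algebra.Algebraic_Closure_Type"
begin

section \<open>Presheaves and sheaves\<close>

text \<open>
  \<open>sect F U\<close> is the set, group, ring or module of sections over the open set \<open>U\<close>, and
  \<open>rstr F U V\<close> the restriction map from \<open>U\<close> to \<open>V\<close>. Values at sets that are not open are
  irrelevant. All sections of one presheaf live in one type \<open>'s\<close>, with the carrier depending
  on \<open>U\<close>.
\<close>

record ('x, 'A, 's) presheaf =
  sect :: "'x set \<Rightarrow> 'A"
  rstr :: "'x set \<Rightarrow> 'x set \<Rightarrow> 's \<Rightarrow> 's"

type_synonym ('x, 's) group_presheaf = "('x, 's monoid, 's) presheaf"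
type_synonym ('x, 'r) ring_presheaf = "('x, 'r ring, 'r) presheaf"
type_synonym ('x, 'r, 'm) module_presheaf = "('x, ('r, 'm) module, 'm) presheaf"

definition is_presheaf ::
    "'x topology \<Rightarrow> ('x, ('s, 'z) partial_object_scheme, 's) presheaf \<Rightarrow> bool" where
  "is_presheaf T F \<longleftrightarrow>
     (\<forall>U V. openin T U \<and> openin T V \<and> V \<subseteq> U \<longrightarrow>
        rstr F U V \<in> carrier (sect F U) \<rightarrow> carrier (sect F V)) \<and>
     (\<forall>U. openin T U \<longrightarrow> (\<forall>s\<in>carrier (sect F U). rstr F U U s = s)) \<and>
     (\<forall>U V V'. openin T U \<and> openin T V \<and> openin T V' \<and> V' \<subseteq> V \<and> V \<subseteq> U \<longrightarrow>
        (\<forall>s\<in>carrier (sect F U). rstr F V V' (rstr F U V s) = rstr F U V' s))"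

definition is_sheaf ::
    "'x topology \<Rightarrow> ('x, ('s, 'z) partial_object_scheme, 's) presheaf \<Rightarrow> bool" where
  "is_sheaf T F \<longleftrightarrow> is_presheaf T F \<and>
     (\<forall>\<U> s. (\<forall>U\<in>\<U>. openin T U \<and> s U \<in> carrier (sect F U)) \<and>
        (\<forall>U\<in>\<U>. \<forall>V\<in>\<U>. rstr F U (U \<inter> V) (s U) = rstr F V (U \<inter> V) (s V)) \<longrightarrow>
        (\<exists>!t. t \<in> carrier (sect F (\<Union>\<U>)) \<and> (\<forall>U\<in>\<U>. rstr F (\<Union>\<U>) U t = s U)))"

definition locally_in ::
    "'x topology \<Rightarrow> ('x, 'A, 's) presheaf \<Rightarrow> ('x set \<Rightarrow> 's set) \<Rightarrow> 'x set \<Rightarrow> 's \<Rightarrow> bool" where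
  "locally_in T F N U s \<longleftrightarrow>
     (\<forall>x\<in>U. \<exists>V. openin T V \<and> x \<in> V \<and> V \<subseteq> U \<and> rstr F U V s \<in> N V)"

definition additive_group :: "('s, 'z) ring_scheme \<Rightarrow> 's monoid" where
  "additive_group M = \<lparr>carrier = carrier M, mult = add M, one = \<zero>\<^bsub>M\<^esub>\<rparr>"

definition additive_sheaf ::
    "('x, ('s, 'z) ring_scheme, 's) presheaf \<Rightarrow> ('x, 's) group_presheaf" where
  "additive_sheaf F = \<lparr>sect = (\<lambda>U. additive_group (sect F U)), rstr = rstr F\<rparr>"

subsection \<open>Stalks, quotients, restriction to a subspace\<close>

definition germ ::
    "'x topology \<Rightarrow> ('x, ('s, 'z) partial_object_scheme, 's) presheaf \<Rightarrow> 'x \<Rightarrow> 'x set \<Rightarrow> 's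
      \<Rightarrow> ('x set \<times> 's) set" where
  "germ T F x U s =
     {(V, t). openin T V \<and> x \<in> V \<and> t \<in> carrier (sect F V) \<and>
        (\<exists>V'. openin T V' \<and> x \<in> V' \<and> V' \<subseteq> U \<inter> V \<and> rstr F U V' s = rstr F V V' t)}"

definition stalk ::
    "'x topology \<Rightarrow> ('x, 's) group_presheaf \<Rightarrow> 'x \<Rightarrow> ('x set \<times> 's) set monoid" where
  "stalk T F x =
     \<lparr>carrier = {germ T F x U s | U s. openin T U \<and> x \<in> U \<and> s \<in> carrier (sect F U)},
      mult = (\<lambda>g h. \<Union>(U, s)\<in>g. \<Union>(V, t)\<in>h.
        germ T F x (U \<inter> V) (rstr F U (U \<inter> V) s \<otimes>\<^bsub>sect F (U \<inter> V)\<^esub> rstr F V (U \<inter> V) t)),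
      one = germ T F x (topspace T) \<one>\<^bsub>sect F (topspace T)\<^esub>\<rparr>"

text \<open>The presheaf quotient \<open>U \<mapsto> F(U)/N(U)\<close>; it is not sheafified here.\<close>

definition quot_presheaf ::
    "('x, 's) group_presheaf \<Rightarrow> ('x set \<Rightarrow> 's set) \<Rightarrow> ('x, 's set) group_presheaf" where
  "quot_presheaf F N =
     \<lparr>sect = (\<lambda>U. sect F U Mod N U),
      rstr = (\<lambda>U V c. N V <#>\<^bsub>sect F V\<^esub> (rstr F U V ` c))\<rparr>"

text \<open>
  The inverse image \<open>i\<^sup>-\<^sup>1F\<^sup>+\<close> of the sheaf \<open>F\<^sup>+\<close> associated with a presheaf \<open>F\<close>
  on \<open>T\<close> along the inclusion \<open>i\<close> of the subspace \<open>S\<close>: its sections over a relatively open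
  \<open>V \<subseteq> S\<close> are the functions into the stalks of \<open>F\<close> that are locally on \<open>V\<close> given by
  sections of \<open>F\<close> on open sets of \<open>T\<close>.
\<close>

definition subspace_sheaf ::
    "'x topology \<Rightarrow> ('x, 's) group_presheaf \<Rightarrow> ('x, 'x \<Rightarrow> ('x set \<times> 's) set) group_presheaf" where
  "subspace_sheaf T F =
     \<lparr>sect = (\<lambda>V.
        \<lparr>carrier = {s \<in> (\<Pi>\<^sub>E y\<in>V. carrier (stalk T F y)).
            \<forall>x\<in>V. \<exists>U t. openin T U \<and> x \<in> U \<and> t \<in> carrier (sect F U) \<and>
              (\<forall>y\<in>U \<inter> V. s y = germ T F y U t)},
         mult = (\<lambda>s t. \<lambda>y\<in>V. s y \<otimes>\<^bsub>stalk T F y\<^esub> t y),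
         one = (\<lambda>y\<in>V. \<one>\<^bsub>stalk T F y\<^esub>)\<rparr>),
      rstr = (\<lambda>U V s. restrict s V)\<rparr>"

definition support :: "'x topology \<Rightarrow> ('x, 's) group_presheaf \<Rightarrow> 'x set" where
  "support T F = {x \<in> topspace T. carrier (stalk T F x) \<noteq> {\<one>\<^bsub>stalk T F x\<^esub>}}"


section \<open>Complex algebraic schemes\<close>

subsection \<open>Affine schemes\<close>

definition frac :: "'r ring \<Rightarrow> 'r set \<Rightarrow> 'r \<Rightarrow> 'r \<Rightarrow> ('r \<times> 'r) set" where
  "frac A P a f =
     {(b, g). b \<in> carrier A \<and> g \<in> carrier A - P \<and>
        (\<exists>u\<in>carrier A - P. u \<otimes>\<^bsub>A\<^esub> (a \<otimes>\<^bsub>A\<^esub> g) = u \<otimes>\<^bsub>A\<^esub> (b \<otimes>\<^bsub>A\<^esub> f))}"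

definition localization :: "'r ring \<Rightarrow> 'r set \<Rightarrow> ('r \<times> 'r) set ring" where
  "localization A P =
     \<lparr>carrier = {frac A P a f | a f. a \<in> carrier A \<and> f \<in> carrier A - P},
      mult = (\<lambda>c d. \<Union>(a, f)\<in>c. \<Union>(b, g)\<in>d. frac A P (a \<otimes>\<^bsub>A\<^esub> b) (f \<otimes>\<^bsub>A\<^esub> g)),
      one = frac A P \<one>\<^bsub>A\<^esub> \<one>\<^bsub>A\<^esub>,
      ring.zero = frac A P \<zero>\<^bsub>A\<^esub> \<one>\<^bsub>A\<^esub>,
      add = (\<lambda>c d. \<Union>(a, f)\<in>c. \<Union>(b, g)\<in>d.
        frac A P (a \<otimes>\<^bsub>A\<^esub> g \<oplus>\<^bsub>A\<^esub> b \<otimes>\<^bsub>A\<^esub> f) (f \<otimes>\<^bsub>A\<^esub> g))\<rparr>"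

definition Spec_top :: "'r ring \<Rightarrow> 'r set topology" where
  "Spec_top A = topology_generated_by {{P. primeideal P A \<and> f \<notin> P} | f. f \<in> carrier A}"

definition Spec_sheaf :: "'r ring \<Rightarrow> ('r set, 'r set \<Rightarrow> ('r \<times> 'r) set) ring_presheaf" where
  "Spec_sheaf A =
     \<lparr>sect = (\<lambda>U.
        \<lparr>carrier = {s \<in> (\<Pi>\<^sub>E P\<in>U. carrier (localization A P)).
            \<forall>P\<in>U. \<exists>V. openin (Spec_top A) V \<and> P \<in> V \<and> V \<subseteq> U \<and>
              (\<exists>a\<in>carrier A. \<exists>f\<in>carrier A. \<forall>Q\<in>V. f \<notin> Q \<and> s Q = frac A Q a f)},
         mult = (\<lambda>s t. \<lambda>P\<in>U. s P \<otimes>\<^bsub>localization A P\<^esub> t P),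
         one = (\<lambda>P\<in>U. \<one>\<^bsub>localization A P\<^esub>),
         ring.zero = (\<lambda>P\<in>U. \<zero>\<^bsub>localization A P\<^esub>),
         add = (\<lambda>s t. \<lambda>P\<in>U. s P \<oplus>\<^bsub>localization A P\<^esub> t P)\<rparr>),
      rstr = (\<lambda>U V s. restrict s V)\<rparr>"

definition ringed_space_iso ::
    "'x topology \<Rightarrow> ('x, 'r) ring_presheaf \<Rightarrow> 'y topology \<Rightarrow> ('y, 's) ring_presheaf
      \<Rightarrow> ('x \<Rightarrow> 'y) \<Rightarrow> ('y set \<Rightarrow> 's \<Rightarrow> 'r) \<Rightarrow> bool" where
  "ringed_space_iso T \<O> T' \<O>' f \<psi> \<longleftrightarrow> homeomorphic_map T T' f \<and>
     (\<forall>V. openin T' V \<longrightarrow>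
        \<psi> V \<in> ring_iso (sect \<O>' V) (sect \<O> {x \<in> topspace T. f x \<in> V})) \<and>
     (\<forall>V V'. openin T' V \<and> openin T' V' \<and> V' \<subseteq> V \<longrightarrow>
        (\<forall>s\<in>carrier (sect \<O>' V).
           \<psi> V' (rstr \<O>' V V' s) =
           rstr \<O> {x \<in> topspace T. f x \<in> V} {x \<in> topspace T. f x \<in> V'} (\<psi> V s)))"

subsection \<open>Schemes of finite type over the complex numbers\<close>

text \<open>
  A morphism to the spectrum of the complex numbers is the same as a structure of a sheaf of
  complex algebras on the structure sheaf; \<open>const W U\<close> is the embedding of the constants
  into the ring of sections over \<open>U\<close>.
\<close>

record ('x, 'r) cspace =
  base :: "'x topology"
  struct :: "('x, 'r) ring_presheaf"
  const :: "'x set \<Rightarrow> complex \<Rightarrow> 'r"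

definition is_ringed_cspace :: "('x, 'r) cspace \<Rightarrow> bool" where
  "is_ringed_cspace W \<longleftrightarrow> is_sheaf (base W) (struct W) \<and>
     (\<forall>U. openin (base W) U \<longrightarrow> cring (sect (struct W) U) \<and>
        const W U \<in> ring_hom ring_of_type_algebra (sect (struct W) U)) \<and>
     (\<forall>U V. openin (base W) U \<and> openin (base W) V \<and> V \<subseteq> U \<longrightarrow>
        rstr (struct W) U V \<in> ring_hom (sect (struct W) U) (sect (struct W) V) \<and>
        (\<forall>c. rstr (struct W) U V (const W U c) = const W V c))"

text \<open>
  The ring \<open>A\<close> may be taken in the type \<open>'r\<close>: a ring whose spectrum is isomorphic to \<open>U\<close> is
  isomorphic to the ring of sections over \<open>U\<close>.
\<close>

definition affine_open :: "('x, 'r) cspace \<Rightarrow> 'x set \<Rightarrow> bool" where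
  "affine_open W U \<longleftrightarrow> openin (base W) U \<and>
     (\<exists>A :: 'r ring. cring A \<and>
        (\<exists>f \<psi>. ringed_space_iso (subtopology (base W) U) (struct W)
           (Spec_top A) (Spec_sheaf A) f \<psi>))"

definition finitely_generated_calgebra :: "'r ring \<Rightarrow> (complex \<Rightarrow> 'r) \<Rightarrow> bool" where
  "finitely_generated_calgebra A \<kappa> \<longleftrightarrow>
     (\<exists>S. finite S \<and> S \<subseteq> carrier A \<and> generate_ring A (range \<kappa> \<union> S) = carrier A)"

definition complex_algebraic_scheme :: "('x, 'r) cspace \<Rightarrow> bool" where
  "complex_algebraic_scheme W \<longleftrightarrow> is_ringed_cspace W \<and> compact_space (base W) \<and>
     (\<forall>x\<in>topspace (base W). \<exists>U. x \<in> U \<and> affine_open W U \<and>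
        finitely_generated_calgebra (sect (struct W) U) (const W U))"


section \<open>Modules over the structure sheaf\<close>

definition is_module_sheaf ::
    "('x, 'r) cspace \<Rightarrow> ('x, 'r, 'm) module_presheaf \<Rightarrow> bool" where
  "is_module_sheaf W M \<longleftrightarrow> is_sheaf (base W) M \<and>
     (\<forall>U. openin (base W) U \<longrightarrow> module (sect (struct W) U) (sect M U)) \<and>
     (\<forall>U V. openin (base W) U \<and> openin (base W) V \<and> V \<subseteq> U \<longrightarrow>
        (\<forall>s\<in>carrier (sect M U). \<forall>t\<in>carrier (sect M U).
           rstr M U V (s \<oplus>\<^bsub>sect M U\<^esub> t) = rstr M U V s \<oplus>\<^bsub>sect M V\<^esub> rstr M U V t) \<and>
        (\<forall>a\<in>carrier (sect (struct W) U). \<forall>s\<in>carrier (sect M U).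
           rstr M U V (a \<odot>\<^bsub>sect M U\<^esub> s) =
           rstr (struct W) U V a \<odot>\<^bsub>sect M V\<^esub> rstr M U V s))"

definition sheaf_hom ::
    "'x topology \<Rightarrow> ('x, ('m, 'y) ring_scheme, 'm) presheaf
      \<Rightarrow> ('x, ('n, 'z) ring_scheme, 'n) presheaf \<Rightarrow> ('x set \<Rightarrow> 'm \<Rightarrow> 'n) \<Rightarrow> bool" where
  "sheaf_hom T M N \<phi> \<longleftrightarrow>
     (\<forall>U. openin T U \<longrightarrow> \<phi> U \<in> carrier (sect M U) \<rightarrow> carrier (sect N U) \<and>
        (\<forall>s\<in>carrier (sect M U). \<forall>t\<in>carrier (sect M U).
           \<phi> U (s \<oplus>\<^bsub>sect M U\<^esub> t) = \<phi> U s \<oplus>\<^bsub>sect N U\<^esub> \<phi> U t)) \<and>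
     (\<forall>U V. openin T U \<and> openin T V \<and> V \<subseteq> U \<longrightarrow>
        (\<forall>s\<in>carrier (sect M U). \<phi> V (rstr M U V s) = rstr N U V (\<phi> U s)))"

definition O_linear_hom ::
    "('x, 'r) cspace \<Rightarrow> ('x, 'r, 'm) module_presheaf \<Rightarrow> ('x, 'r, 'n) module_presheaf
      \<Rightarrow> ('x set \<Rightarrow> 'm \<Rightarrow> 'n) \<Rightarrow> bool" where
  "O_linear_hom W M N \<phi> \<longleftrightarrow> sheaf_hom (base W) M N \<phi> \<and>
     (\<forall>U. openin (base W) U \<longrightarrow>
        (\<forall>a\<in>carrier (sect (struct W) U). \<forall>s\<in>carrier (sect M U).
           \<phi> U (a \<odot>\<^bsub>sect M U\<^esub> s) = a \<odot>\<^bsub>sect N U\<^esub> \<phi> U s))"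

text \<open>
  Exactness as sheaves: surjectivity, and membership in the image, are local conditions.
\<close>

definition short_exact ::
    "('x, 'r) cspace \<Rightarrow> ('x, 'r, 'g) module_presheaf \<Rightarrow> ('x, 'r, 'f) module_presheaf
      \<Rightarrow> ('x, 'r, 'e) module_presheaf \<Rightarrow> ('x set \<Rightarrow> 'g \<Rightarrow> 'f) \<Rightarrow> ('x set \<Rightarrow> 'f \<Rightarrow> 'e) \<Rightarrow> bool" where
  "short_exact W G F E \<alpha> \<beta> \<longleftrightarrow>
     (\<forall>U. openin (base W) U \<longrightarrow>
        inj_on (\<alpha> U) (carrier (sect G U)) \<and>
        (\<forall>s\<in>carrier (sect F U). \<beta> U s = \<zero>\<^bsub>sect E U\<^esub> \<longleftrightarrow>
           locally_in (base W) F (\<lambda>V. \<alpha> V ` carrier (sect G V)) U s) \<and>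
        (\<forall>s\<in>carrier (sect E U). locally_in (base W) E (\<lambda>V. \<beta> V ` carrier (sect F V)) U s))"

subsection \<open>Coherent and quasi-coherent modules\<close>

text \<open>The additive span of all products; this is the submodule generated by \<open>B\<close> if \<open>A\<close> is the
  whole ring.\<close>

definition module_span :: "('r, 'm) module \<Rightarrow> 'r set \<Rightarrow> 'm set \<Rightarrow> 'm set" where
  "module_span M A B = generate (additive_group M) {a \<odot>\<^bsub>M\<^esub> x | a x. a \<in> A \<and> x \<in> B}"

definition generated_by ::
    "('x, 'r) cspace \<Rightarrow> ('x, 'r, 'm) module_presheaf \<Rightarrow> 'x set \<Rightarrow> 'm set \<Rightarrow> bool" where
  "generated_by W M U S \<longleftrightarrow>
     (\<forall>V. openin (base W) V \<and> V \<subseteq> U \<longrightarrow>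
        (\<forall>t\<in>carrier (sect M V). locally_in (base W) M
           (\<lambda>V'. module_span (sect M V') (carrier (sect (struct W) V')) (rstr M U V' ` S)) V t))"

definition finite_type_on ::
    "('x, 'r) cspace \<Rightarrow> ('x, 'r, 'm) module_presheaf \<Rightarrow> 'x set \<Rightarrow> bool" where
  "finite_type_on W M U \<longleftrightarrow>
     (\<forall>x\<in>U. \<exists>V S. openin (base W) V \<and> x \<in> V \<and> V \<subseteq> U \<and>
        finite S \<and> S \<subseteq> carrier (sect M V) \<and> generated_by W M V S)"

text \<open>
  The module of relations between sections \<open>s j\<close> of \<open>M\<close> over \<open>U\<close>, that is, the kernel of the map
  from the free module with basis \<open>J\<close> to \<open>M\<close>, over open subsets of \<open>U\<close>. The ring
  multiplication fields of a module record carry no meaning.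
\<close>

definition relations ::
    "('x, 'r) cspace \<Rightarrow> ('x, 'r, 'm) module_presheaf \<Rightarrow> 'x set \<Rightarrow> 'j set \<Rightarrow> ('j \<Rightarrow> 'm)
      \<Rightarrow> ('x, 'r, 'j \<Rightarrow> 'r) module_presheaf" where
  "relations W M U J s =
     \<lparr>sect = (\<lambda>V. let R = sect (struct W) V; N = sect M V in
        \<lparr>carrier = {a \<in> J \<rightarrow>\<^sub>E carrier R. finite {j \<in> J. a j \<noteq> \<zero>\<^bsub>R\<^esub>} \<and>
            finsum N (\<lambda>j. a j \<odot>\<^bsub>N\<^esub> rstr M U V (s j)) {j \<in> J. a j \<noteq> \<zero>\<^bsub>R\<^esub>} = \<zero>\<^bsub>N\<^esub>},
         mult = undefined,
         one = undefined,
         ring.zero = (\<lambda>j\<in>J. \<zero>\<^bsub>R\<^esub>),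
         add = (\<lambda>a b. \<lambda>j\<in>J. a j \<oplus>\<^bsub>R\<^esub> b j),
         smult = (\<lambda>c a. \<lambda>j\<in>J. c \<otimes>\<^bsub>R\<^esub> a j)\<rparr>),
      rstr = (\<lambda>V V' a. \<lambda>j\<in>J. rstr (struct W) V V' (a j))\<rparr>"

definition coherent :: "('x, 'r) cspace \<Rightarrow> ('x, 'r, 'm) module_presheaf \<Rightarrow> bool" where
  "coherent W M \<longleftrightarrow> is_module_sheaf W M \<and> finite_type_on W M (topspace (base W)) \<and>
     (\<forall>U (n :: nat) s. openin (base W) U \<and> s \<in> {..<n} \<rightarrow> carrier (sect M U) \<longrightarrow>
        finite_type_on W (relations W M U {..<n} s) U)"

text \<open>
  Local presentations by free modules of arbitrary rank. The basis of the free module may be taken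
  to be a set of sections, since repeated generators can be dropped.
\<close>

definition quasi_coherent :: "('x, 'r) cspace \<Rightarrow> ('x, 'r, 'm) module_presheaf \<Rightarrow> bool" where
  "quasi_coherent W M \<longleftrightarrow> is_module_sheaf W M \<and>
     (\<forall>x\<in>topspace (base W). \<exists>U J K. openin (base W) U \<and> x \<in> U \<and>
        J \<subseteq> carrier (sect M U) \<and> generated_by W M U J \<and>
        K \<subseteq> carrier (sect (relations W M U J (\<lambda>j. j)) U) \<and>
        generated_by W (relations W M U J (\<lambda>j. j)) U K)"

subsection \<open>Closed subschemes and infinitesimal neighbourhoods\<close>

definition ideal_module ::
    "('x, 'r) cspace \<Rightarrow> ('x set \<Rightarrow> 'r set) \<Rightarrow> ('x, 'r, 'r) module_presheaf" where
  "ideal_module W I =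
     \<lparr>sect = (\<lambda>U. let R = sect (struct W) U in
        \<lparr>carrier = I U, mult = mult R, one = one R, ring.zero = \<zero>\<^bsub>R\<^esub>, add = add R,
         smult = mult R\<rparr>),
      rstr = rstr (struct W)\<rparr>"

text \<open>
  A closed subscheme \<open>X\<close> of \<open>W\<close> is given by its quasi-coherent ideal sheaf \<open>I\<close>; its
  space is the support of the quotient of the structure sheaf by \<open>I\<close>.
\<close>

definition closed_subscheme :: "('x, 'r) cspace \<Rightarrow> ('x set \<Rightarrow> 'r set) \<Rightarrow> bool" where
  "closed_subscheme W I \<longleftrightarrow>
     (\<forall>U. openin (base W) U \<longrightarrow> ideal (I U) (sect (struct W) U)) \<and>
     quasi_coherent W (ideal_module W I)"

definition subscheme_space :: "('x, 'r) cspace \<Rightarrow> ('x set \<Rightarrow> 'r set) \<Rightarrow> 'x set" where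
  "subscheme_space W I = support (base W) (quot_presheaf (additive_sheaf (struct W)) I)"

primrec ideal_power ::
    "('x, 'r) cspace \<Rightarrow> ('x set \<Rightarrow> 'r set) \<Rightarrow> nat \<Rightarrow> 'x set \<Rightarrow> 'r set" where
  "ideal_power W I 0 U = carrier (sect (struct W) U)"
| "ideal_power W I (Suc k) U =
     {a \<in> carrier (sect (struct W) U). locally_in (base W) (struct W)
        (\<lambda>V. ideal_prod (sect (struct W) V) (I V) (ideal_power W I k V)) U a}"

definition ideal_times_module ::
    "('x, 'r) cspace \<Rightarrow> ('x set \<Rightarrow> 'r set) \<Rightarrow> ('x, 'r, 'm) module_presheaf \<Rightarrow> 'x set \<Rightarrow> 'm set" where
  "ideal_times_module W I M U =
     {s \<in> carrier (sect M U). locally_in (base W) M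
        (\<lambda>V. module_span (sect M V) (I V) (carrier (sect M V))) U s}"

text \<open>
  The space of the \<open>k\<close>-th infinitesimal neighbourhood is \<open>inf_space W I\<close>, which does not depend
  on \<open>k\<close>; on it lives \<open>inf_sheaf W I E k\<close>, the sheaf \<open>E/I\<^sup>k\<^sup>+\<^sup>1E\<close>. Only its structure of a
  sheaf of abelian groups is recorded, as it is used through its cohomology alone.
\<close>

definition inf_space :: "('x, 'r) cspace \<Rightarrow> ('x set \<Rightarrow> 'r set) \<Rightarrow> 'x topology" where
  "inf_space W I = subtopology (base W) (subscheme_space W I)"

definition inf_presheaf ::
    "('x, 'r) cspace \<Rightarrow> ('x set \<Rightarrow> 'r set) \<Rightarrow> ('x, 'r, 'm) module_presheaf \<Rightarrow> nat
      \<Rightarrow> ('x, 'm set) group_presheaf" where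
  "inf_presheaf W I E k =
     quot_presheaf (additive_sheaf E) (ideal_times_module W (ideal_power W I (k + 1)) E)"

definition inf_sheaf ::
    "('x, 'r) cspace \<Rightarrow> ('x set \<Rightarrow> 'r set) \<Rightarrow> ('x, 'r, 'm) module_presheaf \<Rightarrow> nat
      \<Rightarrow> ('x, 'x \<Rightarrow> ('x set \<times> 'm set) set) group_presheaf" where
  "inf_sheaf W I E k = subspace_sheaf (base W) (inf_presheaf W I E k)"


section \<open>Differential operators\<close>

text \<open>
  Grothendieck's definition: order at most \<open>0\<close> means linear over the structure sheaf, and order at
  most \<open>n + 1\<close> that all commutators with multiplication by local functions have order at most \<open>n\<close>.
  The operator is considered on the open subsets of \<open>U\<close>.
\<close>

primrec diff_order_le ::
    "('x, 'r) cspace \<Rightarrow> ('x, 'r, 'm) module_presheaf \<Rightarrow> ('x, 'r, 'n) module_presheaf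
      \<Rightarrow> nat \<Rightarrow> 'x set \<Rightarrow> ('x set \<Rightarrow> 'm \<Rightarrow> 'n) \<Rightarrow> bool" where
  "diff_order_le W M N 0 U D \<longleftrightarrow>
     (\<forall>V. openin (base W) V \<and> V \<subseteq> U \<longrightarrow>
        (\<forall>a\<in>carrier (sect (struct W) V). \<forall>s\<in>carrier (sect M V).
           D V (a \<odot>\<^bsub>sect M V\<^esub> s) = a \<odot>\<^bsub>sect N V\<^esub> D V s))"
| "diff_order_le W M N (Suc n) U D \<longleftrightarrow>
     (\<forall>V. openin (base W) V \<and> V \<subseteq> U \<longrightarrow>
        (\<forall>a\<in>carrier (sect (struct W) V). diff_order_le W M N n V
           (\<lambda>V' s. D V' (rstr (struct W) V V' a \<odot>\<^bsub>sect M V'\<^esub> s)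
              \<ominus>\<^bsub>sect N V'\<^esub> rstr (struct W) V V' a \<odot>\<^bsub>sect N V'\<^esub> D V' s)))"

definition differential_operator ::
    "('x, 'r) cspace \<Rightarrow> ('x, 'r, 'm) module_presheaf \<Rightarrow> ('x, 'r, 'n) module_presheaf
      \<Rightarrow> nat \<Rightarrow> ('x set \<Rightarrow> 'm \<Rightarrow> 'n) \<Rightarrow> bool" where
  "differential_operator W M N n D \<longleftrightarrow> sheaf_hom (base W) M N D \<and>
     (\<forall>U. openin (base W) U \<longrightarrow> (\<forall>c. \<forall>s\<in>carrier (sect M U).
        D U (const W U c \<odot>\<^bsub>sect M U\<^esub> s) = const W U c \<odot>\<^bsub>sect N U\<^esub> D U s)) \<and>
     diff_order_le W M N n (topspace (base W)) D"

definition splits_differentially ::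
    "('x, 'r) cspace \<Rightarrow> ('x, 'r, 'f) module_presheaf \<Rightarrow> ('x, 'r, 'e) module_presheaf
      \<Rightarrow> ('x set \<Rightarrow> 'f \<Rightarrow> 'e) \<Rightarrow> nat \<Rightarrow> bool" where
  "splits_differentially W F E \<beta> n \<longleftrightarrow>
     (\<exists>D. differential_operator W E F n D \<and>
        (\<forall>U. openin (base W) U \<longrightarrow> (\<forall>s\<in>carrier (sect E U). \<beta> U (D U s) = s)))"


section \<open>Sheaf cohomology\<close>

text \<open>
  Cohomology is the cohomology of global sections of Godement's canonical simplicial flasque
  resolution, written out as in Godement's book (II.6.4). If \<open>\<G>F\<close> denotes the
  sheaf \<open>U \<mapsto> (\<Pi> x\<in>U. F\<^sub>x)\<close>, the resolution is \<open>\<G>F \<rightarrow> \<G>\<G>F \<rightarrow> \<dots>\<close>, with alternating sums of the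
  maps obtained from the unit \<open>F \<rightarrow> \<G>F\<close> as differentials. Unfolding the iterated
  stalks, a global section of the term of degree \<open>n\<close> is a function that assigns to every
  tuple \<open>x\<^sub>0, \<dots>, x\<^sub>n\<close> a germ in the stalk at \<open>x\<^sub>n\<close>, where two functions are identified if they agree
  for all \<open>x\<^sub>0\<close>, for all \<open>x\<^sub>1\<close> near \<open>x\<^sub>0\<close>, and so on until: for all \<open>x\<^sub>n\<close> near \<open>x\<^sub>n\<^sub>-\<^sub>1\<close>, where the last
  neighbourhood may depend on all of \<open>x\<^sub>0, \<dots>, x\<^sub>n\<^sub>-\<^sub>1\<close>. Below, \<open>cochains\<close> is the group of the functions
  and \<open>null_cochains\<close> the subgroup of those identified with zero. The group of cohomology is formed
  as cocycles modulo coboundaries, both taken as preimages in \<open>cochains\<close>.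
\<close>

definition tuples :: "'x topology \<Rightarrow> nat \<Rightarrow> 'x list set" where
  "tuples T n = {xs. length xs = Suc n \<and> set xs \<subseteq> topspace T}"

primrec near :: "'x topology \<Rightarrow> nat \<Rightarrow> 'x set \<Rightarrow> ('x list \<Rightarrow> bool) \<Rightarrow> bool" where
  "near T 0 U P \<longleftrightarrow> (\<forall>x\<in>U. P [x])"
| "near T (Suc n) U P \<longleftrightarrow>
     (\<forall>x\<in>U. \<exists>V. openin T V \<and> x \<in> V \<and> near T n V (\<lambda>xs. P (x # xs)))"

definition cochains ::
    "'x topology \<Rightarrow> ('x, 's) group_presheaf \<Rightarrow> nat \<Rightarrow> ('x list \<Rightarrow> ('x set \<times> 's) set) monoid" where
  "cochains T F n = product_group (tuples T n) (\<lambda>xs. stalk T F (last xs))"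

definition null_cochains ::
    "'x topology \<Rightarrow> ('x, 's) group_presheaf \<Rightarrow> nat \<Rightarrow> ('x list \<Rightarrow> ('x set \<times> 's) set) set" where
  "null_cochains T F n = {f \<in> carrier (cochains T F n).
     near T n (topspace T) (\<lambda>xs. f xs = \<one>\<^bsub>stalk T F (last xs)\<^esub>)}"

text \<open>
  The germ at a nearby point \<open>y\<close> of a section representing the germ \<open>g\<close>. The choice of the
  representative affects the differential below only by null cochains.
\<close>

definition spread_germ ::
    "'x topology \<Rightarrow> ('x, 's) group_presheaf \<Rightarrow> ('x set \<times> 's) set \<Rightarrow> 'x \<Rightarrow> ('x set \<times> 's) set" where
  "spread_germ T F g y =
     (let (U, s) = (SOME p. p \<in> g) in if y \<in> U then germ T F y U s else \<one>\<^bsub>stalk T F y\<^esub>)"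

definition omit :: "nat \<Rightarrow> 'x list \<Rightarrow> 'x list" where
  "omit i xs = take i xs @ drop (Suc i) xs"

text \<open>
  The alternating sum of the faces, in multiplicative notation. In the last face the germ
  at \<open>x\<^sub>n\<close> has to be moved to \<open>x\<^sub>n\<^sub>+\<^sub>1\<close>.
\<close>

definition coboundary ::
    "'x topology \<Rightarrow> ('x, 's) group_presheaf \<Rightarrow> nat \<Rightarrow> ('x list \<Rightarrow> ('x set \<times> 's) set)
      \<Rightarrow> 'x list \<Rightarrow> ('x set \<times> 's) set" where
  "coboundary T F n f = (\<lambda>xs\<in>tuples T (Suc n).
     finprod (stalk T F (last xs))
       (\<lambda>i. (if i \<le> n then f (omit i xs) else spread_germ T F (f (butlast xs)) (last xs))
              [^]\<^bsub>stalk T F (last xs)\<^esub> ((- 1) ^ i :: int))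
       {..Suc n})"

definition cocycles ::
    "'x topology \<Rightarrow> ('x, 's) group_presheaf \<Rightarrow> nat \<Rightarrow> ('x list \<Rightarrow> ('x set \<times> 's) set) set" where
  "cocycles T F n =
     {f \<in> carrier (cochains T F n). coboundary T F n f \<in> null_cochains T F (Suc n)}"

definition coboundaries ::
    "'x topology \<Rightarrow> ('x, 's) group_presheaf \<Rightarrow> nat \<Rightarrow> ('x list \<Rightarrow> ('x set \<times> 's) set) set" where
  "coboundaries T F n = (case n of 0 \<Rightarrow> null_cochains T F 0
     | Suc m \<Rightarrow> null_cochains T F (Suc m) <#>\<^bsub>cochains T F (Suc m)\<^esub>
         (coboundary T F m ` carrier (cochains T F m)))"

definition cohomology ::
    "'x topology \<Rightarrow> ('x, 's) group_presheaf \<Rightarrow> nat \<Rightarrow> ('x list \<Rightarrow> ('x set \<times> 's) set) set monoid" where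
  "cohomology T F n = (cochains T F n)\<lparr>carrier := cocycles T F n\<rparr> Mod coboundaries T F n"

text \<open>
  The map in cohomology along the inclusion of a subspace \<open>S\<close> of \<open>T\<close> induced by a
  compatible family of homomorphisms \<open>\<phi> U\<close> from \<open>F(U)\<close> to \<open>F'(U \<inter> S)\<close>, where \<open>F'\<close> is a sheaf on \<open>S\<close>.
\<close>

definition stalk_map ::
    "'x topology \<Rightarrow> 'x set \<Rightarrow> ('x, ('t, 'z) partial_object_scheme, 't) presheaf
      \<Rightarrow> ('x set \<Rightarrow> 's \<Rightarrow> 't) \<Rightarrow> 'x \<Rightarrow> ('x set \<times> 's) set \<Rightarrow> ('x set \<times> 't) set" where
  "stalk_map T S F' \<phi> x g = (\<Union>(U, s)\<in>g. germ (subtopology T S) F' x (U \<inter> S) (\<phi> U s))"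

definition cohomology_map ::
    "'x topology \<Rightarrow> 'x set \<Rightarrow> ('x, 't) group_presheaf \<Rightarrow> ('x set \<Rightarrow> 's \<Rightarrow> 't) \<Rightarrow> nat
      \<Rightarrow> ('x list \<Rightarrow> ('x set \<times> 's) set) set \<Rightarrow> ('x list \<Rightarrow> ('x set \<times> 't) set) set" where
  "cohomology_map T S F' \<phi> n c =
     coboundaries (subtopology T S) F' n <#>\<^bsub>cochains (subtopology T S) F' n\<^esub>
       ((\<lambda>f. \<lambda>xs\<in>tuples (subtopology T S) n. stalk_map T S F' \<phi> (last xs) (f xs)) ` c)"


section \<open>The global lifting criterion\<close>

definition to_inf_sheaf ::
    "('x, 'r) cspace \<Rightarrow> ('x set \<Rightarrow> 'r set) \<Rightarrow> ('x, 'r, 'm) module_presheaf \<Rightarrow> nat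
      \<Rightarrow> 'x set \<Rightarrow> 'm \<Rightarrow> 'x \<Rightarrow> ('x set \<times> 'm set) set" where
  "to_inf_sheaf W I E n U s = (\<lambda>y\<in>U \<inter> subscheme_space W I.
     germ (base W) (inf_presheaf W I E n) y U
       (ideal_times_module W (ideal_power W I (n + 1)) E U #>\<^bsub>additive_group (sect E U)\<^esub> s))"

text \<open>
  For \<open>n \<le> k\<close>, the projection from \<open>inf_sheaf W I E k\<close> to \<open>inf_sheaf W I E n\<close>. The stalks of
  both are stalks of presheaves on all of \<open>W\<close>, hence the whole space as second argument
  of \<open>stalk_map\<close>.
\<close>

definition inf_sheaf_proj ::
    "('x, 'r) cspace \<Rightarrow> ('x set \<Rightarrow> 'r set) \<Rightarrow> ('x, 'r, 'm) module_presheaf \<Rightarrow> nat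
      \<Rightarrow> 'x set \<Rightarrow> ('x \<Rightarrow> ('x set \<times> 'm set) set) \<Rightarrow> 'x \<Rightarrow> ('x set \<times> 'm set) set" where
  "inf_sheaf_proj W I E n V s = (\<lambda>y\<in>V.
     stalk_map (base W) (topspace (base W)) (inf_presheaf W I E n)
       (\<lambda>U c. ideal_times_module W (ideal_power W I (n + 1)) E U <#>\<^bsub>additive_group (sect E U)\<^esub> c)
       y (s y))"

definition restrict_global ::
    "('x, 'r) cspace \<Rightarrow> ('x set \<Rightarrow> 'r set) \<Rightarrow> ('x, 'r, 'm) module_presheaf \<Rightarrow> nat \<Rightarrow> nat
      \<Rightarrow> ('x list \<Rightarrow> ('x set \<times> 'm) set) set
      \<Rightarrow> ('x list \<Rightarrow> ('x set \<times> ('x \<Rightarrow> ('x set \<times> 'm set) set)) set) set" where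
  "restrict_global W I E p n =
     cohomology_map (base W) (subscheme_space W I) (inf_sheaf W I E n) (to_inf_sheaf W I E n) p"

definition restrict_inf ::
    "('x, 'r) cspace \<Rightarrow> ('x set \<Rightarrow> 'r set) \<Rightarrow> ('x, 'r, 'm) module_presheaf \<Rightarrow> nat \<Rightarrow> nat
      \<Rightarrow> ('x list \<Rightarrow> ('x set \<times> ('x \<Rightarrow> ('x set \<times> 'm set) set)) set) set
      \<Rightarrow> ('x list \<Rightarrow> ('x set \<times> ('x \<Rightarrow> ('x set \<times> 'm set) set)) set) set" where
  "restrict_inf W I E p n =
     cohomology_map (inf_space W I) (topspace (inf_space W I)) (inf_sheaf W I E n)
       (inf_sheaf_proj W I E n) p"

definition global_lifting_criterion ::
    "('x, 'r) cspace \<Rightarrow> ('x set \<Rightarrow> 'r set) \<Rightarrow> ('x, 'r, 'm) module_presheaf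
      \<Rightarrow> nat \<Rightarrow> nat \<Rightarrow> nat \<Rightarrow> bool" where
  "global_lifting_criterion W I E p level n \<longleftrightarrow>
     restrict_global W I E p n ` carrier (cohomology (base W) (additive_sheaf E) p) =
     restrict_inf W I E p n `
       carrier (cohomology (inf_space W I) (inf_sheaf W I E (n + level)) p)"

end

theory Submission
  imports Defs
begin

text \<open>
  Write \<open>E\<^sub>(\<^sub>k\<^sub>)\<close> for \<open>E/I\<^sup>k\<^sup>+\<^sup>1E\<close>, let \<open>X\<close> be the subscheme defined by \<open>I\<close>, and let \<open>D : E \<rightarrow> F\<close> be
  a differential operator of order at most \<open>l\<close> with \<open>\<beta> \<circ> D = id\<close>. The operator \<open>D\<close> need not be
  linear, so it need not act on \<open>E\<^sub>(\<^sub>k\<^sub>)\<close>, but it loses at most \<open>l\<close> powers of the ideal: it maps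
  \<open>I\<^sup>k\<^sup>+\<^sup>lE\<close> into \<open>I\<^sup>kF\<close> (lemma \<open>diff_operator_IM\<close>). It therefore induces additive maps
  \<open>E\<^sub>(\<^sub>k\<^sub>+\<^sub>l\<^sub>) \<rightarrow> F\<^sub>(\<^sub>k\<^sub>)\<close>, and following such a map by the projection \<open>F\<^sub>(\<^sub>k\<^sub>) \<rightarrow> F\<^sub>(\<^sub>\<nu>\<^sub>)\<close> and by
  \<open>\<beta> : F\<^sub>(\<^sub>\<nu>\<^sub>) \<rightarrow> E\<^sub>(\<^sub>\<nu>\<^sub>)\<close> gives the projection \<open>E\<^sub>(\<^sub>k\<^sub>+\<^sub>l\<^sub>) \<rightarrow> E\<^sub>(\<^sub>\<nu>\<^sub>)\<close>.
  
  Now take a class \<open>e\<close> in the cohomology of \<open>E\<close> at level \<open>\<nu> + l + \<mu>\<close>. The class \<open>D e\<close> lives at level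
  \<open>\<nu> + \<mu>\<close> for \<open>F\<close>, so by the criterion for \<open>F\<close> its restriction to level \<open>\<nu>\<close> is the
  restriction of a global class \<open>f\<close>. Then \<open>\<beta> f\<close> is a global class of \<open>E\<close> whose restriction to level \<open>\<nu>\<close>
  is \<open>\<beta> (D e) = e\<close>. The other inclusion says only that restricting a global class to level \<open>\<nu>\<close> may be
  done in two steps.
  
  What this argument needs from cohomology is functoriality for additive sheaf maps, here on explicit
  cochains. A map of presheaves acts on cochains stalk by stalk
  (\<open>cochain_map\<close>), and this action is strictly functorial; so every identity between sheaf maps used
  above holds already for cochains. The differential involves a choice of representatives of
  germs, so it is additive and natural only up to null cochains
  (\<open>coboundary_mult_near\<close>, \<open>cochain_map_coboundary\<close>); this is enough for cocycles and
  coboundaries to be preserved, and for the map in cohomology to send the class of a cocycle to the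
  class of its image (\<open>cohomology_map_class\<close>). The maps on infinitesimal neighbourhoods come from
  presheaf maps on the whole space that respect the submodules \<open>I\<^sup>k\<^sup>+\<^sup>1E\<close>, by passing to quotients
  (\<open>quot_map\<close>) and then to families of germs along \<open>X\<close> (\<open>stalkwise\<close>).
\<close>

section \<open>Stalks of presheaves of abelian groups\<close>

text \<open>
  Maps between quotients are written throughout as \<open>c \<mapsto> K <#> h ` c\<close>: for the restriction maps of
  a quotient presheaf, for the maps induced between quotient presheaves, and for the maps in
  cohomology. They all send the coset of \<open>a\<close> to the coset of \<open>h a\<close>. Submonoids are used
  because for coboundaries only closure under products is established.
\<close>

lemma image_of_coset:
  assumes "group A" and "group B" and h: "h \<in> hom A B"
    and H: "submonoid H A" and K: "submonoid K B" and HK: "h ` H \<subseteq> K" and a: "a \<in> carrier A"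
  shows "K <#>\<^bsub>B\<^esub> (h ` (H #>\<^bsub>A\<^esub> a)) = K #>\<^bsub>B\<^esub> h a"
proof -
  interpret A: group A by fact
  interpret B: group B by fact
  note Hs = submonoid.subset[OF H] and Ks = submonoid.subset[OF K]
  have ha: "h a \<in> carrier B" using h a by (auto simp: hom_def)
  have split: "h (x \<otimes>\<^bsub>A\<^esub> a) = h x \<otimes>\<^bsub>B\<^esub> h a" if "x \<in> H" for x
    using that Hs a h by (auto simp: hom_def)
  show ?thesis
  proof
    show "K <#>\<^bsub>B\<^esub> (h ` (H #>\<^bsub>A\<^esub> a)) \<subseteq> K #>\<^bsub>B\<^esub> h a"
    proof
      fix z assume "z \<in> K <#>\<^bsub>B\<^esub> (h ` (H #>\<^bsub>A\<^esub> a))"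
      then obtain k x where k: "k \<in> K" and x: "x \<in> H" and z: "z = k \<otimes>\<^bsub>B\<^esub> h (x \<otimes>\<^bsub>A\<^esub> a)"
        by (auto simp: set_mult_def r_coset_def)
      have hx: "h x \<in> K" using HK x by auto
      have "z = (k \<otimes>\<^bsub>B\<^esub> h x) \<otimes>\<^bsub>B\<^esub> h a"
        using z split[OF x] k hx Ks ha by (simp add: B.m_assoc subsetD)
      then show "z \<in> K #>\<^bsub>B\<^esub> h a"
        using submonoid.m_closed[OF K k hx] by (auto simp: r_coset_def)
    qed
    show "K #>\<^bsub>B\<^esub> h a \<subseteq> K <#>\<^bsub>B\<^esub> (h ` (H #>\<^bsub>A\<^esub> a))"
    proof
      fix z assume "z \<in> K #>\<^bsub>B\<^esub> h a"
      then obtain k where k: "k \<in> K" and z: "z = k \<otimes>\<^bsub>B\<^esub> h a" by (auto simp: r_coset_def)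
      have "a \<in> H #>\<^bsub>A\<^esub> a"
        using submonoid.one_closed[OF H] a by (force simp: r_coset_def)
      then show "z \<in> K <#>\<^bsub>B\<^esub> (h ` (H #>\<^bsub>A\<^esub> a))"
        using k z by (auto simp: set_mult_def)
    qed
  qed
qed

locale ab_presheaf =
  fixes T :: "'x topology" and F :: "('x, 's) group_presheaf"
  assumes presheaf: "is_presheaf T F"
    and sect_group: "openin T U \<Longrightarrow> comm_group (sect F U)"
    and rstr_hom: "openin T U \<Longrightarrow> openin T V \<Longrightarrow> V \<subseteq> U \<Longrightarrow> rstr F U V \<in> hom (sect F U) (sect F V)"
begin

lemma rstr_closed:
  "openin T U \<Longrightarrow> openin T V \<Longrightarrow> V \<subseteq> U \<Longrightarrow> s \<in> carrier (sect F U) \<Longrightarrow> rstr F U V s \<in> carrier (sect F V)"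
  using rstr_hom by (auto simp: hom_def)

lemma rstr_mult:
  "openin T U \<Longrightarrow> openin T V \<Longrightarrow> V \<subseteq> U \<Longrightarrow> s \<in> carrier (sect F U) \<Longrightarrow> t \<in> carrier (sect F U) \<Longrightarrow>
    rstr F U V (s \<otimes>\<^bsub>sect F U\<^esub> t) = rstr F U V s \<otimes>\<^bsub>sect F V\<^esub> rstr F U V t"
  using rstr_hom by (auto simp: hom_def)

lemma rstr_one:
  "openin T U \<Longrightarrow> openin T V \<Longrightarrow> V \<subseteq> U \<Longrightarrow> rstr F U V \<one>\<^bsub>sect F U\<^esub> = \<one>\<^bsub>sect F V\<^esub>"
  using hom_one[OF rstr_hom] sect_group comm_group_def by metis

lemma rstr_self: "openin T U \<Longrightarrow> s \<in> carrier (sect F U) \<Longrightarrow> rstr F U U s = s"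
  using presheaf by (auto simp: is_presheaf_def)

lemma rstr_rstr:
  "openin T U \<Longrightarrow> openin T V \<Longrightarrow> openin T V' \<Longrightarrow> V' \<subseteq> V \<Longrightarrow> V \<subseteq> U \<Longrightarrow> s \<in> carrier (sect F U) \<Longrightarrow>
    rstr F V V' (rstr F U V s) = rstr F U V' s"
  using presheaf unfolding is_presheaf_def by blast

lemma germ_refl:
  "openin T U \<Longrightarrow> x \<in> U \<Longrightarrow> s \<in> carrier (sect F U) \<Longrightarrow> (U, s) \<in> germ T F x U s"
  unfolding germ_def by auto

lemma germ_eqI:
  assumes U: "openin T U" "s \<in> carrier (sect F U)" and V: "openin T V" "t \<in> carrier (sect F V)"
    and W: "openin T W" "x \<in> W" "W \<subseteq> U \<inter> V" and eq: "rstr F U W s = rstr F V W t"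
  shows "germ T F x U s = germ T F x V t"
proof -
  have *: "germ T F x U s \<subseteq> germ T F x V t"
    if U: "openin T U" "s \<in> carrier (sect F U)" and V: "openin T V" "t \<in> carrier (sect F V)"
      and W: "openin T W" "x \<in> W" "W \<subseteq> U \<inter> V" and eq: "rstr F U W s = rstr F V W t" for U V W s t
  proof
    fix p assume "p \<in> germ T F x U s"
    then obtain U' s' V' where p: "p = (U', s')" "openin T U'" "x \<in> U'" "s' \<in> carrier (sect F U')"
      and V': "openin T V'" "x \<in> V'" "V' \<subseteq> U \<inter> U'" and eq': "rstr F U V' s = rstr F U' V' s'"
      by (auto simp: germ_def)
    let ?N = "W \<inter> V'"
    have N: "openin T ?N" using W V' by auto
    have "rstr F V ?N t = rstr F W ?N (rstr F V W t)"
      using rstr_rstr[of V W ?N t] V W N by auto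
    also have "\<dots> = rstr F U ?N s"
      using rstr_rstr[of U W ?N s] U W N eq by auto
    also have "\<dots> = rstr F V' ?N (rstr F U V' s)"
      using rstr_rstr[of U V' ?N s] U V' N by auto
    also have "\<dots> = rstr F U' ?N s'"
      using rstr_rstr[of U' V' ?N s'] p V' N eq' by auto
    finally show "p \<in> germ T F x V t"
      unfolding germ_def using p N W V' by blast
  qed
  from *[OF U V W eq] *[OF V U _ _ _ eq[symmetric]] W show ?thesis by blast
qed

text \<open>
  A germ is the set of all its representatives, so membership recovers every representation of it.
\<close>

lemma germ_memberD:
  assumes "openin T U" "s \<in> carrier (sect F U)" and "(V, t) \<in> germ T F x U s"
  shows "openin T V" "x \<in> V" "t \<in> carrier (sect F V)" "germ T F x V t = germ T F x U s"
    and "\<exists>W. openin T W \<and> x \<in> W \<and> W \<subseteq> U \<inter> V \<and> rstr F U W s = rstr F V W t"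
proof -
  from assms(3) obtain W where W: "openin T W" "x \<in> W" "W \<subseteq> U \<inter> V" "rstr F U W s = rstr F V W t"
    and V: "openin T V" "x \<in> V" "t \<in> carrier (sect F V)"
    by (auto simp: germ_def)
  then show "openin T V" "x \<in> V" "t \<in> carrier (sect F V)"
    "\<exists>W. openin T W \<and> x \<in> W \<and> W \<subseteq> U \<inter> V \<and> rstr F U W s = rstr F V W t" by blast+
  show "germ T F x V t = germ T F x U s"
    using germ_eqI[OF assms(1,2) V(1,3) W] by simp
qed

lemma germ_rstr:
  assumes "openin T U" "openin T V" "V \<subseteq> U" "x \<in> V" "s \<in> carrier (sect F U)"
  shows "germ T F x V (rstr F U V s) = germ T F x U s"
proof (rule germ_eqI[where W = V])
  show "rstr F V V (rstr F U V s) = rstr F U V s"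
    using assms rstr_self rstr_closed by blast
qed (use assms rstr_closed in auto)

lemma germ_in_stalk:
  "openin T U \<Longrightarrow> x \<in> U \<Longrightarrow> s \<in> carrier (sect F U) \<Longrightarrow> germ T F x U s \<in> carrier (stalk T F x)"
  unfolding stalk_def by auto

lemma stalkE:
  assumes "g \<in> carrier (stalk T F x)"
  obtains U s where "openin T U" "x \<in> U" "s \<in> carrier (sect F U)" "g = germ T F x U s"
  using assms unfolding stalk_def by auto

lemma stalk_member:
  assumes "g \<in> carrier (stalk T F x)" "(U, s) \<in> g"
  shows "openin T U" "x \<in> U" "s \<in> carrier (sect F U)" "g = germ T F x U s"
proof -
  obtain V t where V: "openin T V" "t \<in> carrier (sect F V)" and g: "g = germ T F x V t"
    using stalkE[OF assms(1)] by metis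
  note * = germ_memberD[OF V assms(2)[unfolded g]]
  show "openin T U" "x \<in> U" "s \<in> carrier (sect F U)" "g = germ T F x U s"
    using * g by auto
qed

lemma stalk_nonempty:
  assumes "g \<in> carrier (stalk T F x)" shows "g \<noteq> {}"
  using stalkE[OF assms] germ_refl by (metis empty_iff)

text \<open>
  Functions of germs are defined as unions over all representatives; such a union is the common value.
\<close>

lemma UN_stalk_eq:
  assumes "g \<in> carrier (stalk T F x)"
    and "\<And>U s. openin T U \<Longrightarrow> x \<in> U \<Longrightarrow> s \<in> carrier (sect F U) \<Longrightarrow> g = germ T F x U s \<Longrightarrow> c U s = d"
  shows "(\<Union>(U, s)\<in>g. c U s) = d"
proof -
  have "c U s = d" if "(U, s) \<in> g" for U s
    using assms(2) stalk_member[OF assms(1) that] by blast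
  then show ?thesis using stalk_nonempty[OF assms(1)] by auto
qed

text \<open>
  The group laws in a stalk reduce to those of the sections over one open set once finitely many
  germs are represented over the same neighbourhood.
\<close>

lemma common_domain:
  assumes "g \<in> carrier (stalk T F x)" "openin T V" "x \<in> V"
  obtains U s where "openin T U" "x \<in> U" "U \<subseteq> V" "s \<in> carrier (sect F U)" "g = germ T F x U s"
proof -
  obtain U s where U: "openin T U" "x \<in> U" "s \<in> carrier (sect F U)" "g = germ T F x U s"
    using stalkE[OF assms(1)] by metis
  show ?thesis
  proof
    show "openin T (U \<inter> V)" "x \<in> U \<inter> V" "U \<inter> V \<subseteq> V" using U assms by auto
    then show "rstr F U (U \<inter> V) s \<in> carrier (sect F (U \<inter> V))"
      using rstr_closed U by auto
    show "g = germ T F x (U \<inter> V) (rstr F U (U \<inter> V) s)"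
      using germ_rstr[of U "U \<inter> V" x s] U assms by auto
  qed
qed

lemma common_domain2:
  assumes g: "g \<in> carrier (stalk T F x)" and h: "h \<in> carrier (stalk T F x)"
  obtains U s t where "openin T U" "x \<in> U" "s \<in> carrier (sect F U)" "t \<in> carrier (sect F U)"
    "g = germ T F x U s" "h = germ T F x U t"
proof -
  obtain V s where V: "openin T V" "x \<in> V" "s \<in> carrier (sect F V)" "g = germ T F x V s"
    using stalkE[OF g] by metis
  obtain U t where U: "openin T U" "x \<in> U" "U \<subseteq> V" "t \<in> carrier (sect F U)" "h = germ T F x U t"
    using common_domain[OF h V(1,2)] by metis
  show ?thesis
    using that[of U "rstr F V U s" t] U V rstr_closed[of V U s] germ_rstr[of V U x s] by simp
qed

lemma common_domain3:
  assumes g: "g \<in> carrier (stalk T F x)" and h: "h \<in> carrier (stalk T F x)"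
    and k: "k \<in> carrier (stalk T F x)"
  obtains U s t u where "openin T U" "x \<in> U" "s \<in> carrier (sect F U)" "t \<in> carrier (sect F U)"
    "u \<in> carrier (sect F U)" "g = germ T F x U s" "h = germ T F x U t" "k = germ T F x U u"
proof -
  obtain V s t where V: "openin T V" "x \<in> V" "s \<in> carrier (sect F V)" "t \<in> carrier (sect F V)"
    "g = germ T F x V s" "h = germ T F x V t"
    using common_domain2[OF g h] by metis
  obtain U u where U: "openin T U" "x \<in> U" "U \<subseteq> V" "u \<in> carrier (sect F U)" "k = germ T F x U u"
    using common_domain[OF k V(1,2)] by metis
  show ?thesis
    using that[of U "rstr F V U s" "rstr F V U t" u] U V rstr_closed[of V U]
      germ_rstr[of V U x] by simp
qed

lemma germ_mult:
  assumes U: "openin T U" "x \<in> U" and s: "s \<in> carrier (sect F U)" and t: "t \<in> carrier (sect F U)"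
  shows "germ T F x U s \<otimes>\<^bsub>stalk T F x\<^esub> germ T F x U t = germ T F x U (s \<otimes>\<^bsub>sect F U\<^esub> t)"
proof -
  let ?g = "germ T F x U s" and ?h = "germ T F x U t"
  have "germ T F x (U1 \<inter> U2) (rstr F U1 (U1 \<inter> U2) s1 \<otimes>\<^bsub>sect F (U1 \<inter> U2)\<^esub> rstr F U2 (U1 \<inter> U2) s2)
      = germ T F x U (s \<otimes>\<^bsub>sect F U\<^esub> t)"
    if 1: "openin T U1" "x \<in> U1" "s1 \<in> carrier (sect F U1)" "?g = germ T F x U1 s1"
      and 2: "openin T U2" "x \<in> U2" "s2 \<in> carrier (sect F U2)" "?h = germ T F x U2 s2"
    for U1 s1 U2 s2
  proof -
    obtain W1 where W1: "openin T W1" "x \<in> W1" "W1 \<subseteq> U \<inter> U1" "rstr F U W1 s = rstr F U1 W1 s1"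
      using germ_memberD(5)[of U s U1 s1 x] germ_refl[of U1 x s1] 1 U s by auto
    obtain W2 where W2: "openin T W2" "x \<in> W2" "W2 \<subseteq> U \<inter> U2" "rstr F U W2 t = rstr F U2 W2 s2"
      using germ_memberD(5)[of U t U2 s2 x] germ_refl[of U2 x s2] 2 U t by auto
    let ?W = "W1 \<inter> W2" and ?V = "U1 \<inter> U2"
    have W: "openin T ?W" and V: "openin T ?V" using W1 W2 1 2 by auto
    have e1: "rstr F U ?W s = rstr F U1 ?W s1"
      using rstr_rstr[of U W1 ?W s] rstr_rstr[of U1 W1 ?W s1] W1 W U s 1 by auto
    have e2: "rstr F U ?W t = rstr F U2 ?W s2"
      using rstr_rstr[of U W2 ?W t] rstr_rstr[of U2 W2 ?W s2] W2 W U t 2 by auto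
    have sub: "?W \<subseteq> ?V" "?W \<subseteq> U" using W1 W2 by auto
    interpret V: comm_group "sect F ?V" using sect_group V .
    interpret U: comm_group "sect F U" using sect_group U by blast
    have c1: "rstr F U1 ?V s1 \<in> carrier (sect F ?V)" "rstr F U2 ?V s2 \<in> carrier (sect F ?V)"
      using rstr_closed 1 2 V by auto
    show ?thesis
    proof (rule germ_eqI[where W = ?W])
      have "rstr F ?V ?W (rstr F U1 ?V s1 \<otimes>\<^bsub>sect F ?V\<^esub> rstr F U2 ?V s2)
          = rstr F U1 ?W s1 \<otimes>\<^bsub>sect F ?W\<^esub> rstr F U2 ?W s2"
        using rstr_mult[OF V W sub(1) c1] rstr_rstr[of U1 ?V ?W s1] rstr_rstr[of U2 ?V ?W s2]
          1 2 V W sub by auto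
      also have "\<dots> = rstr F U ?W (s \<otimes>\<^bsub>sect F U\<^esub> t)"
        using rstr_mult[OF U(1) W sub(2) s t] e1 e2 by simp
      finally show "rstr F ?V ?W (rstr F U1 ?V s1 \<otimes>\<^bsub>sect F ?V\<^esub> rstr F U2 ?V s2)
          = rstr F U ?W (s \<otimes>\<^bsub>sect F U\<^esub> t)" .
    qed (use U W V W1 W2 s t c1 in auto)
  qed
  then show ?thesis
    using germ_in_stalk[OF U s] germ_in_stalk[OF U t]
    unfolding stalk_def monoid.simps partial_object.simps
    by (intro UN_stalk_eq) (auto simp: stalk_def)
qed

lemma germ_one:
  assumes "openin T U" "x \<in> U"
  shows "germ T F x U \<one>\<^bsub>sect F U\<^esub> = \<one>\<^bsub>stalk T F x\<^esub>"
proof -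
  have "U \<subseteq> topspace T" using assms openin_subset by blast
  moreover have "\<one>\<^bsub>sect F (topspace T)\<^esub> \<in> carrier (sect F (topspace T))"
    using sect_group[of "topspace T"]
    by (simp add: comm_group_def group.is_monoid monoid.one_closed)
  ultimately show ?thesis
    using germ_rstr[of "topspace T" U x "\<one>\<^bsub>sect F (topspace T)\<^esub>"] rstr_one[of "topspace T" U] assms
    by (simp add: stalk_def)
qed

lemma stalk_comm_group:
  assumes x: "x \<in> topspace T" shows "comm_group (stalk T F x)"
proof (rule comm_groupI)
  show "\<one>\<^bsub>stalk T F x\<^esub> \<in> carrier (stalk T F x)"
    using germ_in_stalk[of "topspace T" x "\<one>\<^bsub>sect F (topspace T)\<^esub>"] germ_one[of "topspace T" x]
      sect_group[of "topspace T"] x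
    by (simp add: comm_group_def group.is_monoid monoid.one_closed)
next
  fix g h assume g: "g \<in> carrier (stalk T F x)" and h: "h \<in> carrier (stalk T F x)"
  obtain U s t where U: "openin T U" "x \<in> U" "s \<in> carrier (sect F U)" "t \<in> carrier (sect F U)"
    "g = germ T F x U s" "h = germ T F x U t" using common_domain2[OF g h] by metis
  interpret U: comm_group "sect F U" using sect_group U by blast
  show "g \<otimes>\<^bsub>stalk T F x\<^esub> h \<in> carrier (stalk T F x)"
    using U germ_mult germ_in_stalk by simp
  show "g \<otimes>\<^bsub>stalk T F x\<^esub> h = h \<otimes>\<^bsub>stalk T F x\<^esub> g"
    using U germ_mult by (simp add: U.m_comm)
next
  fix g h k assume g: "g \<in> carrier (stalk T F x)" and h: "h \<in> carrier (stalk T F x)"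
    and k: "k \<in> carrier (stalk T F x)"
  obtain U s t u where U: "openin T U" "x \<in> U" "s \<in> carrier (sect F U)" "t \<in> carrier (sect F U)"
    "u \<in> carrier (sect F U)" "g = germ T F x U s" "h = germ T F x U t" "k = germ T F x U u"
    using common_domain3[OF g h k] by metis
  interpret U: comm_group "sect F U" using sect_group U by blast
  show "g \<otimes>\<^bsub>stalk T F x\<^esub> h \<otimes>\<^bsub>stalk T F x\<^esub> k = g \<otimes>\<^bsub>stalk T F x\<^esub> (h \<otimes>\<^bsub>stalk T F x\<^esub> k)"
    using U germ_mult by (simp add: U.m_assoc)
next
  fix g assume g: "g \<in> carrier (stalk T F x)"
  obtain U s where U: "openin T U" "x \<in> U" "s \<in> carrier (sect F U)" "g = germ T F x U s"
    using stalkE[OF g] by metis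
  interpret U: comm_group "sect F U" using sect_group U by blast
  show "\<one>\<^bsub>stalk T F x\<^esub> \<otimes>\<^bsub>stalk T F x\<^esub> g = g"
    using U germ_mult germ_one[OF U(1,2), symmetric] by simp
  have "germ T F x U (inv\<^bsub>sect F U\<^esub> s) \<otimes>\<^bsub>stalk T F x\<^esub> g = \<one>\<^bsub>stalk T F x\<^esub>"
    using U germ_mult germ_one[OF U(1,2), symmetric] by simp
  then show "\<exists>h\<in>carrier (stalk T F x). h \<otimes>\<^bsub>stalk T F x\<^esub> g = \<one>\<^bsub>stalk T F x\<^esub>"
    using germ_in_stalk[OF U(1,2)] U by blast
qed

lemma spread_germ_closed:
  assumes g: "g \<in> carrier (stalk T F x)" and y: "y \<in> topspace T"
  shows "spread_germ T F g y \<in> carrier (stalk T F y)"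
proof -
  obtain U s where Us: "(SOME p. p \<in> g) = (U, s)" by fastforce
  moreover have "(SOME p. p \<in> g) \<in> g"
    using stalk_nonempty[OF g] by (simp add: some_in_eq)
  ultimately have "(U, s) \<in> g" by simp
  note * = stalk_member[OF g this]
  show ?thesis
    using *(1-3) germ_in_stalk stalk_comm_group[OF y]
    by (simp add: spread_germ_def Us comm_group_def group.is_monoid monoid.one_closed)
qed

text \<open>
  The representative chosen in \<open>spread_germ\<close> agrees with any given one near \<open>x\<close>, so the choice is
  invisible after shrinking the neighbourhood.
\<close>

lemma spread_germ_near:
  assumes U: "openin T U" "x \<in> U" "s \<in> carrier (sect F U)"
  shows "\<exists>V. openin T V \<and> x \<in> V \<and> V \<subseteq> U \<and>
    (\<forall>y\<in>V. spread_germ T F (germ T F x U s) y = germ T F y U s)"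
proof -
  let ?g = "germ T F x U s"
  obtain U' s' where Us: "(SOME p. p \<in> ?g) = (U', s')" by fastforce
  moreover have "(SOME p. p \<in> ?g) \<in> ?g"
    using germ_refl[OF U] by (meson someI)
  ultimately have "(U', s') \<in> ?g" by simp
  note * = germ_memberD[OF U(1,3) this]
  obtain V where V: "openin T V" "x \<in> V" "V \<subseteq> U \<inter> U'" "rstr F U V s = rstr F U' V s'"
    using *(5) by blast
  have "spread_germ T F ?g y = germ T F y U s" if "y \<in> V" for y
    using germ_eqI[OF U(1,3) *(1,3) V(1) that V(3,4)] that V(3) by (auto simp: spread_germ_def Us)
  then show ?thesis using V by blast
qed

end

text \<open>
  The target lives on a subspace, so that one notion covers the restriction of sections from the
  whole space to a closed subset and, for \<open>S = topspace T\<close>, maps between presheaves on one space.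
\<close>

locale presheaf_morphism = source: ab_presheaf T F + target: ab_presheaf "subtopology T S" F'
  for T :: "'x topology" and S and F :: "('x, 's) group_presheaf"
    and F' :: "('x, 't) group_presheaf" +
  fixes \<phi> :: "'x set \<Rightarrow> 's \<Rightarrow> 't"
  assumes map_hom: "openin T U \<Longrightarrow> \<phi> U \<in> hom (sect F U) (sect F' (U \<inter> S))"
    and map_rstr: "openin T U \<Longrightarrow> openin T V \<Longrightarrow> V \<subseteq> U \<Longrightarrow> s \<in> carrier (sect F U) \<Longrightarrow>
      \<phi> V (rstr F U V s) = rstr F' (U \<inter> S) (V \<inter> S) (\<phi> U s)"
begin

lemma map_closed: "openin T U \<Longrightarrow> s \<in> carrier (sect F U) \<Longrightarrow> \<phi> U s \<in> carrier (sect F' (U \<inter> S))"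
  using map_hom by (auto simp: hom_def)

lemma open_Int: "openin T U \<Longrightarrow> openin (subtopology T S) (U \<inter> S)"
  by (auto simp: openin_subtopology)

lemma stalk_map_germ:
  assumes U: "openin T U" "x \<in> U" "s \<in> carrier (sect F U)" and x: "x \<in> S"
  shows "stalk_map T S F' \<phi> x (germ T F x U s) = germ (subtopology T S) F' x (U \<inter> S) (\<phi> U s)"
  unfolding stalk_map_def
proof (rule source.UN_stalk_eq[OF source.germ_in_stalk[OF U]])
  fix V t assume V: "openin T V" "x \<in> V" "t \<in> carrier (sect F V)"
    and eq: "germ T F x U s = germ T F x V t"
  obtain N where N: "openin T N" "x \<in> N" "N \<subseteq> V \<inter> U" "rstr F V N t = rstr F U N s"
    using source.germ_memberD(5)[OF V(1,3)] source.germ_refl[OF U] eq by metis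
  show "germ (subtopology T S) F' x (V \<inter> S) (\<phi> V t) = germ (subtopology T S) F' x (U \<inter> S) (\<phi> U s)"
  proof (rule target.germ_eqI[where W = "N \<inter> S"])
    show "rstr F' (V \<inter> S) (N \<inter> S) (\<phi> V t) = rstr F' (U \<inter> S) (N \<inter> S) (\<phi> U s)"
      using N map_rstr[of V N t] map_rstr[of U N s] U V by simp
  qed (use U V N x open_Int map_closed in auto)
qed

lemma stalk_map_hom:
  assumes x: "x \<in> topspace T \<inter> S"
  shows "stalk_map T S F' \<phi> x \<in> hom (stalk T F x) (stalk (subtopology T S) F' x)"
proof (rule homI)
  fix g assume "g \<in> carrier (stalk T F x)"
  then obtain U s where U: "openin T U" "x \<in> U" "s \<in> carrier (sect F U)" "g = germ T F x U s"
    by (rule source.stalkE)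
  then show "stalk_map T S F' \<phi> x g \<in> carrier (stalk (subtopology T S) F' x)"
    using x stalk_map_germ target.germ_in_stalk open_Int map_closed by simp
next
  fix g h assume g: "g \<in> carrier (stalk T F x)" and h: "h \<in> carrier (stalk T F x)"
  obtain U s t where U: "openin T U" "x \<in> U" "s \<in> carrier (sect F U)" "t \<in> carrier (sect F U)"
    "g = germ T F x U s" "h = germ T F x U t" using source.common_domain2[OF g h] by metis
  interpret U: comm_group "sect F U" using source.sect_group U by blast
  have "\<phi> U (s \<otimes>\<^bsub>sect F U\<^esub> t) = \<phi> U s \<otimes>\<^bsub>sect F' (U \<inter> S)\<^esub> \<phi> U t"
    using map_hom[OF U(1)] U by (auto simp: hom_def)
  then show "stalk_map T S F' \<phi> x (g \<otimes>\<^bsub>stalk T F x\<^esub> h) =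
      stalk_map T S F' \<phi> x g \<otimes>\<^bsub>stalk (subtopology T S) F' x\<^esub> stalk_map T S F' \<phi> x h"
    using U x by (simp add: source.germ_mult stalk_map_germ target.germ_mult open_Int map_closed)
qed

end

section \<open>Cochains and cohomology classes\<close>

lemma near_antimono: "near T n U P \<Longrightarrow> U' \<subseteq> U \<Longrightarrow> near T n U' P"
  by (cases n) auto

lemma near_mono:
  assumes "near T n U P" "U \<subseteq> topspace T" "\<And>xs. xs \<in> tuples T n \<Longrightarrow> P xs \<Longrightarrow> Q xs"
  shows "near T n U Q"
  using assms
proof (induction n arbitrary: U P Q)
  case 0
  then show ?case by (auto simp: tuples_def)
next
  case (Suc n)
  have "\<exists>V. openin T V \<and> x \<in> V \<and> near T n V (\<lambda>xs. Q (x # xs))" if x: "x \<in> U" for x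
  proof -
    obtain V where V: "openin T V" "x \<in> V" "near T n V (\<lambda>xs. P (x # xs))"
      using Suc.prems(1) x by auto
    have "near T n V (\<lambda>xs. Q (x # xs))"
    proof (rule Suc.IH[OF V(3)])
      fix xs assume "xs \<in> tuples T n" "P (x # xs)"
      then show "Q (x # xs)"
        using Suc.prems(2,3) x by (auto simp: tuples_def)
    qed (use V openin_subset in blast)
    then show ?thesis using V by blast
  qed
  then show ?case by simp
qed

lemma near_conj:
  assumes "near T n U P" "near T n U Q"
  shows "near T n U (\<lambda>xs. P xs \<and> Q xs)"
  using assms
proof (induction n arbitrary: U P Q)
  case 0
  then show ?case by auto
next
  case (Suc n)
  have "\<exists>V. openin T V \<and> x \<in> V \<and> near T n V (\<lambda>xs. P (x # xs) \<and> Q (x # xs))" if x: "x \<in> U" for x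
  proof -
    obtain V1 V2 where V: "openin T V1" "x \<in> V1" "near T n V1 (\<lambda>xs. P (x # xs))"
      "openin T V2" "x \<in> V2" "near T n V2 (\<lambda>xs. Q (x # xs))"
      using Suc.prems x by fastforce
    have "near T n (V1 \<inter> V2) (\<lambda>xs. P (x # xs) \<and> Q (x # xs))"
      using V by (intro Suc.IH) (auto elim: near_antimono)
    then show ?thesis using V by blast
  qed
  then show ?case by simp
qed

lemma near_all:
  assumes "U \<subseteq> topspace T" "\<And>xs. xs \<in> tuples T n \<Longrightarrow> P xs" shows "near T n U P"
proof -
  have "near T n U (\<lambda>_. True)"
    using assms(1) by (induction n arbitrary: U) (auto intro: exI[where x = "topspace T"])
  then show ?thesis by (rule near_mono) (use assms in auto)
qed

lemma near_subtopology:
  assumes "near T n U P" shows "near (subtopology T S) n (U \<inter> S) P"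
  using assms
proof (induction n arbitrary: U P)
  case 0
  then show ?case by auto
next
  case (Suc n)
  have "\<exists>V. openin (subtopology T S) V \<and> x \<in> V \<and> near (subtopology T S) n V (\<lambda>xs. P (x # xs))"
    if x: "x \<in> U \<inter> S" for x
  proof -
    obtain V where V: "openin T V" "x \<in> V" "near T n V (\<lambda>xs. P (x # xs))"
      using Suc.prems x by auto
    show ?thesis
      using Suc.IH[OF V(3)] V x by (intro exI[where x = "V \<inter> S"]) (auto simp: openin_subtopology)
  qed
  then show ?case by simp
qed

text \<open>
  In the differential only the last face moves a germ from a point to a nearby one. Statements about
  that face are local around the last but one point, which is exactly what \<open>near\<close> allows.
\<close>

lemma near_last:
  assumes "U \<subseteq> topspace T"
    and "\<And>ys. ys \<in> tuples T n \<Longrightarrow> \<exists>V. openin T V \<and> last ys \<in> V \<and> (\<forall>y\<in>V. P (ys @ [y]))"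
  shows "near T (Suc n) U P"
  using assms
proof (induction n arbitrary: U P)
  case 0
  have "\<exists>V. openin T V \<and> x \<in> V \<and> (\<forall>y\<in>V. P [x, y])" if "x \<in> U" for x
    using 0(1) 0(2)[of "[x]"] that by (auto simp: tuples_def)
  then show ?case by auto
next
  case (Suc n)
  have "near T (Suc n) (topspace T) (\<lambda>xs. P (x # xs))" if x: "x \<in> U" for x
  proof (rule Suc.IH)
    fix ys assume "ys \<in> tuples T n"
    then show "\<exists>V. openin T V \<and> last ys \<in> V \<and> (\<forall>y\<in>V. P (x # ys @ [y]))"
      using Suc.prems(2)[of "x # ys"] Suc.prems(1) x by (auto simp: tuples_def split: if_splits)
  qed simp
  then show ?case
    using Suc.prems(1) by (subst near.simps) (meson openin_topspace subsetD)
qed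

\<comment> \<open>The lemmas above apply only to quantifiers that are not unfolded.\<close>
declare near.simps [simp del]

lemma hom_finprod_int_pow:
  assumes "comm_group A" "comm_group B" "h \<in> hom A B" "finite J" "\<And>i. i \<in> J \<Longrightarrow> u i \<in> carrier A"
  shows "h (finprod A (\<lambda>i. u i [^]\<^bsub>A\<^esub> (e i :: int)) J) = finprod B (\<lambda>i. h (u i) [^]\<^bsub>B\<^esub> e i) J"
  using assms(4,5)
proof (induction rule: finite_induct)
  interpret A: comm_group A by fact
  interpret B: comm_group B by fact
  interpret h: group_hom A B h
    by unfold_locales (rule assms)
  {
    case empty
    then show ?case by simp
  next
    case (insert i J)
    have "finprod A (\<lambda>i. u i [^]\<^bsub>A\<^esub> e i) (insert i J)
        = u i [^]\<^bsub>A\<^esub> e i \<otimes>\<^bsub>A\<^esub> finprod A (\<lambda>i. u i [^]\<^bsub>A\<^esub> e i) J"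
      using insert by (intro A.finprod_insert) auto
    moreover have "finprod B (\<lambda>i. h (u i) [^]\<^bsub>B\<^esub> e i) (insert i J)
        = h (u i) [^]\<^bsub>B\<^esub> e i \<otimes>\<^bsub>B\<^esub> finprod B (\<lambda>i. h (u i) [^]\<^bsub>B\<^esub> e i) J"
      using insert by (intro B.finprod_insert) auto
    moreover have "finprod A (\<lambda>i. u i [^]\<^bsub>A\<^esub> e i) J \<in> carrier A"
      using insert by (intro A.finprod_closed) auto
    ultimately show ?case
      using insert by (simp add: h.hom_int_pow)
  }
qed

definition face :: "'x topology \<Rightarrow> ('x, 's) group_presheaf \<Rightarrow> nat \<Rightarrow> ('x list \<Rightarrow> ('x set \<times> 's) set)
    \<Rightarrow> 'x list \<Rightarrow> nat \<Rightarrow> ('x set \<times> 's) set" where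
  "face T F n f xs i =
     (if i \<le> n then f (omit i xs) else spread_germ T F (f (butlast xs)) (last xs))"

lemma coboundary_face:
  "xs \<in> tuples T (Suc n) \<Longrightarrow> coboundary T F n f xs =
     finprod (stalk T F (last xs)) (\<lambda>i. face T F n f xs i [^]\<^bsub>stalk T F (last xs)\<^esub> ((- 1) ^ i :: int))
       {..Suc n}"
  by (simp add: coboundary_def face_def)

lemma tuples_last: "xs \<in> tuples T n \<Longrightarrow> last xs \<in> topspace T"
  by (cases xs rule: rev_cases) (auto simp: tuples_def)

lemma tuples_omit:
  assumes "xs \<in> tuples T (Suc n)" "i \<le> n"
  shows "omit i xs \<in> tuples T n" "last (omit i xs) = last xs"
proof -
  have len: "length xs = Suc (Suc n)" using assms by (simp add: tuples_def)
  have "set (omit i xs) \<subseteq> set xs"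
    using set_take_subset[of i xs] set_drop_subset[of "Suc i" xs] by (auto simp: omit_def)
  then show "omit i xs \<in> tuples T n"
    using assms len by (auto simp: tuples_def omit_def)
  show "last (omit i xs) = last xs"
    using assms(2) len by (simp add: omit_def last_append)
qed

lemma tuples_butlast: "xs \<in> tuples T (Suc n) \<Longrightarrow> butlast xs \<in> tuples T n"
  by (auto simp: tuples_def dest: in_set_butlastD)

lemma tuples_subtopology: "xs \<in> tuples (subtopology T S) n \<Longrightarrow> xs \<in> tuples T n"
  by (auto simp: tuples_def)

lemma last_tuples_subtopology: "xs \<in> tuples (subtopology T S) n \<Longrightarrow> last xs \<in> topspace T \<inter> S"
  using tuples_last[of xs "subtopology T S"] by simp

context ab_presheaf
begin

lemma stalk_group: "x \<in> topspace T \<Longrightarrow> group (stalk T F x)"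
  using stalk_comm_group comm_group_def by blast

lemma cochains_group: "group (cochains T F n)"
  unfolding cochains_def by (rule product_group) (simp add: stalk_group tuples_last)

lemma cochains_carrier:
  "f \<in> carrier (cochains T F n) \<longleftrightarrow>
     f \<in> extensional (tuples T n) \<and> (\<forall>xs\<in>tuples T n. f xs \<in> carrier (stalk T F (last xs)))"
  by (auto simp: cochains_def PiE_def Pi_def)

lemma cochains_mult:
  "xs \<in> tuples T n \<Longrightarrow> (f \<otimes>\<^bsub>cochains T F n\<^esub> g) xs = f xs \<otimes>\<^bsub>stalk T F (last xs)\<^esub> g xs"
  by (simp add: cochains_def)

lemma cochains_one: "xs \<in> tuples T n \<Longrightarrow> \<one>\<^bsub>cochains T F n\<^esub> xs = \<one>\<^bsub>stalk T F (last xs)\<^esub>"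
  by (simp add: cochains_def)

lemma face_closed:
  assumes f: "f \<in> carrier (cochains T F n)" and xs: "xs \<in> tuples T (Suc n)"
  shows "face T F n f xs i \<in> carrier (stalk T F (last xs))"
proof (cases "i \<le> n")
  case True
  then show ?thesis
    using tuples_omit[OF xs True] f by (auto simp: face_def cochains_carrier)
next
  case False
  then show ?thesis
    using tuples_butlast[OF xs] tuples_last[OF xs] f spread_germ_closed
    by (auto simp: face_def cochains_carrier)
qed

lemma coboundary_closed:
  assumes f: "f \<in> carrier (cochains T F n)"
  shows "coboundary T F n f \<in> carrier (cochains T F (Suc n))"
  unfolding cochains_carrier
proof (intro conjI ballI)
  show "coboundary T F n f \<in> extensional (tuples T (Suc n))" by (simp add: coboundary_def)
  fix xs assume xs: "xs \<in> tuples T (Suc n)"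
  interpret x: comm_group "stalk T F (last xs)"
    by (rule stalk_comm_group[OF tuples_last[OF xs]])
  show "coboundary T F n f xs \<in> carrier (stalk T F (last xs))"
    unfolding coboundary_face[OF xs] using face_closed[OF f xs] by (intro x.finprod_closed) auto
qed

text \<open>
  Both sides are computed from representatives over one open set, with which the chosen ones agree
  near \<open>x\<close>.
\<close>

lemma spread_germ_mult_near:
  assumes g: "g \<in> carrier (stalk T F x)" and h: "h \<in> carrier (stalk T F x)"
  shows "\<exists>V. openin T V \<and> x \<in> V \<and> (\<forall>y\<in>V. spread_germ T F (g \<otimes>\<^bsub>stalk T F x\<^esub> h) y =
    spread_germ T F g y \<otimes>\<^bsub>stalk T F y\<^esub> spread_germ T F h y)"
proof -
  obtain U s t where U: "openin T U" "x \<in> U" "s \<in> carrier (sect F U)" "t \<in> carrier (sect F U)"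
    "g = germ T F x U s" "h = germ T F x U t" using common_domain2[OF g h] by metis
  interpret U: comm_group "sect F U" using sect_group U by blast
  obtain V1 where V1: "openin T V1" "x \<in> V1" "V1 \<subseteq> U"
    "\<And>y. y \<in> V1 \<Longrightarrow> spread_germ T F g y = germ T F y U s"
    using spread_germ_near[of U x s] U by blast
  obtain V2 where V2: "openin T V2" "x \<in> V2" "V2 \<subseteq> U"
    "\<And>y. y \<in> V2 \<Longrightarrow> spread_germ T F h y = germ T F y U t"
    using spread_germ_near[of U x t] U by blast
  obtain V3 where V3: "openin T V3" "x \<in> V3" "V3 \<subseteq> U"
    "\<And>y. y \<in> V3 \<Longrightarrow> spread_germ T F (g \<otimes>\<^bsub>stalk T F x\<^esub> h) y = germ T F y U (s \<otimes>\<^bsub>sect F U\<^esub> t)"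
    using spread_germ_near[of U x "s \<otimes>\<^bsub>sect F U\<^esub> t"] U germ_mult by auto
  have "spread_germ T F (g \<otimes>\<^bsub>stalk T F x\<^esub> h) y =
      spread_germ T F g y \<otimes>\<^bsub>stalk T F y\<^esub> spread_germ T F h y" if "y \<in> V1 \<inter> V2 \<inter> V3" for y
    using that V1 V2 V3(4) germ_mult[of U y s t] U by auto
  then show ?thesis using V1 V2 V3 by (intro exI[where x = "V1 \<inter> V2 \<inter> V3"]) auto
qed

text \<open>
  All faces but the last are pointwise additive on the nose; the last one is so near every point, by
  \<open>spread_germ_mult_near\<close>.
\<close>

lemma coboundary_mult_near:
  assumes f: "f \<in> carrier (cochains T F n)" and g: "g \<in> carrier (cochains T F n)"
  shows "near T (Suc n) (topspace T) (\<lambda>xs. coboundary T F n (f \<otimes>\<^bsub>cochains T F n\<^esub> g) xs =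
    coboundary T F n f xs \<otimes>\<^bsub>stalk T F (last xs)\<^esub> coboundary T F n g xs)"
proof -
  let ?fg = "f \<otimes>\<^bsub>cochains T F n\<^esub> g"
  have "near T (Suc n) (topspace T) (\<lambda>xs. spread_germ T F (?fg (butlast xs)) (last xs) =
    spread_germ T F (f (butlast xs)) (last xs) \<otimes>\<^bsub>stalk T F (last xs)\<^esub>
    spread_germ T F (g (butlast xs)) (last xs))"
  proof (rule near_last)
    fix ys assume ys: "ys \<in> tuples T n"
    then show "\<exists>V. openin T V \<and> last ys \<in> V \<and>
        (\<forall>y\<in>V. spread_germ T F (?fg (butlast (ys @ [y]))) (last (ys @ [y])) =
        spread_germ T F (f (butlast (ys @ [y]))) (last (ys @ [y])) \<otimes>\<^bsub>stalk T F (last (ys @ [y]))\<^esub>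
        spread_germ T F (g (butlast (ys @ [y]))) (last (ys @ [y])))"
      using spread_germ_mult_near[of "f ys" "last ys" "g ys"] f g cochains_mult[OF ys]
      by (simp add: cochains_carrier)
  qed simp
  then show ?thesis
  proof (rule near_mono)
    fix xs assume xs: "xs \<in> tuples T (Suc n)"
      and spread: "spread_germ T F (?fg (butlast xs)) (last xs) =
        spread_germ T F (f (butlast xs)) (last xs) \<otimes>\<^bsub>stalk T F (last xs)\<^esub>
        spread_germ T F (g (butlast xs)) (last xs)"
    interpret x: comm_group "stalk T F (last xs)"
      by (rule stalk_comm_group[OF tuples_last[OF xs]])
    have face: "face T F n ?fg xs i = face T F n f xs i \<otimes>\<^bsub>stalk T F (last xs)\<^esub> face T F n g xs i" for i
      using spread tuples_omit[OF xs, of i] cochains_mult[of "omit i xs" n] by (simp add: face_def)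
    note c = face_closed[OF f xs] face_closed[OF g xs]
    have "coboundary T F n ?fg xs = finprod (stalk T F (last xs))
        (\<lambda>i. face T F n f xs i [^]\<^bsub>stalk T F (last xs)\<^esub> ((- 1) ^ i :: int)
           \<otimes>\<^bsub>stalk T F (last xs)\<^esub> face T F n g xs i [^]\<^bsub>stalk T F (last xs)\<^esub> ((- 1) ^ i :: int)) {..Suc n}"
      unfolding coboundary_face[OF xs] face using c
      by (intro x.finprod_cong') (auto simp: x.int_pow_mult_distrib x.m_comm)
    also have "\<dots> = coboundary T F n f xs \<otimes>\<^bsub>stalk T F (last xs)\<^esub> coboundary T F n g xs"
      unfolding coboundary_face[OF xs] using c by (intro x.finprod_multf) auto
    finally show "coboundary T F n ?fg xs =
      coboundary T F n f xs \<otimes>\<^bsub>stalk T F (last xs)\<^esub> coboundary T F n g xs" .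
  qed simp
qed

text \<open>
  By additivity the value is idempotent, hence trivial, in the stalk.
\<close>

lemma coboundary_one_near:
  "near T (Suc n) (topspace T) (\<lambda>xs. coboundary T F n \<one>\<^bsub>cochains T F n\<^esub> xs = \<one>\<^bsub>stalk T F (last xs)\<^esub>)"
proof -
  interpret C: group "cochains T F n" by (rule cochains_group)
  have "near T (Suc n) (topspace T) (\<lambda>xs. coboundary T F n \<one>\<^bsub>cochains T F n\<^esub> xs =
    coboundary T F n \<one>\<^bsub>cochains T F n\<^esub> xs \<otimes>\<^bsub>stalk T F (last xs)\<^esub> coboundary T F n \<one>\<^bsub>cochains T F n\<^esub> xs)"
    using coboundary_mult_near[of "\<one>\<^bsub>cochains T F n\<^esub>" n "\<one>\<^bsub>cochains T F n\<^esub>"] by simp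
  then show ?thesis
  proof (rule near_mono)
    fix xs assume xs: "xs \<in> tuples T (Suc n)" and eq: "coboundary T F n \<one>\<^bsub>cochains T F n\<^esub> xs =
      coboundary T F n \<one>\<^bsub>cochains T F n\<^esub> xs \<otimes>\<^bsub>stalk T F (last xs)\<^esub> coboundary T F n \<one>\<^bsub>cochains T F n\<^esub> xs"
    interpret x: group "stalk T F (last xs)"
      by (rule stalk_group[OF tuples_last[OF xs]])
    have "coboundary T F n \<one>\<^bsub>cochains T F n\<^esub> xs \<in> carrier (stalk T F (last xs))"
      using coboundary_closed[OF C.one_closed] xs by (simp add: cochains_carrier)
    then show "coboundary T F n \<one>\<^bsub>cochains T F n\<^esub> xs = \<one>\<^bsub>stalk T F (last xs)\<^esub>"
      using eq by (metis x.r_cancel_one')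
  qed simp
qed

text \<open>
  Dividing by \<open>coboundary T F m f\<close> turns near equality with it into a null cochain. In the form on the
  right, closure properties follow by intersecting neighbourhoods.
\<close>

lemma coboundaries_Suc:
  "g \<in> coboundaries T F (Suc m) \<longleftrightarrow> g \<in> carrier (cochains T F (Suc m)) \<and>
     (\<exists>f\<in>carrier (cochains T F m). near T (Suc m) (topspace T) (\<lambda>xs. g xs = coboundary T F m f xs))"
proof
  interpret C: group "cochains T F (Suc m)" by (rule cochains_group)
  {
    assume "g \<in> coboundaries T F (Suc m)"
    then obtain k f where k: "k \<in> null_cochains T F (Suc m)" and f: "f \<in> carrier (cochains T F m)"
      and g: "g = k \<otimes>\<^bsub>cochains T F (Suc m)\<^esub> coboundary T F m f"
      by (auto simp: coboundaries_def set_mult_def)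
    have kc: "k \<in> carrier (cochains T F (Suc m))" using k by (simp add: null_cochains_def)
    have "near T (Suc m) (topspace T) (\<lambda>xs. k xs = \<one>\<^bsub>stalk T F (last xs)\<^esub>)"
      using k by (simp add: null_cochains_def)
    then have "near T (Suc m) (topspace T) (\<lambda>xs. g xs = coboundary T F m f xs)"
    proof (rule near_mono)
      fix xs assume xs: "xs \<in> tuples T (Suc m)" and "k xs = \<one>\<^bsub>stalk T F (last xs)\<^esub>"
      moreover interpret x: group "stalk T F (last xs)"
        by (rule stalk_group[OF tuples_last[OF xs]])
      have "coboundary T F m f xs \<in> carrier (stalk T F (last xs))"
        using coboundary_closed[OF f] xs by (simp add: cochains_carrier)
      ultimately show "g xs = coboundary T F m f xs" by (simp add: g cochains_mult)
    qed simp
    then show "g \<in> carrier (cochains T F (Suc m)) \<and>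
     (\<exists>f\<in>carrier (cochains T F m). near T (Suc m) (topspace T) (\<lambda>xs. g xs = coboundary T F m f xs))"
      using f kc coboundary_closed[OF f] unfolding g by blast
  next
    assume "g \<in> carrier (cochains T F (Suc m)) \<and>
     (\<exists>f\<in>carrier (cochains T F m). near T (Suc m) (topspace T) (\<lambda>xs. g xs = coboundary T F m f xs))"
    then obtain f where g: "g \<in> carrier (cochains T F (Suc m))" and f: "f \<in> carrier (cochains T F m)"
      and near: "near T (Suc m) (topspace T) (\<lambda>xs. g xs = coboundary T F m f xs)" by blast
    let ?d = "coboundary T F m f"
    note d = coboundary_closed[OF f]
    define k where "k = g \<otimes>\<^bsub>cochains T F (Suc m)\<^esub> inv\<^bsub>cochains T F (Suc m)\<^esub> ?d"
    have g_eq: "g = k \<otimes>\<^bsub>cochains T F (Suc m)\<^esub> ?d"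
      using g d by (simp add: k_def C.m_assoc)
    have kc: "k \<in> carrier (cochains T F (Suc m))" using g d by (simp add: k_def)
    have "near T (Suc m) (topspace T) (\<lambda>xs. k xs = \<one>\<^bsub>stalk T F (last xs)\<^esub>)"
      using near
    proof (rule near_mono)
      fix xs assume xs: "xs \<in> tuples T (Suc m)" and eq: "g xs = ?d xs"
      interpret x: group "stalk T F (last xs)"
        by (rule stalk_group[OF tuples_last[OF xs]])
      have "k xs \<in> carrier (stalk T F (last xs))" "?d xs \<in> carrier (stalk T F (last xs))"
        using kc d xs by (auto simp: cochains_carrier)
      moreover have "k xs \<otimes>\<^bsub>stalk T F (last xs)\<^esub> ?d xs = ?d xs"
        using g_eq cochains_mult[OF xs] eq by metis
      ultimately show "k xs = \<one>\<^bsub>stalk T F (last xs)\<^esub>" by simp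
    qed simp
    then show "g \<in> coboundaries T F (Suc m)"
      using g_eq kc f by (auto simp: coboundaries_def set_mult_def null_cochains_def)
  }
qed

lemma null_cochains_submonoid: "submonoid (null_cochains T F n) (cochains T F n)"
proof
  interpret C: group "cochains T F n" by (rule cochains_group)
  show "null_cochains T F n \<subseteq> carrier (cochains T F n)" by (auto simp: null_cochains_def)
  show "\<one>\<^bsub>cochains T F n\<^esub> \<in> null_cochains T F n"
    by (auto simp: null_cochains_def cochains_one intro: near_all)
  fix f g assume f: "f \<in> null_cochains T F n" and g: "g \<in> null_cochains T F n"
  have "near T n (topspace T) (\<lambda>xs. f xs = \<one>\<^bsub>stalk T F (last xs)\<^esub> \<and> g xs = \<one>\<^bsub>stalk T F (last xs)\<^esub>)"
    using f g by (intro near_conj) (auto simp: null_cochains_def)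
  then have "near T n (topspace T) (\<lambda>xs. (f \<otimes>\<^bsub>cochains T F n\<^esub> g) xs = \<one>\<^bsub>stalk T F (last xs)\<^esub>)"
  proof (rule near_mono)
    fix xs assume xs: "xs \<in> tuples T n"
      and eq: "f xs = \<one>\<^bsub>stalk T F (last xs)\<^esub> \<and> g xs = \<one>\<^bsub>stalk T F (last xs)\<^esub>"
    interpret x: group "stalk T F (last xs)"
      by (rule stalk_group[OF tuples_last[OF xs]])
    show "(f \<otimes>\<^bsub>cochains T F n\<^esub> g) xs = \<one>\<^bsub>stalk T F (last xs)\<^esub>"
      using eq xs by (simp add: cochains_mult)
  qed simp
  then show "f \<otimes>\<^bsub>cochains T F n\<^esub> g \<in> null_cochains T F n"
    using f g by (simp add: null_cochains_def)
qed

lemma coboundaries_submonoid: "submonoid (coboundaries T F n) (cochains T F n)"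
proof (cases n)
  case 0
  then show ?thesis using null_cochains_submonoid[of 0] by (simp add: coboundaries_def)
next
  case (Suc m)
  interpret C: group "cochains T F (Suc m)" by (rule cochains_group)
  interpret D: group "cochains T F m" by (rule cochains_group)
  have "submonoid (coboundaries T F (Suc m)) (cochains T F (Suc m))"
  proof
    show "coboundaries T F (Suc m) \<subseteq> carrier (cochains T F (Suc m))"
      by (auto simp: coboundaries_Suc)
    have "near T (Suc m) (topspace T)
        (\<lambda>xs. \<one>\<^bsub>cochains T F (Suc m)\<^esub> xs = coboundary T F m \<one>\<^bsub>cochains T F m\<^esub> xs)"
      using coboundary_one_near[of m] by (rule near_mono) (auto simp: cochains_one)
    then show "\<one>\<^bsub>cochains T F (Suc m)\<^esub> \<in> coboundaries T F (Suc m)"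
      unfolding coboundaries_Suc using C.one_closed D.one_closed by blast
    fix g h assume "g \<in> coboundaries T F (Suc m)" "h \<in> coboundaries T F (Suc m)"
    then obtain u v where g: "g \<in> carrier (cochains T F (Suc m))" and h: "h \<in> carrier (cochains T F (Suc m))"
      and u: "u \<in> carrier (cochains T F m)" and v: "v \<in> carrier (cochains T F m)"
      and "near T (Suc m) (topspace T) (\<lambda>xs. g xs = coboundary T F m u xs)"
      and "near T (Suc m) (topspace T) (\<lambda>xs. h xs = coboundary T F m v xs)"
      unfolding coboundaries_Suc by blast
    then have "near T (Suc m) (topspace T) (\<lambda>xs. (g xs = coboundary T F m u xs \<and>
       h xs = coboundary T F m v xs) \<and> coboundary T F m (u \<otimes>\<^bsub>cochains T F m\<^esub> v) xs =
       coboundary T F m u xs \<otimes>\<^bsub>stalk T F (last xs)\<^esub> coboundary T F m v xs)"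
      by (intro near_conj coboundary_mult_near)
    then have "near T (Suc m) (topspace T) (\<lambda>xs. (g \<otimes>\<^bsub>cochains T F (Suc m)\<^esub> h) xs =
       coboundary T F m (u \<otimes>\<^bsub>cochains T F m\<^esub> v) xs)"
      by (rule near_mono) (auto simp: cochains_mult)
    then show "g \<otimes>\<^bsub>cochains T F (Suc m)\<^esub> h \<in> coboundaries T F (Suc m)"
      unfolding coboundaries_Suc using g h u v by blast
  qed
  then show ?thesis using Suc by simp
qed

lemma carrier_cohomology:
  "carrier (cohomology T F n) = {coboundaries T F n #>\<^bsub>cochains T F n\<^esub> f | f. f \<in> cocycles T F n}"
  by (auto simp: cohomology_def FactGroup_def RCOSETS_def r_coset_def)

end

text \<open>
  The map of representatives that underlies \<open>cohomology_map\<close>.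
\<close>

definition cochain_map ::
    "'x topology \<Rightarrow> 'x set \<Rightarrow> ('x, 't) group_presheaf \<Rightarrow> ('x set \<Rightarrow> 's \<Rightarrow> 't) \<Rightarrow> nat
      \<Rightarrow> ('x list \<Rightarrow> ('x set \<times> 's) set) \<Rightarrow> 'x list \<Rightarrow> ('x set \<times> 't) set" where
  "cochain_map T S F' \<phi> n f = (\<lambda>xs\<in>tuples (subtopology T S) n. stalk_map T S F' \<phi> (last xs) (f xs))"

context presheaf_morphism
begin

abbreviation "T' \<equiv> subtopology T S"

lemma stalk_map_one:
  assumes "x \<in> topspace T \<inter> S"
  shows "stalk_map T S F' \<phi> x \<one>\<^bsub>stalk T F x\<^esub> = \<one>\<^bsub>stalk T' F' x\<^esub>"
  using hom_one[OF stalk_map_hom[OF assms]] source.stalk_group target.stalk_group assms by simp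

lemma cochain_map_hom: "cochain_map T S F' \<phi> n \<in> hom (cochains T F n) (cochains T' F' n)"
proof (rule homI)
  fix f assume f: "f \<in> carrier (cochains T F n)"
  show "cochain_map T S F' \<phi> n f \<in> carrier (cochains T' F' n)"
    unfolding target.cochains_carrier
  proof (intro conjI ballI)
    fix xs assume xs: "xs \<in> tuples T' n"
    then have "f xs \<in> carrier (stalk T F (last xs))"
      using f tuples_subtopology[OF xs] by (auto simp: source.cochains_carrier)
    then show "cochain_map T S F' \<phi> n f xs \<in> carrier (stalk T' F' (last xs))"
      using stalk_map_hom[OF last_tuples_subtopology[OF xs]] xs by (auto simp: cochain_map_def hom_def)
  qed (simp add: cochain_map_def)
next
  fix f g assume fg: "f \<in> carrier (cochains T F n)" "g \<in> carrier (cochains T F n)"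
  show "cochain_map T S F' \<phi> n (f \<otimes>\<^bsub>cochains T F n\<^esub> g) =
    cochain_map T S F' \<phi> n f \<otimes>\<^bsub>cochains T' F' n\<^esub> cochain_map T S F' \<phi> n g"
  proof (rule extensionalityI[where A = "tuples T' n"])
    fix xs assume xs: "xs \<in> tuples T' n"
    then have xs': "xs \<in> tuples T n" by (rule tuples_subtopology)
    then have "f xs \<in> carrier (stalk T F (last xs))" "g xs \<in> carrier (stalk T F (last xs))"
      using fg by (auto simp: source.cochains_carrier)
    then show "cochain_map T S F' \<phi> n (f \<otimes>\<^bsub>cochains T F n\<^esub> g) xs =
      (cochain_map T S F' \<phi> n f \<otimes>\<^bsub>cochains T' F' n\<^esub> cochain_map T S F' \<phi> n g) xs"
      using stalk_map_hom[OF last_tuples_subtopology[OF xs]] xs xs'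
      by (auto simp: cochain_map_def hom_def source.cochains_mult target.cochains_mult)
  qed (auto simp: cochain_map_def cochains_def)
qed

text \<open>
  Moving a germ to a nearby point commutes with the map on stalks, for points near enough that the
  chosen representatives on both sides agree with a fixed section and its image.
\<close>

lemma spread_germ_natural:
  assumes g: "g \<in> carrier (stalk T F x)" and x: "x \<in> topspace T \<inter> S"
  shows "\<exists>V. openin T' V \<and> x \<in> V \<and> (\<forall>y\<in>V. stalk_map T S F' \<phi> y (spread_germ T F g y) =
    spread_germ T' F' (stalk_map T S F' \<phi> x g) y)"
proof -
  obtain U s where U: "openin T U" "x \<in> U" "s \<in> carrier (sect F U)" and g: "g = germ T F x U s"
    by (rule source.stalkE[OF g])
  obtain V1 where V1: "openin T V1" "x \<in> V1" "V1 \<subseteq> U"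
    "\<And>y. y \<in> V1 \<Longrightarrow> spread_germ T F g y = germ T F y U s"
    using source.spread_germ_near[OF U] g by blast
  have US: "openin T' (U \<inter> S)" "x \<in> U \<inter> S" "\<phi> U s \<in> carrier (sect F' (U \<inter> S))"
    using open_Int U x map_closed by auto
  obtain V2 where V2: "openin T' V2" "x \<in> V2" "V2 \<subseteq> U \<inter> S"
    "\<And>y. y \<in> V2 \<Longrightarrow> spread_germ T' F' (stalk_map T S F' \<phi> x g) y = germ T' F' y (U \<inter> S) (\<phi> U s)"
    using target.spread_germ_near[OF US] stalk_map_germ[OF U] x g by auto
  have "stalk_map T S F' \<phi> y (spread_germ T F g y) =
      spread_germ T' F' (stalk_map T S F' \<phi> x g) y" if "y \<in> V1 \<inter> S \<inter> V2" for y
    using that V1 V2(4) stalk_map_germ[of U y s] U by auto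
  moreover have "openin T' (V1 \<inter> S \<inter> V2)" using open_Int[OF V1(1)] V2 by auto
  ultimately show ?thesis using V1 V2 x by blast
qed

lemma cochain_map_coboundary:
  assumes f: "f \<in> carrier (cochains T F n)"
  shows "near T' (Suc n) (topspace T') (\<lambda>xs. cochain_map T S F' \<phi> (Suc n) (coboundary T F n f) xs =
    coboundary T' F' n (cochain_map T S F' \<phi> n f) xs)"
proof -
  let ?f = "cochain_map T S F' \<phi> n f"
  have f': "?f \<in> carrier (cochains T' F' n)"
    using cochain_map_hom f by (auto simp: hom_def)
  have "near T' (Suc n) (topspace T') (\<lambda>xs.
      stalk_map T S F' \<phi> (last xs) (spread_germ T F (f (butlast xs)) (last xs)) =
      spread_germ T' F' (?f (butlast xs)) (last xs))"
  proof (rule near_last)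
    fix ys assume ys: "ys \<in> tuples T' n"
    then have "f ys \<in> carrier (stalk T F (last ys))"
      using f tuples_subtopology[OF ys] by (auto simp: source.cochains_carrier)
    from spread_germ_natural[OF this last_tuples_subtopology[OF ys]]
    show "\<exists>V. openin T' V \<and> last ys \<in> V \<and>
        (\<forall>y\<in>V. stalk_map T S F' \<phi> (last (ys @ [y]))
          (spread_germ T F (f (butlast (ys @ [y]))) (last (ys @ [y]))) =
        spread_germ T' F' (?f (butlast (ys @ [y]))) (last (ys @ [y])))"
      using ys by (simp add: cochain_map_def)
  qed simp
  then show ?thesis
  proof (rule near_mono)
    fix xs assume xs: "xs \<in> tuples T' (Suc n)"
      and spread: "stalk_map T S F' \<phi> (last xs) (spread_germ T F (f (butlast xs)) (last xs)) =
      spread_germ T' F' (?f (butlast xs)) (last xs)"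
    note l = last_tuples_subtopology[OF xs]
    have xs': "xs \<in> tuples T (Suc n)" using tuples_subtopology[OF xs] .
    have face: "stalk_map T S F' \<phi> (last xs) (face T F n f xs i) = face T' F' n ?f xs i" for i
      using spread tuples_omit[OF xs, of i] by (simp add: face_def cochain_map_def)
    have "stalk_map T S F' \<phi> (last xs) (coboundary T F n f xs) = coboundary T' F' n ?f xs"
      unfolding coboundary_face[OF xs] coboundary_face[OF xs'] face[symmetric]
    proof (rule hom_finprod_int_pow)
      show "comm_group (stalk T F (last xs))" "comm_group (stalk T' F' (last xs))"
        using l by (auto intro: source.stalk_comm_group target.stalk_comm_group)
      show "stalk_map T S F' \<phi> (last xs) \<in> hom (stalk T F (last xs)) (stalk T' F' (last xs))"
        using l by (rule stalk_map_hom)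
    qed (use source.face_closed[OF f xs'] in auto)
    then show "cochain_map T S F' \<phi> (Suc n) (coboundary T F n f) xs = coboundary T' F' n ?f xs"
      using xs by (simp add: cochain_map_def)
  qed simp
qed

lemma cochain_map_near:
  assumes "near T n (topspace T) P" "\<And>xs. xs \<in> tuples T' n \<Longrightarrow> P xs \<Longrightarrow> Q xs"
  shows "near T' n (topspace T') Q"
proof -
  have "near T' n (topspace T') P" using near_subtopology[OF assms(1), of S] by simp
  then show ?thesis by (rule near_mono) (use assms(2) in auto)
qed

lemma cochain_map_null:
  assumes "f \<in> null_cochains T F n" shows "cochain_map T S F' \<phi> n f \<in> null_cochains T' F' n"
proof -
  have f: "f \<in> carrier (cochains T F n)" and near: "near T n (topspace T) (\<lambda>xs. f xs = \<one>\<^bsub>stalk T F (last xs)\<^esub>)"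
    using assms by (auto simp: null_cochains_def)
  have "near T' n (topspace T') (\<lambda>xs. cochain_map T S F' \<phi> n f xs = \<one>\<^bsub>stalk T' F' (last xs)\<^esub>)"
    using near
    by (rule cochain_map_near) (simp add: cochain_map_def stalk_map_one[OF last_tuples_subtopology])
  then show ?thesis using cochain_map_hom f by (auto simp: null_cochains_def hom_def)
qed

lemma cochain_map_coboundaries:
  assumes "g \<in> coboundaries T F n" shows "cochain_map T S F' \<phi> n g \<in> coboundaries T' F' n"
proof (cases n)
  case 0
  then show ?thesis using cochain_map_null assms by (simp add: coboundaries_def)
next
  case (Suc m)
  then obtain f where g: "g \<in> carrier (cochains T F (Suc m))" and f: "f \<in> carrier (cochains T F m)"
    and near: "near T (Suc m) (topspace T) (\<lambda>xs. g xs = coboundary T F m f xs)"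
    using assms source.coboundaries_Suc by blast
  let ?g = "cochain_map T S F' \<phi> (Suc m) g" and ?f = "cochain_map T S F' \<phi> m f"
  have "near T' (Suc m) (topspace T') (\<lambda>xs. ?g xs = cochain_map T S F' \<phi> (Suc m) (coboundary T F m f) xs)"
    using near by (rule cochain_map_near) (simp add: cochain_map_def)
  from near_conj[OF this cochain_map_coboundary[OF f]]
  have "near T' (Suc m) (topspace T') (\<lambda>xs. ?g xs = coboundary T' F' m ?f xs)"
    by (rule near_mono) auto
  moreover have "?g \<in> carrier (cochains T' F' (Suc m))" "?f \<in> carrier (cochains T' F' m)"
    using cochain_map_hom f g by (auto simp: hom_def)
  ultimately show ?thesis using Suc target.coboundaries_Suc by blast
qed

lemma cochain_map_cocycles:
  assumes "f \<in> cocycles T F n" shows "cochain_map T S F' \<phi> n f \<in> cocycles T' F' n"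
proof -
  let ?f = "cochain_map T S F' \<phi> n f"
  have f: "f \<in> carrier (cochains T F n)" and null: "coboundary T F n f \<in> null_cochains T F (Suc n)"
    using assms by (auto simp: cocycles_def)
  have f': "?f \<in> carrier (cochains T' F' n)" using cochain_map_hom f by (auto simp: hom_def)
  have "near T' (Suc n) (topspace T')
      (\<lambda>xs. cochain_map T S F' \<phi> (Suc n) (coboundary T F n f) xs = \<one>\<^bsub>stalk T' F' (last xs)\<^esub>)"
    using cochain_map_null[OF null] by (simp add: null_cochains_def)
  from near_conj[OF this cochain_map_coboundary[OF f]]
  have "near T' (Suc n) (topspace T') (\<lambda>xs. coboundary T' F' n ?f xs = \<one>\<^bsub>stalk T' F' (last xs)\<^esub>)"
    by (rule near_mono) auto
  then show ?thesis
    using f' target.coboundary_closed[OF f'] by (simp add: cocycles_def null_cochains_def)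
qed

text \<open>
  By this lemma the rest of the argument can be carried out with cocycles instead of classes.
\<close>

lemma cohomology_map_class:
  assumes "f \<in> cocycles T F n"
  shows "cohomology_map T S F' \<phi> n (coboundaries T F n #>\<^bsub>cochains T F n\<^esub> f) =
    coboundaries T' F' n #>\<^bsub>cochains T' F' n\<^esub> cochain_map T S F' \<phi> n f"
proof -
  have "f \<in> carrier (cochains T F n)" using assms by (simp add: cocycles_def)
  moreover have "cochain_map T S F' \<phi> n ` coboundaries T F n \<subseteq> coboundaries T' F' n"
    using cochain_map_coboundaries by blast
  ultimately have "coboundaries T' F' n <#>\<^bsub>cochains T' F' n\<^esub>
      (cochain_map T S F' \<phi> n ` (coboundaries T F n #>\<^bsub>cochains T F n\<^esub> f)) =
    coboundaries T' F' n #>\<^bsub>cochains T' F' n\<^esub> cochain_map T S F' \<phi> n f"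
    by (intro image_of_coset source.cochains_group target.cochains_group cochain_map_hom
        source.coboundaries_submonoid target.coboundaries_submonoid)
  then show ?thesis
    unfolding cohomology_map_def cochain_map_def[abs_def] .
qed

end

lemma image_cohomology_map:
  assumes "presheaf_morphism T S F F' \<phi>"
  shows "cohomology_map T S F' \<phi> n ` carrier (cohomology T F n) =
    {coboundaries (subtopology T S) F' n #>\<^bsub>cochains (subtopology T S) F' n\<^esub> cochain_map T S F' \<phi> n f
      | f. f \<in> cocycles T F n}"
proof -
  interpret presheaf_morphism T S F F' \<phi> by fact
  show ?thesis
    unfolding source.carrier_cohomology using cohomology_map_class by (auto simp: image_iff)
qed

section \<open>Composition of presheaf maps\<close>

lemma presheaf_morphism_comp:
  assumes "presheaf_morphism T S F F' \<phi>" and "presheaf_morphism (subtopology T S) S' F' F'' \<psi>"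
  shows "presheaf_morphism T (S \<inter> S') F F'' (\<lambda>U s. \<psi> (U \<inter> S) (\<phi> U s))"
proof -
  interpret \<phi>: presheaf_morphism T S F F' \<phi> by fact
  interpret \<psi>: presheaf_morphism "subtopology T S" S' F' F'' \<psi> by fact
  show ?thesis
  proof (intro presheaf_morphism.intro presheaf_morphism_axioms.intro)
    show "ab_presheaf T F" by (rule \<phi>.source.ab_presheaf_axioms)
    show "ab_presheaf (subtopology T (S \<inter> S')) F''"
      using \<psi>.target.ab_presheaf_axioms by (simp add: subtopology_subtopology)
  next
    fix U assume U: "openin T U"
    have "\<psi> (U \<inter> S) \<in> hom (sect F' (U \<inter> S)) (sect F'' (U \<inter> S \<inter> S'))"
      using \<psi>.map_hom \<phi>.open_Int U by blast
    then show "(\<lambda>s. \<psi> (U \<inter> S) (\<phi> U s)) \<in> hom (sect F U) (sect F'' (U \<inter> (S \<inter> S')))"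
      using \<phi>.map_hom[OF U] by (auto simp: hom_def Int_assoc)
  next
    fix U V s assume U: "openin T U" "openin T V" "V \<subseteq> U" "s \<in> carrier (sect F U)"
    then show "\<psi> (V \<inter> S) (\<phi> V (rstr F U V s)) = rstr F'' (U \<inter> (S \<inter> S')) (V \<inter> (S \<inter> S')) (\<psi> (U \<inter> S) (\<phi> U s))"
      using \<phi>.map_rstr[OF U] \<psi>.map_rstr[of "U \<inter> S" "V \<inter> S" "\<phi> U s"] \<phi>.open_Int \<phi>.map_closed
      by (auto simp: Int_assoc)
  qed
qed

lemma stalk_map_comp:
  assumes "presheaf_morphism T S F F' \<phi>" and "presheaf_morphism (subtopology T S) S' F' F'' \<psi>"
    and g: "g \<in> carrier (stalk T F x)" and x: "x \<in> S" "x \<in> S'"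
  shows "stalk_map (subtopology T S) S' F'' \<psi> x (stalk_map T S F' \<phi> x g) =
    stalk_map T (S \<inter> S') F'' (\<lambda>U s. \<psi> (U \<inter> S) (\<phi> U s)) x g"
proof -
  interpret \<phi>: presheaf_morphism T S F F' \<phi> by fact
  interpret \<psi>: presheaf_morphism "subtopology T S" S' F' F'' \<psi> by fact
  interpret c: presheaf_morphism T "S \<inter> S'" F F'' "\<lambda>U s. \<psi> (U \<inter> S) (\<phi> U s)"
    by (rule presheaf_morphism_comp) fact+
  obtain U s where U: "openin T U" "x \<in> U" "s \<in> carrier (sect F U)" and g: "g = germ T F x U s"
    by (rule \<phi>.source.stalkE[OF g])
  show ?thesis
    using \<phi>.stalk_map_germ[OF U x(1)] \<psi>.stalk_map_germ[of "U \<inter> S" x "\<phi> U s"] c.stalk_map_germ[OF U]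
      \<phi>.open_Int[OF U(1)] \<phi>.map_closed[OF U(1,3)] U x g
    by (simp add: subtopology_subtopology Int_assoc)
qed

lemma stalk_map_cong:
  assumes "ab_presheaf T F" and g: "g \<in> carrier (stalk T F x)"
    and "\<And>U s. openin T U \<Longrightarrow> s \<in> carrier (sect F U) \<Longrightarrow> \<phi> U s = \<phi>' U s"
  shows "stalk_map T S F' \<phi> x g = stalk_map T S F' \<phi>' x g"
proof -
  interpret ab_presheaf T F by fact
  show ?thesis
    unfolding stalk_map_def using assms(3) stalk_member[OF g] by (intro SUP_cong) auto
qed

text \<open>
  On cochains composition is strict and not only up to null cochains, since the map on stalks involves no
  choice of representatives.
\<close>

lemma cochain_map_comp:
  assumes "presheaf_morphism T S F F' \<phi>" and "presheaf_morphism (subtopology T S) S' F' F'' \<psi>"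
    and f: "f \<in> carrier (cochains T F n)"
  shows "cochain_map (subtopology T S) S' F'' \<psi> n (cochain_map T S F' \<phi> n f) =
    cochain_map T (S \<inter> S') F'' (\<lambda>U s. \<psi> (U \<inter> S) (\<phi> U s)) n f"
proof -
  interpret \<phi>: presheaf_morphism T S F F' \<phi> by fact
  have "stalk_map (subtopology T S) S' F'' \<psi> (last xs) (stalk_map T S F' \<phi> (last xs) (f xs)) =
      stalk_map T (S \<inter> S') F'' (\<lambda>U s. \<psi> (U \<inter> S) (\<phi> U s)) (last xs) (f xs)"
    and "xs \<in> tuples (subtopology T S) n"
    if xs: "xs \<in> tuples (subtopology T (S \<inter> S')) n" for xs
  proof -
    note xs' = tuples_subtopology[OF xs] last_tuples_subtopology[OF xs]
    show "stalk_map (subtopology T S) S' F'' \<psi> (last xs) (stalk_map T S F' \<phi> (last xs) (f xs)) =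
      stalk_map T (S \<inter> S') F'' (\<lambda>U s. \<psi> (U \<inter> S) (\<phi> U s)) (last xs) (f xs)"
      using f xs' by (intro stalk_map_comp[OF assms(1,2)]) (auto simp: \<phi>.source.cochains_carrier)
    show "xs \<in> tuples (subtopology T S) n" using xs by (auto simp: tuples_def)
  qed
  then show ?thesis
    by (auto simp: cochain_map_def subtopology_subtopology fun_eq_iff restrict_def)
qed

lemma cochain_map_cong:
  assumes "ab_presheaf T F" and f: "f \<in> carrier (cochains T F n)"
    and "\<And>U s. openin T U \<Longrightarrow> s \<in> carrier (sect F U) \<Longrightarrow> \<phi> U s = \<phi>' U s"
  shows "cochain_map T S F' \<phi> n f = cochain_map T S F' \<phi>' n f"
proof -
  interpret ab_presheaf T F by fact
  have "stalk_map T S F' \<phi> (last xs) (f xs) = stalk_map T S F' \<phi>' (last xs) (f xs)"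
    if "xs \<in> tuples (subtopology T S) n" for xs
    using f tuples_subtopology[OF that]
    by (intro stalk_map_cong[OF assms(1)] assms(3)) (auto simp: cochains_carrier)
  then show ?thesis unfolding cochain_map_def by (rule restrict_ext)
qed

lemma presheaf_morphism_topspaceI:
  assumes "ab_presheaf T F" "ab_presheaf T F'"
    and hom: "\<And>U. openin T U \<Longrightarrow> \<phi> U \<in> hom (sect F U) (sect F' U)"
    and rstr: "\<And>U V s. openin T U \<Longrightarrow> openin T V \<Longrightarrow> V \<subseteq> U \<Longrightarrow> s \<in> carrier (sect F U) \<Longrightarrow>
      \<phi> V (rstr F U V s) = rstr F' U V (\<phi> U s)"
  shows "presheaf_morphism T (topspace T) F F' \<phi>"
proof -
  have [simp]: "U \<inter> topspace T = U" if "openin T U" for U using openin_subset[OF that] by blast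
  show ?thesis
    using assms
    by (intro presheaf_morphism.intro presheaf_morphism_axioms.intro) (simp_all add: subtopology_topspace)
qed

locale same_space_morphism = presheaf_morphism T "topspace T" F F' \<phi>
  for T :: "'x topology" and F :: "('x, 's) group_presheaf"
    and F' :: "('x, 't) group_presheaf" and \<phi> :: "'x set \<Rightarrow> 's \<Rightarrow> 't"
begin

lemma open_Int_topspace: "openin T U \<Longrightarrow> U \<inter> topspace T = U"
  using openin_subset by blast

lemma hom_same: "openin T U \<Longrightarrow> \<phi> U \<in> hom (sect F U) (sect F' U)"
  using map_hom open_Int_topspace by metis

lemma closed_same: "openin T U \<Longrightarrow> s \<in> carrier (sect F U) \<Longrightarrow> \<phi> U s \<in> carrier (sect F' U)"
  using hom_same by (auto simp: hom_def)

lemma rstr_same: "openin T U \<Longrightarrow> openin T V \<Longrightarrow> V \<subseteq> U \<Longrightarrow> s \<in> carrier (sect F U) \<Longrightarrow>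
    \<phi> V (rstr F U V s) = rstr F' U V (\<phi> U s)"
  using map_rstr open_Int_topspace by metis

lemma stalk_map_germ_same:
  assumes "openin T U" "x \<in> U" "s \<in> carrier (sect F U)"
  shows "stalk_map T (topspace T) F' \<phi> x (germ T F x U s) = germ T F' x U (\<phi> U s)"
  using stalk_map_germ[OF assms] open_Int_topspace[OF assms(1)] assms by (auto simp: subtopology_topspace)

lemma stalk_map_hom_same:
  "x \<in> topspace T \<Longrightarrow> stalk_map T (topspace T) F' \<phi> x \<in> hom (stalk T F x) (stalk T F' x)"
  using stalk_map_hom[of x] by (simp add: subtopology_topspace)

end

section \<open>Families of germs on a subspace\<close>

lemma subspace_sheaf_simps:
  "s \<in> carrier (sect (subspace_sheaf T F) V) \<longleftrightarrow> s \<in> extensional V \<and>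
     (\<forall>y\<in>V. s y \<in> carrier (stalk T F y)) \<and>
     (\<forall>x\<in>V. \<exists>U t. openin T U \<and> x \<in> U \<and> t \<in> carrier (sect F U) \<and> (\<forall>y\<in>U \<inter> V. s y = germ T F y U t))"
  "s \<otimes>\<^bsub>sect (subspace_sheaf T F) V\<^esub> t = (\<lambda>y\<in>V. s y \<otimes>\<^bsub>stalk T F y\<^esub> t y)"
  "\<one>\<^bsub>sect (subspace_sheaf T F) V\<^esub> = (\<lambda>y\<in>V. \<one>\<^bsub>stalk T F y\<^esub>)"
  "rstr (subspace_sheaf T F) U V s = restrict s V"
  by (auto simp: subspace_sheaf_def PiE_def Pi_def)

context ab_presheaf
begin

lemma subspace_sheaf_common:
  assumes s: "s \<in> carrier (sect (subspace_sheaf T F) V)" and t: "t \<in> carrier (sect (subspace_sheaf T F) V)"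
    and x: "x \<in> V"
  obtains U u v where "openin T U" "x \<in> U" "u \<in> carrier (sect F U)" "v \<in> carrier (sect F U)"
    "\<And>y. y \<in> U \<inter> V \<Longrightarrow> s y = germ T F y U u" "\<And>y. y \<in> U \<inter> V \<Longrightarrow> t y = germ T F y U v"
proof -
  obtain U1 u where 1: "openin T U1" "x \<in> U1" "u \<in> carrier (sect F U1)" "\<And>y. y \<in> U1 \<inter> V \<Longrightarrow> s y = germ T F y U1 u"
    using s x unfolding subspace_sheaf_simps by meson
  obtain U2 v where 2: "openin T U2" "x \<in> U2" "v \<in> carrier (sect F U2)" "\<And>y. y \<in> U2 \<inter> V \<Longrightarrow> t y = germ T F y U2 v"
    using t x unfolding subspace_sheaf_simps by meson
  let ?U = "U1 \<inter> U2"
  have U: "openin T ?U" using 1 2 by auto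
  show ?thesis
  proof (rule that)
    show "rstr F U1 ?U u \<in> carrier (sect F ?U)" "rstr F U2 ?U v \<in> carrier (sect F ?U)"
      using rstr_closed[OF 1(1) U _ 1(3)] rstr_closed[OF 2(1) U _ 2(3)] by simp_all
    fix y assume y: "y \<in> ?U \<inter> V"
    show "s y = germ T F y ?U (rstr F U1 ?U u)"
      using 1(4)[of y] germ_rstr[OF 1(1) U _ _ 1(3), of y] y by simp
    show "t y = germ T F y ?U (rstr F U2 ?U v)"
      using 2(4)[of y] germ_rstr[OF 2(1) U _ _ 2(3), of y] y by simp
  qed (use U 1(2) 2(2) in simp_all)
qed

text \<open>
  The group structure is inherited pointwise from the stalks; only the local representability of
  products, units and inverses by sections needs an argument.
\<close>

lemma subspace_sheaf_ab_presheaf: "ab_presheaf (subtopology T S) (subspace_sheaf T F)"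
proof (rule ab_presheaf.intro)
  let ?F = "subspace_sheaf T F"
  have restr: "restrict s V \<in> carrier (sect ?F V)" if VU: "V \<subseteq> U" and s: "s \<in> carrier (sect ?F U)" for U V s
    unfolding subspace_sheaf_simps
  proof (intro conjI ballI)
    fix x assume x: "x \<in> V"
    then have "x \<in> U" using VU by blast
    then obtain U' t where "openin T U'" "x \<in> U'" "t \<in> carrier (sect F U')"
      "\<And>y. y \<in> U' \<inter> U \<Longrightarrow> s y = germ T F y U' t"
      using subspace_sheaf_common[OF s s] by metis
    then show "\<exists>U t. openin T U \<and> x \<in> U \<and> t \<in> carrier (sect F U) \<and>
        (\<forall>y\<in>U \<inter> V. restrict s V y = germ T F y U t)"
      using VU by (intro exI[where x = U'] exI[where x = t]) auto
  qed (use VU s in \<open>auto simp: subspace_sheaf_simps\<close>)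
  show "is_presheaf (subtopology T S) ?F"
    unfolding is_presheaf_def
  proof (intro conjI allI impI ballI)
    fix U V assume "openin (subtopology T S) U \<and> openin (subtopology T S) V \<and> V \<subseteq> U"
    then show "rstr ?F U V \<in> carrier (sect ?F U) \<rightarrow> carrier (sect ?F V)"
      using restr by (auto simp: subspace_sheaf_simps(4))
  qed (auto simp: subspace_sheaf_simps extensional_restrict inf.absorb2)
  fix V assume V: "openin (subtopology T S) V"
  have Vx: "x \<in> topspace T" if "x \<in> V" for x
    using openin_subset[OF V] that by auto
  have cg: "comm_group (stalk T F x)" if "x \<in> V" for x
    using stalk_comm_group Vx that by blast
  have stalk_group_laws: "\<one>\<^bsub>stalk T F x\<^esub> \<in> carrier (stalk T F x)"
    "g \<in> carrier (stalk T F x) \<Longrightarrow> h \<in> carrier (stalk T F x) \<Longrightarrow> g \<otimes>\<^bsub>stalk T F x\<^esub> h \<in> carrier (stalk T F x)"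
    "g \<in> carrier (stalk T F x) \<Longrightarrow> \<one>\<^bsub>stalk T F x\<^esub> \<otimes>\<^bsub>stalk T F x\<^esub> g = g"
    "g \<in> carrier (stalk T F x) \<Longrightarrow> inv\<^bsub>stalk T F x\<^esub> g \<in> carrier (stalk T F x)"
    "g \<in> carrier (stalk T F x) \<Longrightarrow> inv\<^bsub>stalk T F x\<^esub> g \<otimes>\<^bsub>stalk T F x\<^esub> g = \<one>\<^bsub>stalk T F x\<^esub>"
    "g \<in> carrier (stalk T F x) \<Longrightarrow> h \<in> carrier (stalk T F x) \<Longrightarrow> g \<otimes>\<^bsub>stalk T F x\<^esub> h = h \<otimes>\<^bsub>stalk T F x\<^esub> g"
    "g \<in> carrier (stalk T F x) \<Longrightarrow> h \<in> carrier (stalk T F x) \<Longrightarrow> k \<in> carrier (stalk T F x) \<Longrightarrow>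
      g \<otimes>\<^bsub>stalk T F x\<^esub> h \<otimes>\<^bsub>stalk T F x\<^esub> k = g \<otimes>\<^bsub>stalk T F x\<^esub> (h \<otimes>\<^bsub>stalk T F x\<^esub> k)"
    if "x \<in> V" for x g h k
  proof -
    interpret x: comm_group "stalk T F x" using cg that .
    show "\<one>\<^bsub>stalk T F x\<^esub> \<in> carrier (stalk T F x)"
    "g \<in> carrier (stalk T F x) \<Longrightarrow> h \<in> carrier (stalk T F x) \<Longrightarrow> g \<otimes>\<^bsub>stalk T F x\<^esub> h \<in> carrier (stalk T F x)"
    "g \<in> carrier (stalk T F x) \<Longrightarrow> \<one>\<^bsub>stalk T F x\<^esub> \<otimes>\<^bsub>stalk T F x\<^esub> g = g"
    "g \<in> carrier (stalk T F x) \<Longrightarrow> inv\<^bsub>stalk T F x\<^esub> g \<in> carrier (stalk T F x)"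
    "g \<in> carrier (stalk T F x) \<Longrightarrow> inv\<^bsub>stalk T F x\<^esub> g \<otimes>\<^bsub>stalk T F x\<^esub> g = \<one>\<^bsub>stalk T F x\<^esub>"
    "g \<in> carrier (stalk T F x) \<Longrightarrow> h \<in> carrier (stalk T F x) \<Longrightarrow> g \<otimes>\<^bsub>stalk T F x\<^esub> h = h \<otimes>\<^bsub>stalk T F x\<^esub> g"
    "g \<in> carrier (stalk T F x) \<Longrightarrow> h \<in> carrier (stalk T F x) \<Longrightarrow> k \<in> carrier (stalk T F x) \<Longrightarrow>
      g \<otimes>\<^bsub>stalk T F x\<^esub> h \<otimes>\<^bsub>stalk T F x\<^esub> k = g \<otimes>\<^bsub>stalk T F x\<^esub> (h \<otimes>\<^bsub>stalk T F x\<^esub> k)"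
      by (simp_all add: x.m_ac)
  qed
  have in_stalk: "s y \<in> carrier (stalk T F y)" if "s \<in> carrier (sect ?F V)" "y \<in> V" for s y
    using that by (simp add: subspace_sheaf_simps)
  show "comm_group (sect ?F V)"
  proof (rule comm_groupI)
    fix s t assume s: "s \<in> carrier (sect ?F V)" and t: "t \<in> carrier (sect ?F V)"
    have "\<exists>U r. openin T U \<and> x \<in> U \<and> r \<in> carrier (sect F U) \<and>
        (\<forall>y\<in>U \<inter> V. s y \<otimes>\<^bsub>stalk T F y\<^esub> t y = germ T F y U r)" if x: "x \<in> V" for x
    proof -
      obtain U u v where U: "openin T U" "x \<in> U" "u \<in> carrier (sect F U)" "v \<in> carrier (sect F U)"
        "\<And>y. y \<in> U \<inter> V \<Longrightarrow> s y = germ T F y U u" "\<And>y. y \<in> U \<inter> V \<Longrightarrow> t y = germ T F y U v"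
        using subspace_sheaf_common[OF s t x] by metis
      interpret U: comm_group "sect F U" using sect_group U by blast
      show ?thesis
        using U germ_mult by (intro exI[where x = U] exI[where x = "u \<otimes>\<^bsub>sect F U\<^esub> v"]) auto
    qed
    then show "s \<otimes>\<^bsub>sect ?F V\<^esub> t \<in> carrier (sect ?F V)"
      using in_stalk[OF s] in_stalk[OF t] stalk_group_laws(2) by (auto simp: subspace_sheaf_simps)
    show "s \<otimes>\<^bsub>sect ?F V\<^esub> t = t \<otimes>\<^bsub>sect ?F V\<^esub> s"
      using in_stalk[OF s] in_stalk[OF t] stalk_group_laws(6)
      by (auto simp: subspace_sheaf_simps intro!: restrict_ext)
  next
    have "\<exists>U r. openin T U \<and> x \<in> U \<and> r \<in> carrier (sect F U) \<and>
        (\<forall>y\<in>U \<inter> V. \<one>\<^bsub>stalk T F y\<^esub> = germ T F y U r)" if "x \<in> V" for x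
    proof -
      interpret U: comm_group "sect F (topspace T)" using sect_group by simp
      show ?thesis
        using germ_one Vx that
        by (intro exI[where x = "topspace T"] exI[where x = "\<one>\<^bsub>sect F (topspace T)\<^esub>"]) auto
    qed
    then show "\<one>\<^bsub>sect ?F V\<^esub> \<in> carrier (sect ?F V)"
      using stalk_group_laws(1) by (auto simp: subspace_sheaf_simps)
  next
    fix r s t assume "r \<in> carrier (sect ?F V)" "s \<in> carrier (sect ?F V)" "t \<in> carrier (sect ?F V)"
    then show "r \<otimes>\<^bsub>sect ?F V\<^esub> s \<otimes>\<^bsub>sect ?F V\<^esub> t = r \<otimes>\<^bsub>sect ?F V\<^esub> (s \<otimes>\<^bsub>sect ?F V\<^esub> t)"
      using in_stalk stalk_group_laws(7)
      by (auto simp: subspace_sheaf_simps(2-) intro!: restrict_ext)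
  next
    fix s assume s: "s \<in> carrier (sect ?F V)"
    then show "\<one>\<^bsub>sect ?F V\<^esub> \<otimes>\<^bsub>sect ?F V\<^esub> s = s"
      using in_stalk stalk_group_laws(3)
      by (intro extensionalityI[where A = V]) (auto simp: subspace_sheaf_simps)
    have "\<exists>U r. openin T U \<and> x \<in> U \<and> r \<in> carrier (sect F U) \<and>
        (\<forall>y\<in>U \<inter> V. inv\<^bsub>stalk T F y\<^esub> s y = germ T F y U r)" if x: "x \<in> V" for x
    proof -
      obtain U u where U: "openin T U" "x \<in> U" "u \<in> carrier (sect F U)"
        "\<And>y. y \<in> U \<inter> V \<Longrightarrow> s y = germ T F y U u"
        using subspace_sheaf_common[OF s s x] by metis
      interpret U: comm_group "sect F U" using sect_group U by blast
      have "inv\<^bsub>stalk T F y\<^esub> s y = germ T F y U (inv\<^bsub>sect F U\<^esub> u)" if "y \<in> U \<inter> V" for y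
      proof -
        interpret y: comm_group "stalk T F y" using cg that by blast
        have "germ T F y U (inv\<^bsub>sect F U\<^esub> u) \<otimes>\<^bsub>stalk T F y\<^esub> s y = \<one>\<^bsub>stalk T F y\<^esub>"
          using U that germ_mult germ_one by simp
        then show ?thesis
          using y.inv_equality U germ_in_stalk that by simp
      qed
      then show ?thesis
        using U by (intro exI[where x = U] exI[where x = "inv\<^bsub>sect F U\<^esub> u"]) auto
    qed
    then have "(\<lambda>y\<in>V. inv\<^bsub>stalk T F y\<^esub> s y) \<in> carrier (sect ?F V)"
      using in_stalk[OF s] stalk_group_laws(4) by (auto simp: subspace_sheaf_simps)
    moreover have "(\<lambda>y\<in>V. inv\<^bsub>stalk T F y\<^esub> s y) \<otimes>\<^bsub>sect ?F V\<^esub> s = \<one>\<^bsub>sect ?F V\<^esub>"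
      using in_stalk[OF s] stalk_group_laws(5)
      by (auto simp: subspace_sheaf_simps(2-) intro!: restrict_ext)
    ultimately show "\<exists>t\<in>carrier (sect ?F V). t \<otimes>\<^bsub>sect ?F V\<^esub> s = \<one>\<^bsub>sect ?F V\<^esub>" by blast
  qed
  fix V' assume "V' \<subseteq> V"
  then show "rstr ?F V V' \<in> hom (sect ?F V) (sect ?F V')"
    using restr[of V' V]
    by (auto intro!: homI restrict_ext simp: subspace_sheaf_simps(2-) Int_absorb1)
qed

end

text \<open>
  The map induced by a presheaf map on families of germs. The projections \<open>inf_sheaf_proj\<close> have this
  form.
\<close>

definition stalkwise ::
    "'x topology \<Rightarrow> ('x, 't) group_presheaf \<Rightarrow> ('x set \<Rightarrow> 's \<Rightarrow> 't)
      \<Rightarrow> 'x set \<Rightarrow> ('x \<Rightarrow> ('x set \<times> 's) set) \<Rightarrow> 'x \<Rightarrow> ('x set \<times> 't) set" where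
  "stalkwise T F' \<phi> V s = (\<lambda>y\<in>V. stalk_map T (topspace T) F' \<phi> y (s y))"

text \<open>
  The family of germs along \<open>S\<close> of the image of a section. The restriction maps \<open>to_inf_sheaf\<close> have
  this form.
\<close>

definition germ_section ::
    "'x topology \<Rightarrow> 'x set \<Rightarrow> ('x, 't) group_presheaf \<Rightarrow> ('x set \<Rightarrow> 's \<Rightarrow> 't)
      \<Rightarrow> 'x set \<Rightarrow> 's \<Rightarrow> 'x \<Rightarrow> ('x set \<times> 't) set" where
  "germ_section T S F' \<phi> U s = (\<lambda>y\<in>U \<inter> S. germ T F' y U (\<phi> U s))"

context same_space_morphism
begin

lemma target_ab_presheaf: "ab_presheaf T F'"
  using target.ab_presheaf_axioms by (simp add: subtopology_topspace)

lemma stalkwise_morphism: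
  "presheaf_morphism (subtopology T S) (topspace (subtopology T S))
     (subspace_sheaf T F) (subspace_sheaf T F') (stalkwise T F' \<phi>)"
proof (rule presheaf_morphism_topspaceI)
  interpret F': ab_presheaf T F' by (rule target_ab_presheaf)
  show "ab_presheaf (subtopology T S) (subspace_sheaf T F)"
    "ab_presheaf (subtopology T S) (subspace_sheaf T F')"
    by (rule source.subspace_sheaf_ab_presheaf F'.subspace_sheaf_ab_presheaf)+
  fix V assume V: "openin (subtopology T S) V"
  have Vx: "x \<in> topspace T" if "x \<in> V" for x
    using openin_subset[OF V] that by auto
  have hom: "stalk_map T (topspace T) F' \<phi> y \<in> hom (stalk T F y) (stalk T F' y)" if "y \<in> V" for y
    using stalk_map_hom_same Vx that by blast
  have cl: "stalk_map T (topspace T) F' \<phi> y (s y) \<in> carrier (stalk T F' y)"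
    if "y \<in> V" "s \<in> carrier (sect (subspace_sheaf T F) V)" for y s
    using hom_in_carrier[OF hom] that by (auto simp: subspace_sheaf_simps)
  show "stalkwise T F' \<phi> V \<in> hom (sect (subspace_sheaf T F) V) (sect (subspace_sheaf T F') V)"
  proof (rule homI)
    fix s assume s: "s \<in> carrier (sect (subspace_sheaf T F) V)"
    have "\<exists>U r. openin T U \<and> x \<in> U \<and> r \<in> carrier (sect F' U) \<and>
        (\<forall>y\<in>U \<inter> V. stalk_map T (topspace T) F' \<phi> y (s y) = germ T F' y U r)" if x: "x \<in> V" for x
    proof -
      obtain U u where U: "openin T U" "x \<in> U" "u \<in> carrier (sect F U)"
        "\<And>y. y \<in> U \<inter> V \<Longrightarrow> s y = germ T F y U u"
        using source.subspace_sheaf_common[OF s s x] by metis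
      then show ?thesis
        using stalk_map_germ_same closed_same
        by (intro exI[where x = U] exI[where x = "\<phi> U u"]) auto
    qed
    then show "stalkwise T F' \<phi> V s \<in> carrier (sect (subspace_sheaf T F') V)"
      using cl[OF _ s] by (auto simp: subspace_sheaf_simps stalkwise_def)
  next
    fix s t assume "s \<in> carrier (sect (subspace_sheaf T F) V)" "t \<in> carrier (sect (subspace_sheaf T F) V)"
    then show "stalkwise T F' \<phi> V (s \<otimes>\<^bsub>sect (subspace_sheaf T F) V\<^esub> t) =
        stalkwise T F' \<phi> V s \<otimes>\<^bsub>sect (subspace_sheaf T F') V\<^esub> stalkwise T F' \<phi> V t"
      using hom by (auto simp: subspace_sheaf_simps stalkwise_def hom_def intro!: restrict_ext)
  qed
  fix U s assume "V \<subseteq> U"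
  then show "stalkwise T F' \<phi> V (rstr (subspace_sheaf T F) U V s) =
      rstr (subspace_sheaf T F') U V (stalkwise T F' \<phi> U s)"
    by (auto simp: subspace_sheaf_simps stalkwise_def Int_absorb1 intro!: restrict_ext)
qed

lemma germ_section_morphism:
  "presheaf_morphism T S F (subspace_sheaf T F') (germ_section T S F' \<phi>)"
proof -
  interpret F': ab_presheaf T F' by (rule target_ab_presheaf)
  interpret sub: ab_presheaf "subtopology T S" "subspace_sheaf T F'"
    by (rule F'.subspace_sheaf_ab_presheaf)
  show ?thesis
  proof
    fix U assume U: "openin T U"
    show "germ_section T S F' \<phi> U \<in> hom (sect F U) (sect (subspace_sheaf T F') (U \<inter> S))"
    proof (rule homI)
      fix s assume "s \<in> carrier (sect F U)"
      then show "germ_section T S F' \<phi> U s \<in> carrier (sect (subspace_sheaf T F') (U \<inter> S))"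
        using U closed_same[OF U] F'.germ_in_stalk[OF U]
        by (auto simp: germ_section_def subspace_sheaf_simps)
    next
      fix s t assume st: "s \<in> carrier (sect F U)" "t \<in> carrier (sect F U)"
      then have "\<phi> U (s \<otimes>\<^bsub>sect F U\<^esub> t) = \<phi> U s \<otimes>\<^bsub>sect F' U\<^esub> \<phi> U t"
        using hom_same[OF U] by (auto simp: hom_def)
      then show "germ_section T S F' \<phi> U (s \<otimes>\<^bsub>sect F U\<^esub> t) =
          germ_section T S F' \<phi> U s \<otimes>\<^bsub>sect (subspace_sheaf T F') (U \<inter> S)\<^esub> germ_section T S F' \<phi> U t"
        using st U closed_same[OF U] F'.germ_mult[OF U]
        by (auto simp: germ_section_def subspace_sheaf_simps intro!: restrict_ext)
    qed
    fix V s assume V: "openin T V" "V \<subseteq> U" "s \<in> carrier (sect F U)"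
    then have "germ T F' y V (rstr F' U V (\<phi> U s)) = germ T F' y U (\<phi> U s)" if "y \<in> V" for y
      using that U closed_same[OF U] by (intro F'.germ_rstr) auto
    moreover have UV: "U \<inter> S \<inter> (V \<inter> S) = V \<inter> S" using V by blast
    ultimately show "germ_section T S F' \<phi> V (rstr F U V s) =
        rstr (subspace_sheaf T F') (U \<inter> S) (V \<inter> S) (germ_section T S F' \<phi> U s)"
      using V U rstr_same UV by (auto simp: germ_section_def subspace_sheaf_simps intro!: restrict_ext)
  qed
qed

lemma stalkwise_germs:
  assumes "openin T U" "s \<in> carrier (sect F U)"
  shows "stalkwise T F' \<phi> (U \<inter> S) (\<lambda>y\<in>U \<inter> S. germ T F y U s) = (\<lambda>y\<in>U \<inter> S. germ T F' y U (\<phi> U s))"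
  using assms stalk_map_germ_same by (auto simp: stalkwise_def intro!: restrict_ext)

end

lemma stalkwise_comp:
  assumes "same_space_morphism T F F' \<phi>" "same_space_morphism T F' F'' \<psi>"
    and V: "openin (subtopology T S) V" and s: "s \<in> carrier (sect (subspace_sheaf T F) V)"
  shows "stalkwise T F'' \<psi> V (stalkwise T F' \<phi> V s) = stalkwise T F'' (\<lambda>U s. \<psi> U (\<phi> U s)) V s"
proof -
  interpret \<phi>: same_space_morphism T F F' \<phi> by fact
  interpret \<psi>: same_space_morphism T F' F'' \<psi> by fact
  have "stalk_map T (topspace T) F'' \<psi> y (stalk_map T (topspace T) F' \<phi> y (s y)) =
      stalk_map T (topspace T) F'' (\<lambda>U s. \<psi> U (\<phi> U s)) y (s y)" if y: "y \<in> V" for y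
  proof -
    have sy: "s y \<in> carrier (stalk T F y)" using s y by (simp add: subspace_sheaf_simps)
    have yT: "y \<in> topspace T" using openin_subset[OF V] y by auto
    have "stalk_map T (topspace T) F'' \<psi> y (stalk_map T (topspace T) F' \<phi> y (s y)) =
        stalk_map T (topspace T) F'' (\<lambda>U s. \<psi> (U \<inter> topspace T) (\<phi> U s)) y (s y)"
      using stalk_map_comp[of T "topspace T" F F' \<phi> "topspace T" F'' \<psi>, OF _ _ sy yT yT]
        \<phi>.presheaf_morphism_axioms \<psi>.presheaf_morphism_axioms by (simp add: subtopology_topspace)
    also have "\<dots> = stalk_map T (topspace T) F'' (\<lambda>U s. \<psi> U (\<phi> U s)) y (s y)"
      using \<phi>.source.ab_presheaf_axioms sy
      by (rule stalk_map_cong) (simp add: \<phi>.open_Int_topspace)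
    finally show ?thesis .
  qed
  then show ?thesis by (auto simp: stalkwise_def intro!: restrict_ext)
qed

lemma stalkwise_cong:
  assumes "ab_presheaf T F" and "s \<in> carrier (sect (subspace_sheaf T F) V)"
    and "\<And>U s. openin T U \<Longrightarrow> s \<in> carrier (sect F U) \<Longrightarrow> \<phi> U s = \<phi>' U s"
  shows "stalkwise T F' \<phi> V s = stalkwise T F' \<phi>' V s"
  unfolding stalkwise_def using assms(2)
  by (intro restrict_ext stalk_map_cong[OF assms(1)] assms(3)) (auto simp: subspace_sheaf_simps)

section \<open>Quotient presheaves\<close>

locale subgroup_presheaf = ab_presheaf T F
  for T :: "'x topology" and F :: "('x, 's) group_presheaf" +
  fixes N :: "'x set \<Rightarrow> 's set"
  assumes subgroup: "openin T U \<Longrightarrow> subgroup (N U) (sect F U)"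
    and rstr_sub: "openin T U \<Longrightarrow> openin T V \<Longrightarrow> V \<subseteq> U \<Longrightarrow> rstr F U V ` N U \<subseteq> N V"
begin

lemma submonoid: "openin T U \<Longrightarrow> submonoid (N U) (sect F U)"
  using subgroup subgroup.subgroup_is_submonoid by blast

lemma group: "openin T U \<Longrightarrow> group (sect F U)"
  using sect_group comm_group_def by blast

lemma quot_carrier:
  "carrier (sect (quot_presheaf F N) U) = {N U #>\<^bsub>sect F U\<^esub> s | s. s \<in> carrier (sect F U)}"
  by (auto simp: quot_presheaf_def FactGroup_def RCOSETS_def)

lemma quot_mult:
  assumes "openin T U" "s \<in> carrier (sect F U)" "t \<in> carrier (sect F U)"
  shows "(N U #>\<^bsub>sect F U\<^esub> s) \<otimes>\<^bsub>sect (quot_presheaf F N) U\<^esub> (N U #>\<^bsub>sect F U\<^esub> t) =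
    N U #>\<^bsub>sect F U\<^esub> (s \<otimes>\<^bsub>sect F U\<^esub> t)"
  using normal.rcos_sum[OF comm_group.subgroup_imp_normal[OF sect_group subgroup]] assms
  by (simp add: quot_presheaf_def)

lemma quot_rstr:
  assumes "openin T U" "openin T V" "V \<subseteq> U" "s \<in> carrier (sect F U)"
  shows "rstr (quot_presheaf F N) U V (N U #>\<^bsub>sect F U\<^esub> s) = N V #>\<^bsub>sect F V\<^esub> rstr F U V s"
  unfolding quot_presheaf_def presheaf.simps
  using assms by (intro image_of_coset group rstr_hom submonoid rstr_sub)

lemma quot_ab_presheaf: "ab_presheaf T (quot_presheaf F N)"
proof (rule ab_presheaf.intro)
  show "is_presheaf T (quot_presheaf F N)"
    unfolding is_presheaf_def
  proof (intro conjI allI impI ballI)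
    fix U V assume "openin T U \<and> openin T V \<and> V \<subseteq> U"
    then show "rstr (quot_presheaf F N) U V \<in>
        carrier (sect (quot_presheaf F N) U) \<rightarrow> carrier (sect (quot_presheaf F N) V)"
      using quot_rstr rstr_closed by (auto simp: quot_carrier)
  next
    fix U s assume "openin T U" "s \<in> carrier (sect (quot_presheaf F N) U)"
    then show "rstr (quot_presheaf F N) U U s = s"
      using quot_rstr rstr_self by (auto simp: quot_carrier)
  next
    fix U V V' s assume "openin T U \<and> openin T V \<and> openin T V' \<and> V' \<subseteq> V \<and> V \<subseteq> U"
      "s \<in> carrier (sect (quot_presheaf F N) U)"
    then show "rstr (quot_presheaf F N) V V' (rstr (quot_presheaf F N) U V s) =
        rstr (quot_presheaf F N) U V' s"
      using quot_rstr rstr_rstr rstr_closed by (auto simp: quot_carrier)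
  qed
  fix U assume U: "openin T U"
  show "comm_group (sect (quot_presheaf F N) U)"
    using comm_group.abelian_FactGroup[OF sect_group subgroup] U by (simp add: quot_presheaf_def)
  fix V assume V: "openin T V" "V \<subseteq> U"
  show "rstr (quot_presheaf F N) U V \<in> hom (sect (quot_presheaf F N) U) (sect (quot_presheaf F N) V)"
  proof (rule homI)
    fix c assume "c \<in> carrier (sect (quot_presheaf F N) U)"
    then show "rstr (quot_presheaf F N) U V c \<in> carrier (sect (quot_presheaf F N) V)"
      using U V quot_rstr rstr_closed by (auto simp: quot_carrier)
  next
    fix c d assume "c \<in> carrier (sect (quot_presheaf F N) U)" "d \<in> carrier (sect (quot_presheaf F N) U)"
    then obtain s t where st: "s \<in> carrier (sect F U)" "t \<in> carrier (sect F U)"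
      "c = N U #>\<^bsub>sect F U\<^esub> s" "d = N U #>\<^bsub>sect F U\<^esub> t" by (auto simp: quot_carrier)
    moreover have "s \<otimes>\<^bsub>sect F U\<^esub> t \<in> carrier (sect F U)"
      using group[OF U] st by (simp add: group.is_monoid monoid.m_closed)
    ultimately show "rstr (quot_presheaf F N) U V (c \<otimes>\<^bsub>sect (quot_presheaf F N) U\<^esub> d) =
      rstr (quot_presheaf F N) U V c \<otimes>\<^bsub>sect (quot_presheaf F N) V\<^esub> rstr (quot_presheaf F N) U V d"
      using U V by (simp add: quot_mult quot_rstr rstr_closed rstr_mult)
  qed
qed

lemma coset_morphism: "same_space_morphism T F (quot_presheaf F N) (\<lambda>U s. N U #>\<^bsub>sect F U\<^esub> s)"
  unfolding same_space_morphism_def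
proof (rule presheaf_morphism_topspaceI)
  fix U assume "openin T U"
  then show "(\<lambda>s. N U #>\<^bsub>sect F U\<^esub> s) \<in> hom (sect F U) (sect (quot_presheaf F N) U)"
    by (intro homI) (auto simp: quot_carrier quot_mult)
qed (auto simp: ab_presheaf_axioms quot_ab_presheaf quot_rstr)

end

text \<open>
  The product with \<open>N' U\<close> enlarges the image of a coset to a full coset; the result is well defined on
  quotients when \<open>\<phi> U\<close> sends the source subgroup into \<open>N' U\<close>.
\<close>

definition quot_map :: "('x, 't) group_presheaf \<Rightarrow> ('x set \<Rightarrow> 't set) \<Rightarrow> ('x set \<Rightarrow> 's \<Rightarrow> 't)
    \<Rightarrow> 'x set \<Rightarrow> 's set \<Rightarrow> 't set" where
  "quot_map F' N' \<phi> U c = N' U <#>\<^bsub>sect F' U\<^esub> (\<phi> U ` c)"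

lemma quot_map_coset:
  assumes "subgroup_presheaf T F N" "subgroup_presheaf T F' N'" "same_space_morphism T F F' \<phi>"
    and "openin T U" "\<phi> U ` N U \<subseteq> N' U" "s \<in> carrier (sect F U)"
  shows "quot_map F' N' \<phi> U (N U #>\<^bsub>sect F U\<^esub> s) = N' U #>\<^bsub>sect F' U\<^esub> \<phi> U s"
  unfolding quot_map_def using assms
  by (intro image_of_coset subgroup_presheaf.group subgroup_presheaf.submonoid
      same_space_morphism.hom_same)

lemma quot_map_morphism:
  assumes "subgroup_presheaf T F N" "subgroup_presheaf T F' N'" "same_space_morphism T F F' \<phi>"
    and sub: "\<And>U. openin T U \<Longrightarrow> \<phi> U ` N U \<subseteq> N' U"
  shows "same_space_morphism T (quot_presheaf F N) (quot_presheaf F' N') (quot_map F' N' \<phi>)"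
  unfolding same_space_morphism_def
proof (rule presheaf_morphism_topspaceI)
  interpret N: subgroup_presheaf T F N by fact
  interpret N': subgroup_presheaf T F' N' by fact
  interpret \<phi>: same_space_morphism T F F' \<phi> by fact
  note val = quot_map_coset[OF assms(1-3) _ sub]
  show "ab_presheaf T (quot_presheaf F N)" "ab_presheaf T (quot_presheaf F' N')"
    by (rule N.quot_ab_presheaf N'.quot_ab_presheaf)+
  fix U assume U: "openin T U"
  show "quot_map F' N' \<phi> U \<in> hom (sect (quot_presheaf F N) U) (sect (quot_presheaf F' N') U)"
  proof (rule homI)
    fix c assume "c \<in> carrier (sect (quot_presheaf F N) U)"
    then show "quot_map F' N' \<phi> U c \<in> carrier (sect (quot_presheaf F' N') U)"
      using U val \<phi>.closed_same[OF U] by (auto simp: N.quot_carrier N'.quot_carrier)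
  next
    fix c d assume "c \<in> carrier (sect (quot_presheaf F N) U)" "d \<in> carrier (sect (quot_presheaf F N) U)"
    then obtain s t where st: "s \<in> carrier (sect F U)" "t \<in> carrier (sect F U)"
      "c = N U #>\<^bsub>sect F U\<^esub> s" "d = N U #>\<^bsub>sect F U\<^esub> t" by (auto simp: N.quot_carrier)
    moreover have "s \<otimes>\<^bsub>sect F U\<^esub> t \<in> carrier (sect F U)"
      using N.group[OF U] st by (simp add: group.is_monoid monoid.m_closed)
    moreover have "\<phi> U (s \<otimes>\<^bsub>sect F U\<^esub> t) = \<phi> U s \<otimes>\<^bsub>sect F' U\<^esub> \<phi> U t"
      using \<phi>.hom_same[OF U] st by (auto simp: hom_def)
    ultimately show "quot_map F' N' \<phi> U (c \<otimes>\<^bsub>sect (quot_presheaf F N) U\<^esub> d) =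
      quot_map F' N' \<phi> U c \<otimes>\<^bsub>sect (quot_presheaf F' N') U\<^esub> quot_map F' N' \<phi> U d"
      using U \<phi>.closed_same[OF U] by (simp add: N.quot_mult N'.quot_mult val)
  qed
  fix V c assume V: "openin T V" "V \<subseteq> U" "c \<in> carrier (sect (quot_presheaf F N) U)"
  then show "quot_map F' N' \<phi> V (rstr (quot_presheaf F N) U V c) =
      rstr (quot_presheaf F' N') U V (quot_map F' N' \<phi> U c)"
    using U \<phi>.closed_same[OF U] \<phi>.rstr_same N.rstr_closed
    by (auto simp: N.quot_carrier N.quot_rstr N'.quot_rstr val)
qed

section \<open>The filtration of a module by powers of an ideal sheaf\<close>

lemma additive_group_simps [simp]:
  "carrier (additive_group M) = carrier M"
  "s \<otimes>\<^bsub>additive_group M\<^esub> t = s \<oplus>\<^bsub>M\<^esub> t"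
  "\<one>\<^bsub>additive_group M\<^esub> = \<zero>\<^bsub>M\<^esub>"
  by (simp_all add: additive_group_def)

lemma additive_group_inv: "inv\<^bsub>additive_group M\<^esub> s = \<ominus>\<^bsub>M\<^esub> s"
  by (simp add: a_inv_def m_inv_def)

lemma additive_group_comm_group:
  assumes "abelian_group M" shows "comm_group (additive_group M)"
proof -
  interpret abelian_group M by fact
  show ?thesis
    by (rule comm_groupI) (auto simp: a_ac intro: bexI[where x = "\<ominus>\<^bsub>M\<^esub> _"] l_neg)
qed

lemma additive_sheaf_simps [simp]:
  "sect (additive_sheaf F) U = additive_group (sect F U)" "rstr (additive_sheaf F) = rstr F"
  by (simp_all add: additive_sheaf_def)

locale ringed_cspace =
  fixes W :: "('x, 'r) cspace"
  assumes ringed: "is_ringed_cspace W"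
begin

abbreviation opn :: "'x set \<Rightarrow> bool" where "opn \<equiv> openin (base W)"
abbreviation R :: "'x set \<Rightarrow> 'r ring" where "R \<equiv> sect (struct W)"
abbreviation res :: "'x set \<Rightarrow> 'x set \<Rightarrow> 'r \<Rightarrow> 'r" where "res \<equiv> rstr (struct W)"

lemma struct_presheaf: "is_presheaf (base W) (struct W)"
  using ringed by (simp add: is_ringed_cspace_def is_sheaf_def)

lemma ring_cring: "opn U \<Longrightarrow> cring (R U)"
  using ringed by (auto simp: is_ringed_cspace_def)

lemma res_hom: "opn U \<Longrightarrow> opn V \<Longrightarrow> V \<subseteq> U \<Longrightarrow> res U V \<in> ring_hom (R U) (R V)"
  using ringed by (auto simp: is_ringed_cspace_def)

lemma res_closed: "opn U \<Longrightarrow> opn V \<Longrightarrow> V \<subseteq> U \<Longrightarrow> a \<in> carrier (R U) \<Longrightarrow> res U V a \<in> carrier (R V)"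
  using ring_hom_closed[OF res_hom] .

lemma res_res:
  "opn U \<Longrightarrow> opn V \<Longrightarrow> opn V' \<Longrightarrow> V' \<subseteq> V \<Longrightarrow> V \<subseteq> U \<Longrightarrow> a \<in> carrier (R U) \<Longrightarrow>
    res V V' (res U V a) = res U V' a"
  using struct_presheaf unfolding is_presheaf_def by blast

lemma res_self: "opn U \<Longrightarrow> a \<in> carrier (R U) \<Longrightarrow> res U U a = a"
  using struct_presheaf unfolding is_presheaf_def by blast

end

locale module_sheaf = ringed_cspace W
  for W :: "('x, 'r) cspace" +
  fixes M :: "('x, 'r, 'm) module_presheaf"
  assumes module_sheaf: "is_module_sheaf W M"
begin

lemma module: "opn U \<Longrightarrow> module (R U) (sect M U)"
  using module_sheaf by (auto simp: is_module_sheaf_def)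

lemma abelian_group: "opn U \<Longrightarrow> abelian_group (sect M U)"
  using module module.axioms by blast

lemma rstr_smult:
  "opn U \<Longrightarrow> opn V \<Longrightarrow> V \<subseteq> U \<Longrightarrow> a \<in> carrier (R U) \<Longrightarrow> s \<in> carrier (sect M U) \<Longrightarrow>
    rstr M U V (a \<odot>\<^bsub>sect M U\<^esub> s) = res U V a \<odot>\<^bsub>sect M V\<^esub> rstr M U V s"
  using module_sheaf by (auto simp: is_module_sheaf_def)

lemma additive_ab_presheaf: "ab_presheaf (base W) (additive_sheaf M)"
proof (rule ab_presheaf.intro)
  have pre: "is_presheaf (base W) M"
    using module_sheaf by (simp add: is_module_sheaf_def is_sheaf_def)
  then show "is_presheaf (base W) (additive_sheaf M)"
    by (simp add: is_presheaf_def)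
  show "opn U \<Longrightarrow> comm_group (sect (additive_sheaf M) U)" for U
    using additive_group_comm_group[OF abelian_group] by simp
  show "opn U \<Longrightarrow> opn V \<Longrightarrow> V \<subseteq> U \<Longrightarrow>
      rstr (additive_sheaf M) U V \<in> hom (sect (additive_sheaf M) U) (sect (additive_sheaf M) V)" for U V
    using pre module_sheaf by (intro homI) (auto simp: is_module_sheaf_def is_presheaf_def Pi_def)
qed

sublocale add: ab_presheaf "base W" "additive_sheaf M"
  by (rule additive_ab_presheaf)

lemmas rstr_closed = add.rstr_closed[unfolded additive_sheaf_simps additive_group_simps]
lemmas rstr_add = add.rstr_mult[unfolded additive_sheaf_simps additive_group_simps]
lemmas rstr_zero = add.rstr_one[unfolded additive_sheaf_simps additive_group_simps]
lemmas rstr_self = add.rstr_self[unfolded additive_sheaf_simps additive_group_simps]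
lemmas rstr_rstr = add.rstr_rstr[unfolded additive_sheaf_simps additive_group_simps]

lemma rstr_minus:
  assumes "opn U" "opn V" "V \<subseteq> U" "s \<in> carrier (sect M U)"
  shows "rstr M U V (\<ominus>\<^bsub>sect M U\<^esub> s) = \<ominus>\<^bsub>sect M V\<^esub> rstr M U V s"
proof -
  have "group_hom (additive_group (sect M U)) (additive_group (sect M V)) (rstr M U V)"
    using assms add.rstr_hom add.sect_group
    by (auto simp: group_hom_def group_hom_axioms_def comm_group_def)
  from group_hom.hom_inv[OF this, of s] assms show ?thesis
    by (simp add: additive_group_inv)
qed

end

text \<open>
  Induction over the additive span of products. Membership in the module is carried along, since the module laws
  used in the steps hold only there.
\<close>

lemma module_span_induct [consumes 3, case_names zero smult minus add]:
  assumes t: "t \<in> module_span M A (carrier M)" and "module R M" and A: "A \<subseteq> carrier R"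
    and zero: "P \<zero>\<^bsub>M\<^esub>"
    and smult: "\<And>a s. a \<in> A \<Longrightarrow> s \<in> carrier M \<Longrightarrow> P (a \<odot>\<^bsub>M\<^esub> s)"
    and minus: "\<And>t. t \<in> carrier M \<Longrightarrow> P t \<Longrightarrow> P (\<ominus>\<^bsub>M\<^esub> t)"
    and add: "\<And>t u. t \<in> carrier M \<Longrightarrow> P t \<Longrightarrow> u \<in> carrier M \<Longrightarrow> P u \<Longrightarrow> P (t \<oplus>\<^bsub>M\<^esub> u)"
  shows "t \<in> carrier M \<and> P t"
proof -
  interpret M: module R M by fact
  interpret G: comm_group "additive_group M"
    by (rule additive_group_comm_group) (rule M.abelian_group_axioms)
  show ?thesis
    using t unfolding module_span_def
  proof (induction rule: generate.induct)
    case one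
    then show ?case using zero by simp
  next
    case (incl h)
    then show ?case using smult A by auto
  next
    case (inv h)
    then show ?case using smult A minus by (auto simp: additive_group_inv subsetD)
  next
    case (eng h1 h2)
    then show ?case using add by simp
  qed
qed

lemma module_span_mono:
  assumes "abelian_group M" "A \<subseteq> B"
  shows "module_span M A C \<subseteq> module_span M B C"
proof -
  interpret comm_group "additive_group M"
    by (rule additive_group_comm_group) fact
  have "{a \<odot>\<^bsub>M\<^esub> x | a x. a \<in> A \<and> x \<in> C} \<subseteq> {a \<odot>\<^bsub>M\<^esub> x | a x. a \<in> B \<and> x \<in> C}"
    using assms(2) by blast
  then show ?thesis unfolding module_span_def by (rule mono_generate)
qed

context module_sheaf
begin

lemma span_subgroup:
  assumes U: "opn U" and A: "A \<subseteq> carrier (R U)"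
  shows "subgroup (module_span (sect M U) A (carrier (sect M U))) (additive_group (sect M U))"
proof -
  interpret U: module "R U" "sect M U" by (rule module[OF U])
  interpret G: comm_group "additive_group (sect M U)"
    using add.sect_group[OF U] by simp
  show ?thesis
    unfolding module_span_def using A by (intro G.generate_is_subgroup) auto
qed

lemma span_smult:
  "a \<in> A \<Longrightarrow> s \<in> carrier (sect M U) \<Longrightarrow> a \<odot>\<^bsub>sect M U\<^esub> s \<in> module_span (sect M U) A (carrier (sect M U))"
  unfolding module_span_def by (auto intro: generate.incl)

lemma span_rstr:
  assumes U: "opn U" and V: "opn V" "V \<subseteq> U" and A: "A \<subseteq> carrier (R U)" and B: "B \<subseteq> carrier (R V)"
    and AB: "res U V ` A \<subseteq> B" and t: "t \<in> module_span (sect M U) A (carrier (sect M U))"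
  shows "rstr M U V t \<in> module_span (sect M V) B (carrier (sect M V))"
proof -
  note sub = span_subgroup[OF V(1) B]
  have "t \<in> carrier (sect M U) \<and> rstr M U V t \<in> module_span (sect M V) B (carrier (sect M V))"
    using t module[OF U] A
  proof (induction rule: module_span_induct)
    case zero
    then show ?case using subgroup.one_closed[OF sub] rstr_zero U V by simp
  next
    case (smult a s)
    then show ?case using U V A AB by (auto simp: rstr_smult subsetD intro!: span_smult rstr_closed)
  next
    case (minus t)
    then show ?case using subgroup.m_inv_closed[OF sub, of "rstr M U V t"] U V
      by (simp add: additive_group_inv rstr_minus)
  next
    case (add t u)
    then show ?case using subgroup.m_closed[OF sub, of "rstr M U V t" "rstr M U V u"] U V
      by (simp add: rstr_add)
  qed
  then show ?thesis by blast
qed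

end

text \<open>
  A family \<open>J U\<close> of subsets of the rings, stable under restriction: what is needed for the
  locally generated submodule \<open>JM\<close> to be a presheaf of subgroups. It is used for the powers of an ideal
  sheaf.
\<close>

locale ideal_family = ringed_cspace W
  for W :: "('x, 'r) cspace" +
  fixes J :: "'x set \<Rightarrow> 'r set"
  assumes subset: "opn U \<Longrightarrow> J U \<subseteq> carrier (R U)"
    and res_mem: "opn U \<Longrightarrow> opn V \<Longrightarrow> V \<subseteq> U \<Longrightarrow> a \<in> J U \<Longrightarrow> res U V a \<in> J V"

locale ideal_family_module = J: ideal_family W J + M: module_sheaf W M
  for W :: "('x, 'r) cspace" and J and M :: "('x, 'r, 'm) module_presheaf"
begin

abbreviation N where "N \<equiv> ideal_times_module W J M"

lemma N_carrier: "s \<in> N U \<Longrightarrow> s \<in> carrier (sect M U)"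
  by (simp add: ideal_times_module_def)

lemma NE:
  assumes "s \<in> N U" "x \<in> U"
  obtains V where "J.opn V" "x \<in> V" "V \<subseteq> U"
    "rstr M U V s \<in> module_span (sect M V) (J V) (carrier (sect M V))"
  using assms by (auto simp: ideal_times_module_def locally_in_def)

lemma span_rstr:
  assumes "J.opn U" "J.opn V" "V \<subseteq> U" "t \<in> module_span (sect M U) (J U) (carrier (sect M U))"
  shows "rstr M U V t \<in> module_span (sect M V) (J V) (carrier (sect M V))"
  using assms J.subset J.res_mem by (intro M.span_rstr[OF assms(1-3), of "J U"]) auto

text \<open>
  Membership in \<open>JM\<close> is a local condition, since it is defined by local membership in the span.
\<close>

lemma NI:
  assumes U: "J.opn U" and s: "s \<in> carrier (sect M U)"
    and loc: "\<And>x. x \<in> U \<Longrightarrow> \<exists>V. J.opn V \<and> x \<in> V \<and> V \<subseteq> U \<and> rstr M U V s \<in> N V"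
  shows "s \<in> N U"
proof -
  have "\<exists>V. J.opn V \<and> x \<in> V \<and> V \<subseteq> U \<and> rstr M U V s \<in> module_span (sect M V) (J V) (carrier (sect M V))"
    if x: "x \<in> U" for x
  proof -
    obtain V where V: "J.opn V" "x \<in> V" "V \<subseteq> U" "rstr M U V s \<in> N V" using loc[OF x] by blast
    obtain V' where V': "J.opn V'" "x \<in> V'" "V' \<subseteq> V"
      "rstr M V V' (rstr M U V s) \<in> module_span (sect M V') (J V') (carrier (sect M V'))"
      using NE[OF V(4,2)] by metis
    then show ?thesis
      using V M.rstr_rstr[OF U V(1) V'(1) V'(3) V(3) s] by auto
  qed
  then show ?thesis using s by (simp add: ideal_times_module_def locally_in_def)
qed

lemma span_in_N:
  assumes U: "J.opn U" and s: "s \<in> module_span (sect M U) (J U) (carrier (sect M U))"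
  shows "s \<in> N U"
proof -
  have "s \<in> carrier (sect M U)"
    using subgroup.subset[OF M.span_subgroup[OF U J.subset[OF U]]] s by auto
  then show ?thesis
    using s U M.rstr_self by (auto simp: ideal_times_module_def locally_in_def)
qed

lemma N_rstr:
  assumes U: "J.opn U" and V: "J.opn V" "V \<subseteq> U" and s: "s \<in> N U"
  shows "rstr M U V s \<in> N V"
proof -
  note sc = N_carrier[OF s]
  have "\<exists>V'. J.opn V' \<and> x \<in> V' \<and> V' \<subseteq> V \<and>
      rstr M V V' (rstr M U V s) \<in> module_span (sect M V') (J V') (carrier (sect M V'))"
    if x: "x \<in> V" for x
  proof -
    have "x \<in> U" using x V by blast
    then obtain A where A: "J.opn A" "x \<in> A" "A \<subseteq> U"
      "rstr M U A s \<in> module_span (sect M A) (J A) (carrier (sect M A))"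
      using NE[OF s] by metis
    have AV: "J.opn (A \<inter> V)" using A V by auto
    have "rstr M A (A \<inter> V) (rstr M U A s) \<in> module_span (sect M (A \<inter> V)) (J (A \<inter> V)) (carrier (sect M (A \<inter> V)))"
      using span_rstr[OF A(1) AV _ A(4)] by simp
    moreover have "rstr M A (A \<inter> V) (rstr M U A s) = rstr M V (A \<inter> V) (rstr M U V s)"
      using M.rstr_rstr[OF U A(1) AV _ A(3) sc] M.rstr_rstr[OF U V(1) AV _ V(2) sc] by simp
    ultimately show ?thesis using AV A x by (intro exI[where x = "A \<inter> V"]) auto
  qed
  then show ?thesis
    using M.rstr_closed[OF U V sc] by (simp add: ideal_times_module_def locally_in_def)
qed

lemma N_subgroup:
  assumes U: "J.opn U" shows "subgroup (N U) (additive_group (sect M U))"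
proof -
  interpret G: comm_group "additive_group (sect M U)"
    using M.add.sect_group[OF U] by simp
  note sub = M.span_subgroup[OF _ J.subset]
  show ?thesis
  proof (rule G.subgroupI)
    show "N U \<subseteq> carrier (additive_group (sect M U))" using N_carrier by auto
    have "\<zero>\<^bsub>sect M U\<^esub> \<in> N U" using span_in_N[OF U] subgroup.one_closed[OF sub[OF U U]] by simp
    then show "N U \<noteq> {}" by blast
  next
    fix s assume s: "s \<in> N U"
    have "\<exists>V. J.opn V \<and> x \<in> V \<and> V \<subseteq> U \<and> rstr M U V (\<ominus>\<^bsub>sect M U\<^esub> s)
        \<in> module_span (sect M V) (J V) (carrier (sect M V))" if x: "x \<in> U" for x
    proof -
      obtain V where V: "J.opn V" "x \<in> V" "V \<subseteq> U"
        "rstr M U V s \<in> module_span (sect M V) (J V) (carrier (sect M V))"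
        using NE[OF s x] by metis
      then show ?thesis
        using subgroup.m_inv_closed[OF sub[OF V(1) V(1)] V(4)] U N_carrier[OF s]
        by (auto simp: additive_group_inv M.rstr_minus)
    qed
    moreover have "\<ominus>\<^bsub>sect M U\<^esub> s \<in> carrier (sect M U)"
      using G.inv_closed[of s] N_carrier[OF s] by (simp add: additive_group_inv)
    ultimately show "inv\<^bsub>additive_group (sect M U)\<^esub> s \<in> N U"
      by (simp add: ideal_times_module_def locally_in_def additive_group_inv)
  next
    fix s t assume s: "s \<in> N U" and t: "t \<in> N U"
    have "\<exists>V. J.opn V \<and> x \<in> V \<and> V \<subseteq> U \<and> rstr M U V (s \<oplus>\<^bsub>sect M U\<^esub> t)
        \<in> module_span (sect M V) (J V) (carrier (sect M V))" if x: "x \<in> U" for x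
    proof -
      obtain A where A: "J.opn A" "x \<in> A" "A \<subseteq> U"
        "rstr M U A s \<in> module_span (sect M A) (J A) (carrier (sect M A))"
        using NE[OF s x] by metis
      obtain B where B: "J.opn B" "x \<in> B" "B \<subseteq> U"
        "rstr M U B t \<in> module_span (sect M B) (J B) (carrier (sect M B))"
        using NE[OF t x] by metis
      let ?V = "A \<inter> B"
      have V: "J.opn ?V" using A B by auto
      have "rstr M U ?V s = rstr M A ?V (rstr M U A s)" "rstr M U ?V t = rstr M B ?V (rstr M U B t)"
        using M.rstr_rstr[OF U A(1) V _ A(3) N_carrier[OF s]]
          M.rstr_rstr[OF U B(1) V _ B(3) N_carrier[OF t]] by simp_all
      then have "rstr M U ?V s \<in> module_span (sect M ?V) (J ?V) (carrier (sect M ?V))"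
        "rstr M U ?V t \<in> module_span (sect M ?V) (J ?V) (carrier (sect M ?V))"
        using span_rstr[OF A(1) V _ A(4)] span_rstr[OF B(1) V _ B(4)] by simp_all
      from subgroup.m_closed[OF sub[OF V V] this]
      have "rstr M U ?V (s \<oplus>\<^bsub>sect M U\<^esub> t) \<in> module_span (sect M ?V) (J ?V) (carrier (sect M ?V))"
        using M.rstr_add[OF U V le_infI1[OF A(3)] N_carrier[OF s] N_carrier[OF t]] by simp
      then show ?thesis using V A B by (intro exI[where x = ?V]) auto
    qed
    then show "s \<otimes>\<^bsub>additive_group (sect M U)\<^esub> t \<in> N U"
      using G.m_closed[of s t] N_carrier[OF s] N_carrier[OF t]
      by (simp add: ideal_times_module_def locally_in_def)
  qed
qed

lemma N_subgroup_presheaf: "subgroup_presheaf (base W) (additive_sheaf M) N"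
  using N_subgroup N_rstr
  by (intro subgroup_presheaf.intro M.add.ab_presheaf_axioms subgroup_presheaf_axioms.intro) auto

end

locale ideal_sheaf = ringed_cspace W
  for W :: "('x, 'r) cspace" +
  fixes I :: "'x set \<Rightarrow> 'r set"
  assumes ideal: "opn U \<Longrightarrow> ideal (I U) (R U)"
    and ideal_res: "opn U \<Longrightarrow> opn V \<Longrightarrow> V \<subseteq> U \<Longrightarrow> a \<in> I U \<Longrightarrow> res U V a \<in> I V"
begin

lemma ideal_subset: "opn U \<Longrightarrow> I U \<subseteq> carrier (R U)"
  using ideal ideal.axioms(1) additive_subgroup.a_subset by blast

lemma ideal_power_subset: "ideal_power W I k U \<subseteq> carrier (R U)"
  by (cases k) auto

lemma ideal_prod_res:
  assumes U: "opn U" and V: "opn V" "V \<subseteq> U" and A: "A \<subseteq> carrier (R U)"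
    and AB: "\<And>a. a \<in> A \<Longrightarrow> res U V a \<in> B"
    and c: "c \<in> ideal_prod (R U) (I U) A"
  shows "res U V c \<in> ideal_prod (R V) (I V) B"
proof -
  note hom = res_hom[OF U V]
  interpret U: cring "R U" by (rule ring_cring[OF U])
  have "c \<in> carrier (R U) \<and> res U V c \<in> ideal_prod (R V) (I V) B"
    using c
  proof (induction rule: ideal_prod.induct)
    case (prod i j)
    then have "i \<in> carrier (R U)" "j \<in> carrier (R U)" using ideal_subset[OF U] A by auto
    then show ?case
      using prod ideal_res[OF U V] AB ring_hom_mult[OF hom] by (auto intro: ideal_prod.prod)
  next
    case (sum s1 s2)
    then show ?case using ring_hom_add[OF hom] by (auto intro: ideal_prod.sum)
  qed
  then show ?thesis by blast
qed

lemma ideal_power_res: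
  assumes "opn U" "opn V" "V \<subseteq> U" "a \<in> ideal_power W I k U"
  shows "res U V a \<in> ideal_power W I k V"
  using assms
proof (induction k arbitrary: U V a)
  case 0
  then show ?case using res_closed by simp
next
  case (Suc k)
  have a: "a \<in> carrier (R U)" using Suc.prems by simp
  have "\<exists>V'. opn V' \<and> x \<in> V' \<and> V' \<subseteq> V \<and>
      res V V' (res U V a) \<in> ideal_prod (R V') (I V') (ideal_power W I k V')" if x: "x \<in> V" for x
  proof -
    have "x \<in> U" using x Suc.prems by blast
    then obtain A where A: "opn A" "x \<in> A" "A \<subseteq> U" "res U A a \<in> ideal_prod (R A) (I A) (ideal_power W I k A)"
      using Suc.prems(4) by (auto simp: locally_in_def)
    have AV: "opn (A \<inter> V)" using A Suc.prems by auto
    have "res A (A \<inter> V) (res U A a) \<in> ideal_prod (R (A \<inter> V)) (I (A \<inter> V)) (ideal_power W I k (A \<inter> V))"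
      using ideal_prod_res[OF A(1) AV _ ideal_power_subset _ A(4)] Suc.IH[OF A(1) AV] by blast
    moreover have "res A (A \<inter> V) (res U A a) = res V (A \<inter> V) (res U V a)"
      using res_res[OF Suc.prems(1) A(1) AV _ A(3) a] res_res[OF Suc.prems(1,2) AV _ Suc.prems(3) a] by simp
    ultimately show ?thesis using AV A x by (intro exI[where x = "A \<inter> V"]) auto
  qed
  then show ?case
    using res_closed[OF Suc.prems(1-3) a] by (simp add: locally_in_def)
qed

lemma ideal_power_family: "ideal_family W (ideal_power W I k)"
  by unfold_locales (use ideal_power_subset ideal_power_res in auto)

lemma ideal_power_mult:
  assumes U: "opn U" and b: "b \<in> I U" and a: "a \<in> ideal_power W I k U"
  shows "b \<otimes>\<^bsub>R U\<^esub> a \<in> ideal_power W I (Suc k) U"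
proof -
  interpret U: cring "R U" by (rule ring_cring[OF U])
  have "b \<otimes>\<^bsub>R U\<^esub> a \<in> carrier (R U)"
    using ideal_subset[OF U] ideal_power_subset a b by blast
  then show ?thesis
    using U a b res_self by (auto simp: locally_in_def intro!: exI[where x = U] ideal_prod.prod)
qed

lemma ideal_power_Suc_subset:
  assumes "opn U" "a \<in> ideal_power W I (Suc k) U" shows "a \<in> ideal_power W I k U"
  using assms
proof (induction k arbitrary: U a)
  case 0
  then show ?case by simp
next
  case (Suc k)
  have "c \<in> ideal_prod (R V) (I V) (ideal_power W I k V)"
    if "c \<in> ideal_prod (R V) (I V) (ideal_power W I (Suc k) V)" "opn V" for V c
    using that(1)
    by (induction rule: ideal_prod.induct) (use Suc.IH[OF that(2)] in \<open>auto intro: ideal_prod.intros\<close>)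
  then have "locally_in (base W) (struct W) (\<lambda>V. ideal_prod (R V) (I V) (ideal_power W I k V)) U a"
    using Suc.prems(2) unfolding ideal_power.simps(2)[of W I "Suc k"] locally_in_def by blast
  then show ?case using Suc.prems(2) by simp
qed

end

\<comment> \<open>Unfolding the recursion by default would make the closure lemmas for powers inapplicable.\<close>
declare ideal_power.simps(2) [simp del]

locale ideal_sheaf_module = ideal_sheaf W I + M: module_sheaf W M
  for W :: "('x, 'r) cspace" and I and M :: "('x, 'r, 'm) module_presheaf"
begin

abbreviation IM where "IM k \<equiv> ideal_times_module W (ideal_power W I k) M"

lemma family_module: "ideal_family_module W (ideal_power W I k) M"
  by (intro ideal_family_module.intro ideal_power_family M.module_sheaf_axioms)

lemmas IM_carrier = ideal_family_module.N_carrier[OF family_module]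
  and IME = ideal_family_module.NE[OF family_module]
  and IMI = ideal_family_module.NI[OF family_module]
  and span_in_IM = ideal_family_module.span_in_N[OF family_module]
  and IM_subgroup = ideal_family_module.N_subgroup[OF family_module]
  and IM_subgroup_presheaf = ideal_family_module.N_subgroup_presheaf[OF family_module]

lemma IM_smult:
  assumes U: "opn U" and a: "a \<in> ideal_power W I k U" and s: "s \<in> carrier (sect M U)"
  shows "a \<odot>\<^bsub>sect M U\<^esub> s \<in> IM k U"
  using span_in_IM[OF U] M.span_smult a s by blast

text \<open>
  The zeroth power is the whole ring, so every section is one times itself.
\<close>

lemma IM_zero:
  assumes U: "opn U" and s: "s \<in> carrier (sect M U)" shows "s \<in> IM 0 U"
proof -
  interpret U: module "R U" "sect M U" by (rule M.module[OF U])
  show ?thesis using IM_smult[OF U, of "\<one>\<^bsub>R U\<^esub>" 0 s] s by simp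
qed

lemma IM_add: "opn U \<Longrightarrow> s \<in> IM k U \<Longrightarrow> t \<in> IM k U \<Longrightarrow> s \<oplus>\<^bsub>sect M U\<^esub> t \<in> IM k U"
  using subgroup.m_closed[OF IM_subgroup, of U s k t] by simp

lemma IM_minus: "opn U \<Longrightarrow> s \<in> IM k U \<Longrightarrow> \<ominus>\<^bsub>sect M U\<^esub> s \<in> IM k U"
  using subgroup.m_inv_closed[OF IM_subgroup, of U s k] by (simp add: additive_group_inv)

lemma IM_zero_mem: "opn U \<Longrightarrow> \<zero>\<^bsub>sect M U\<^esub> \<in> IM k U"
  using subgroup.one_closed[OF IM_subgroup, of U k] by simp

text \<open>
  This holds for the generators \<open>a s\<close> of \<open>I\<^sup>kM\<close>, because \<open>b a\<close> lies in \<open>I\<^sup>k\<^sup>+\<^sup>1\<close>, and it passes to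
  sums and to sections that are locally of this form.
\<close>

lemma ideal_smult_IM:
  assumes U: "opn U" and b: "b \<in> I U" and s: "s \<in> IM k U"
  shows "b \<odot>\<^bsub>sect M U\<^esub> s \<in> IM (Suc k) U"
proof (rule IMI[OF U])
  interpret U: module "R U" "sect M U" by (rule M.module[OF U])
  have bc: "b \<in> carrier (R U)" using b ideal_subset[OF U] by blast
  then show "b \<odot>\<^bsub>sect M U\<^esub> s \<in> carrier (sect M U)" using IM_carrier[OF s] by simp
  fix x assume x: "x \<in> U"
  obtain V where V: "opn V" "x \<in> V" "V \<subseteq> U"
    "rstr M U V s \<in> module_span (sect M V) (ideal_power W I k V) (carrier (sect M V))"
    using IME[OF s x] by metis
  interpret V: module "R V" "sect M V" by (rule M.module[OF V(1)])
  let ?b = "res U V b"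
  have b': "?b \<in> I V" "?b \<in> carrier (R V)"
    using ideal_res[OF U V(1,3) b] ideal_subset[OF V(1)] by auto
  have "t \<in> carrier (sect M V) \<and> ?b \<odot>\<^bsub>sect M V\<^esub> t \<in> IM (Suc k) V"
    if "t \<in> module_span (sect M V) (ideal_power W I k V) (carrier (sect M V))" for t
    using that V.module_axioms ideal_power_subset
  proof (induction rule: module_span_induct)
    case zero
    then show ?case using b' IM_zero_mem[OF V(1)] by simp
  next
    case (smult a s)
    have "a \<in> carrier (R V)" using smult ideal_power_subset by blast
    then have "?b \<odot>\<^bsub>sect M V\<^esub> (a \<odot>\<^bsub>sect M V\<^esub> s) = (?b \<otimes>\<^bsub>R V\<^esub> a) \<odot>\<^bsub>sect M V\<^esub> s"
      using b' smult by (simp add: V.smult_assoc1)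
    then show ?case
      using IM_smult[OF V(1) ideal_power_mult[OF V(1) b'(1) smult(1)] smult(2)] by simp
  next
    case (minus t)
    then show ?case using b' IM_minus[OF V(1)] by (simp add: V.smult_r_minus)
  next
    case (add t u)
    then show ?case using b' IM_add[OF V(1)] by (simp add: V.smult_r_distr)
  qed
  from this[OF V(4)]
  have "rstr M U V (b \<odot>\<^bsub>sect M U\<^esub> s) \<in> IM (Suc k) V"
    using M.rstr_smult[OF U V(1,3) bc IM_carrier[OF s]] by simp
  then show "\<exists>V. opn V \<and> x \<in> V \<and> V \<subseteq> U \<and> rstr M U V (b \<odot>\<^bsub>sect M U\<^esub> s) \<in> IM (Suc k) V"
    using V by blast
qed

end

lemma (in ideal_sheaf_module) IM_antimono:
  assumes U: "opn U" and s: "s \<in> IM (n + k) U" shows "s \<in> IM k U"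
  using s
proof (induction n)
  case (Suc n)
  have "s \<in> IM (n + k) U"
  proof (rule IMI[OF U])
    show "s \<in> carrier (sect M U)" using IM_carrier[OF Suc.prems] .
    fix x assume "x \<in> U"
    then obtain V where V: "opn V" "x \<in> V" "V \<subseteq> U" "rstr M U V s \<in>
        module_span (sect M V) (ideal_power W I (Suc n + k) V) (carrier (sect M V))"
      using IME[OF Suc.prems] by metis
    have "ideal_power W I (Suc n + k) V \<subseteq> ideal_power W I (n + k) V"
      using ideal_power_Suc_subset[OF V(1), of _ "n + k"] by (simp add: subsetI)
    then have "rstr M U V s \<in> module_span (sect M V) (ideal_power W I (n + k) V) (carrier (sect M V))"
      using subsetD[OF module_span_mono[OF M.abelian_group[OF V(1)]] V(4)] by blast
    then have "rstr M U V s \<in> IM (n + k) V"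
      by (rule span_in_IM[OF V(1)])
    then show "\<exists>V. opn V \<and> x \<in> V \<and> V \<subseteq> U \<and> rstr M U V s \<in> IM (n + k) V"
      using V(1-3) by blast
  qed
  then show ?case by (rule Suc.IH)
qed simp

section \<open>Differential operators and the filtration\<close>

locale ideal_sheaf_module_pair = M: ideal_sheaf_module W I M + N: ideal_sheaf_module W I N
  for W :: "('x, 'r) cspace" and I and M :: "('x, 'r, 'm) module_presheaf"
    and N :: "('x, 'r, 'n) module_presheaf"
begin

lemma local_homD:
  assumes "sheaf_hom (subtopology (base W) U) M N D" "M.opn U" "M.opn V" "V \<subseteq> U"
  shows "s \<in> carrier (sect M V) \<Longrightarrow> D V s \<in> carrier (sect N V)"
    and "s \<in> carrier (sect M V) \<Longrightarrow> t \<in> carrier (sect M V) \<Longrightarrow>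
      D V (s \<oplus>\<^bsub>sect M V\<^esub> t) = D V s \<oplus>\<^bsub>sect N V\<^esub> D V t"
    and "M.opn V' \<Longrightarrow> V' \<subseteq> V \<Longrightarrow> s \<in> carrier (sect M V) \<Longrightarrow> D V' (rstr M V V' s) = rstr N V V' (D V s)"
    and "D V \<zero>\<^bsub>sect M V\<^esub> = \<zero>\<^bsub>sect N V\<^esub>"
    and "s \<in> carrier (sect M V) \<Longrightarrow> D V (\<ominus>\<^bsub>sect M V\<^esub> s) = \<ominus>\<^bsub>sect N V\<^esub> D V s"
proof -
  have open_sub: "openin (subtopology (base W) U) A \<longleftrightarrow> M.opn A \<and> A \<subseteq> U" for A
    using openin_open_subtopology[OF assms(2)] by simp
  have fact1: "\<forall>s\<in>carrier (sect M V). D V s \<in> carrier (sect N V)"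
    and fact2: "\<forall>s\<in>carrier (sect M V). \<forall>t\<in>carrier (sect M V).
      D V (s \<oplus>\<^bsub>sect M V\<^esub> t) = D V s \<oplus>\<^bsub>sect N V\<^esub> D V t"
    and fact3: "\<forall>V'. M.opn V' \<and> V' \<subseteq> V \<longrightarrow>
       (\<forall>s\<in>carrier (sect M V). D V' (rstr M V V' s) = rstr N V V' (D V s))"
    using assms unfolding sheaf_hom_def open_sub by (auto dest: order_trans)
  show "s \<in> carrier (sect M V) \<Longrightarrow> D V s \<in> carrier (sect N V)"
    "s \<in> carrier (sect M V) \<Longrightarrow> t \<in> carrier (sect M V) \<Longrightarrow>
      D V (s \<oplus>\<^bsub>sect M V\<^esub> t) = D V s \<oplus>\<^bsub>sect N V\<^esub> D V t"
    "M.opn V' \<Longrightarrow> V' \<subseteq> V \<Longrightarrow> s \<in> carrier (sect M V) \<Longrightarrow> D V' (rstr M V V' s) = rstr N V V' (D V s)"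
    using fact1 fact2 fact3 by blast+
  have "group_hom (additive_group (sect M V)) (additive_group (sect N V)) (D V)"
    using fact1 fact2 M.M.add.sect_group[OF assms(3)] N.M.add.sect_group[OF assms(3)]
    by (auto simp: group_hom_def group_hom_axioms_def comm_group_def hom_def)
  from group_hom.hom_one[OF this] group_hom.hom_inv[OF this, of s]
  show "D V \<zero>\<^bsub>sect M V\<^esub> = \<zero>\<^bsub>sect N V\<^esub>"
    "s \<in> carrier (sect M V) \<Longrightarrow> D V (\<ominus>\<^bsub>sect M V\<^esub> s) = \<ominus>\<^bsub>sect N V\<^esub> D V s"
    by (simp_all add: additive_group_inv)
qed

text \<open>
  An additive local operator needs to be controlled only on the products that generate \<open>I\<^sup>mM\<close>, over
  all smaller open sets.
\<close>

lemma local_hom_IM: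
  assumes D: "sheaf_hom (subtopology (base W) U) M N D" and U: "M.opn U"
    and V: "M.opn V" "V \<subseteq> U" and s: "s \<in> M.IM m V"
    and gen: "\<And>A a s. M.opn A \<Longrightarrow> A \<subseteq> V \<Longrightarrow> a \<in> ideal_power W I m A \<Longrightarrow> s \<in> carrier (sect M A) \<Longrightarrow>
      D A (a \<odot>\<^bsub>sect M A\<^esub> s) \<in> N.IM k A"
  shows "D V s \<in> N.IM k V"
proof (rule N.IMI[OF V(1)])
  note sc = M.IM_carrier[OF s]
  show "D V s \<in> carrier (sect N V)" using local_homD(1)[OF D U V] sc by blast
  fix x assume x: "x \<in> V"
  obtain A where A: "M.opn A" "x \<in> A" "A \<subseteq> V"
    "rstr M V A s \<in> module_span (sect M A) (ideal_power W I m A) (carrier (sect M A))"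
    using M.IME[OF s x] by metis
  have AU: "A \<subseteq> U" using A V by blast
  note d = local_homD[OF D U A(1) AU]
  have "t \<in> carrier (sect M A) \<and> D A t \<in> N.IM k A"
    if "t \<in> module_span (sect M A) (ideal_power W I m A) (carrier (sect M A))" for t
    using that M.M.module[OF A(1)] M.ideal_power_subset
  proof (induction rule: module_span_induct)
    case zero
    then show ?case using d(4) N.IM_zero_mem[OF A(1)] by simp
  next
    case (smult a s)
    then show ?case using gen[OF A(1,3)] by blast
  next
    case (minus t)
    then show ?case using d(5) N.IM_minus[OF A(1)] by simp
  next
    case (add t u)
    then show ?case using d(2) N.IM_add[OF A(1)] by simp
  qed
  from this[OF A(4)] have "rstr N V A (D V s) \<in> N.IM k A"
    using local_homD(3)[OF D U V A(1,3) sc] by simp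
  then show "\<exists>A. M.opn A \<and> x \<in> A \<and> A \<subseteq> V \<and> rstr N V A (D V s) \<in> N.IM k A"
    using A by blast
qed

text \<open>
  The operator \<open>[D, b]\<close> of the recursive definition of the order, on open subsets of \<open>V\<close>.
\<close>

definition commutator :: "('x set \<Rightarrow> 'm \<Rightarrow> 'n) \<Rightarrow> 'x set \<Rightarrow> 'r \<Rightarrow> 'x set \<Rightarrow> 'm \<Rightarrow> 'n" where
  "commutator D V b = (\<lambda>V' s. D V' (M.res V V' b \<odot>\<^bsub>sect M V'\<^esub> s)
     \<ominus>\<^bsub>sect N V'\<^esub> M.res V V' b \<odot>\<^bsub>sect N V'\<^esub> D V' s)"

lemma commutator_local_hom:
  assumes D: "sheaf_hom (subtopology (base W) U) M N D" and U: "M.opn U"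
    and V: "M.opn V" "V \<subseteq> U" and b: "b \<in> carrier (M.R V)"
  shows "sheaf_hom (subtopology (base W) V) M N (commutator D V b)"
proof -
  have open_sub: "openin (subtopology (base W) V) A \<longleftrightarrow> M.opn A \<and> A \<subseteq> V" for A
    using openin_open_subtopology[OF V(1)] by simp
  show ?thesis
    unfolding sheaf_hom_def open_sub
  proof (intro conjI allI impI ballI funcsetI; (elim conjE)?)
    fix A s assume A: "M.opn A" "A \<subseteq> V" and s: "s \<in> carrier (sect M A)"
    then have AU: "A \<subseteq> U" using V by blast
    interpret MA: module "M.R A" "sect M A" by (rule M.M.module[OF A(1)])
    interpret NA: module "M.R A" "sect N A" by (rule N.M.module[OF A(1)])
    note d = local_homD[OF D U A(1) AU]
    note b' = M.res_closed[OF V(1) A b]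
    show "commutator D V b A s \<in> carrier (sect N A)"
      using b' s d(1) by (simp add: commutator_def)
    {
      fix t assume t: "t \<in> carrier (sect M A)"
      show "commutator D V b A (s \<oplus>\<^bsub>sect M A\<^esub> t) =
          commutator D V b A s \<oplus>\<^bsub>sect N A\<^esub> commutator D V b A t"
        using b' s t d(1,2)
        by (simp add: commutator_def MA.smult_r_distr NA.smult_r_distr NA.minus_eq NA.minus_add NA.a_ac)
    }
  next
    fix A B s assume A: "M.opn A" "A \<subseteq> V" and B: "M.opn B" "B \<subseteq> V" and BA: "B \<subseteq> A"
      and s: "s \<in> carrier (sect M A)"
    then have AU: "A \<subseteq> U" using V by blast
    interpret MA: module "M.R A" "sect M A" by (rule M.M.module[OF A(1)])
    interpret NA: module "M.R A" "sect N A" by (rule N.M.module[OF A(1)])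
    note d = local_homD[OF D U A(1) AU]
    note b' = M.res_closed[OF V(1) A b]
    have bB: "M.res A B (M.res V A b) = M.res V B b"
      using M.res_res[OF V(1) A(1) B(1) BA A(2) b] .
    show "commutator D V b B (rstr M A B s) = rstr N A B (commutator D V b A s)"
      using b' s d(1) d(3)[OF B(1) BA] d(3)[OF B(1) BA, of "M.res V A b \<odot>\<^bsub>sect M A\<^esub> s"] A B BA bB
      by (simp add: commutator_def M.M.rstr_smult N.M.rstr_smult NA.minus_eq a_minus_def
          N.M.rstr_add N.M.rstr_minus)
  qed
qed

text \<open>
  By induction on the order, and for fixed order on \<open>k\<close>. For the order zero the operator is linear, and for \<open>k = 0\<close> the target is all of \<open>N\<close>. If the order is at
  most \<open>n + 1\<close>, a section of \<open>I\<^sup>n\<^sup>+\<^sup>k\<^sup>+\<^sup>2M\<close> is locally a sum of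
  sections \<open>b t\<close> with \<open>b\<close> in \<open>I\<close> and \<open>t\<close> in \<open>I\<^sup>n\<^sup>+\<^sup>k\<^sup>+\<^sup>1M\<close>, and \<open>D (b t) = [D, b] t + b D t\<close>. The commutator has
  order at most \<open>n\<close>, so it maps \<open>t\<close> into \<open>I\<^sup>k\<^sup>+\<^sup>1N\<close>; the induction on \<open>k\<close> puts \<open>D t\<close> into \<open>I\<^sup>kN\<close>, and the factor
  \<open>b\<close> gains the missing power.
\<close>

lemma diff_operator_IM:
  assumes "sheaf_hom (subtopology (base W) U) M N D" "diff_order_le W M N n U D" "M.opn U"
    and "M.opn V" "V \<subseteq> U" "s \<in> M.IM (n + k) V"
  shows "D V s \<in> N.IM k V"
  using assms
proof (induction n arbitrary: U D V s k)
  case 0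
  have "D A (a \<odot>\<^bsub>sect M A\<^esub> s) \<in> N.IM k A"
    if A: "M.opn A" "A \<subseteq> V" and a: "a \<in> ideal_power W I k A" and s: "s \<in> carrier (sect M A)" for A a s
  proof -
    have AU: "A \<subseteq> U" using A 0 by blast
    have ac: "a \<in> carrier (M.R A)" using a M.ideal_power_subset by blast
    have "D A (a \<odot>\<^bsub>sect M A\<^esub> s) = a \<odot>\<^bsub>sect N A\<^esub> D A s"
      using 0(2) A AU ac s by simp
    then show ?thesis
      using N.IM_smult[OF A(1) a local_homD(1)[OF 0(1,3) A(1) AU s]] by simp
  qed
  then show ?case
    using 0 by (intro local_hom_IM[OF 0(1,3,4,5), where m = k]) auto
next
  case (Suc n)
  note D = Suc.prems(1) and ord = Suc.prems(2) and U = Suc.prems(3)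
  \<comment> \<open>One step of the inner induction: \<open>D (b t) = [D, b] t + b D t\<close>.\<close>
  have step: "D V (b \<odot>\<^bsub>sect M V\<^esub> t) \<in> N.IM (Suc k) V"
    if V: "M.opn V" "V \<subseteq> U" and b: "b \<in> I V" and t: "t \<in> M.IM (n + Suc k) V"
      and Dt: "D V t \<in> N.IM k V" for V b t k
  proof -
    interpret MV: module "M.R V" "sect M V" by (rule M.M.module[OF V(1)])
    interpret NV: module "M.R V" "sect N V" by (rule N.M.module[OF V(1)])
    have bc: "b \<in> carrier (M.R V)" using b M.ideal_subset[OF V(1)] by blast
    have tc: "t \<in> carrier (sect M V)" using M.IM_carrier[OF t] .
    note d = local_homD(1)[OF D U V]
    have "diff_order_le W M N n V (commutator D V b)"
      using ord V bc by (simp add: commutator_def)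
    then have 1: "commutator D V b V t \<in> N.IM (Suc k) V"
      using Suc.IH[OF commutator_local_hom[OF D U V bc] _ V(1) V(1) order_refl t] by blast
    have 2: "b \<odot>\<^bsub>sect N V\<^esub> D V t \<in> N.IM (Suc k) V"
      by (rule N.ideal_smult_IM[OF V(1) b Dt])
    have "D V (b \<odot>\<^bsub>sect M V\<^esub> t) = commutator D V b V t \<oplus>\<^bsub>sect N V\<^esub> b \<odot>\<^bsub>sect N V\<^esub> D V t"
      using bc tc d M.res_self[OF V(1) bc]
      by (simp add: commutator_def NV.minus_eq NV.a_assoc NV.l_neg)
    then show ?thesis using N.IM_add[OF V(1) 1 2] by simp
  qed
  show ?case
    using Suc.prems(4,5,6)
  proof (induction k arbitrary: V s)
    case 0
    then show ?case
      using N.IM_zero local_homD(1)[OF D U] M.IM_carrier by blast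
  next
    case (Suc k)
    have "D A (a \<odot>\<^bsub>sect M A\<^esub> s) \<in> N.IM (Suc k) A"
      if A: "M.opn A" "A \<subseteq> V" and a: "a \<in> ideal_power W I (Suc n + Suc k) A"
        and s: "s \<in> carrier (sect M A)" for A a s
    proof (rule N.IMI[OF A(1)])
      have AU: "A \<subseteq> U" using A Suc.prems by blast
      interpret MA: module "M.R A" "sect M A" by (rule M.M.module[OF A(1)])
      have ac: "a \<in> carrier (M.R A)" using a M.ideal_power_subset by blast
      show "D A (a \<odot>\<^bsub>sect M A\<^esub> s) \<in> carrier (sect N A)"
        using local_homD(1)[OF D U A(1) AU] ac s by simp
      fix x assume x: "x \<in> A"
      obtain B where B: "M.opn B" "x \<in> B" "B \<subseteq> A"
        "M.res A B a \<in> ideal_prod (M.R B) (I B) (ideal_power W I (Suc n + k) B)"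
        using a x by (auto simp: ideal_power.simps(2) locally_in_def)
      have BU: "B \<subseteq> U" using B AU by blast
      interpret MB: module "M.R B" "sect M B" by (rule M.M.module[OF B(1)])
      note d = local_homD[OF D U B(1) BU]
      let ?s = "rstr M A B s"
      have sB: "?s \<in> carrier (sect M B)" using M.M.rstr_closed[OF A(1) B(1,3) s] .
      have "c \<in> carrier (M.R B) \<and> D B (c \<odot>\<^bsub>sect M B\<^esub> ?s) \<in> N.IM (Suc k) B"
        if "c \<in> ideal_prod (M.R B) (I B) (ideal_power W I (Suc n + k) B)" for c
        using that
      proof (induction rule: ideal_prod.induct)
        case (prod i j)
        have ij: "i \<in> carrier (M.R B)" "j \<in> carrier (M.R B)"
          using prod M.ideal_subset[OF B(1)] M.ideal_power_subset by auto
        have t: "j \<odot>\<^bsub>sect M B\<^esub> ?s \<in> M.IM (Suc n + k) B"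
          by (rule M.IM_smult[OF B(1) prod(2) sB])
        have "D B (j \<odot>\<^bsub>sect M B\<^esub> ?s) \<in> N.IM k B"
          by (rule Suc.IH[OF B(1) BU t])
        then have "D B (i \<odot>\<^bsub>sect M B\<^esub> (j \<odot>\<^bsub>sect M B\<^esub> ?s)) \<in> N.IM (Suc k) B"
          using step[OF B(1) BU prod(1)] t by simp
        then show ?case using ij sB by (simp add: MB.smult_assoc1)
      next
        case (sum c1 c2)
        then show ?case
          using d(2) sB N.IM_add[OF B(1)] by (simp add: MB.smult_l_distr)
      qed
      from this[OF B(4)] have "rstr N A B (D A (a \<odot>\<^bsub>sect M A\<^esub> s)) \<in> N.IM (Suc k) B"
        using local_homD(3)[OF D U A(1) AU B(1,3), of "a \<odot>\<^bsub>sect M A\<^esub> s"] ac s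
          M.M.rstr_smult[OF A(1) B(1,3) ac s] by simp
      then show "\<exists>B. M.opn B \<and> x \<in> B \<and> B \<subseteq> A \<and> rstr N A B (D A (a \<odot>\<^bsub>sect M A\<^esub> s)) \<in> N.IM (Suc k) B"
        using B by blast
    qed
    then show ?case
      by (rule local_hom_IM[OF D U Suc.prems(1,2,3)])
  qed
qed

end

section \<open>Lifting along a differential splitting\<close>

lemma ideal_sheafI:
  assumes "is_ringed_cspace W" and "closed_subscheme W I" shows "ideal_sheaf W I"
proof (intro ideal_sheaf.intro ringed_cspace.intro ideal_sheaf_axioms.intro)
  show "is_ringed_cspace W" by fact
  show "openin (base W) U \<Longrightarrow> ideal (I U) (sect (struct W) U)" for U
    using assms(2) by (simp add: closed_subscheme_def)
  have "is_presheaf (base W) (ideal_module W I)"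
    using assms(2) by (simp add: closed_subscheme_def quasi_coherent_def is_module_sheaf_def is_sheaf_def)
  moreover have "carrier (sect (ideal_module W I) U) = I U" for U
    by (simp add: ideal_module_def Let_def)
  moreover have "rstr (ideal_module W I) = rstr (struct W)"
    by (simp add: ideal_module_def)
  ultimately show "openin (base W) U \<Longrightarrow> openin (base W) V \<Longrightarrow> V \<subseteq> U \<Longrightarrow> a \<in> I U \<Longrightarrow>
      rstr (struct W) U V a \<in> I V" for U V a
    by (simp add: is_presheaf_def Pi_iff)
qed

lemma sheaf_hom_morphism:
  assumes "module_sheaf W M" "module_sheaf W N" "sheaf_hom (base W) M N \<phi>"
  shows "same_space_morphism (base W) (additive_sheaf M) (additive_sheaf N) \<phi>"
  unfolding same_space_morphism_def
proof (rule presheaf_morphism_topspaceI)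
  show "ab_presheaf (base W) (additive_sheaf M)" "ab_presheaf (base W) (additive_sheaf N)"
    using module_sheaf.additive_ab_presheaf assms by blast+
qed (use assms(3) in \<open>auto simp: sheaf_hom_def hom_def\<close>)

context ideal_sheaf_module
begin

lemma subscheme_space_subset: "subscheme_space W I \<subseteq> topspace (base W)"
  by (auto simp: subscheme_space_def support_def)

lemma inf_sheaf_eq: "inf_sheaf W I M k = subspace_sheaf (base W) (inf_presheaf W I M k)"
  by (simp add: inf_sheaf_def)

lemma coset_same_space_morphism:
  "same_space_morphism (base W) (additive_sheaf M) (inf_presheaf W I M k)
    (\<lambda>U s. IM (k + 1) U #>\<^bsub>sect (additive_sheaf M) U\<^esub> s)"
  unfolding inf_presheaf_def
  by (rule subgroup_presheaf.coset_morphism[OF IM_subgroup_presheaf])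

lemma to_inf_sheaf_eq: "to_inf_sheaf W I M k =
    germ_section (base W) (subscheme_space W I) (inf_presheaf W I M k) (\<lambda>U s. IM (k + 1) U #>\<^bsub>sect (additive_sheaf M) U\<^esub> s)"
  by (simp add: to_inf_sheaf_def germ_section_def fun_eq_iff)

lemma inf_sheaf_proj_eq: "inf_sheaf_proj W I M k =
    stalkwise (base W) (inf_presheaf W I M k) (quot_map (additive_sheaf M) (IM (k + 1)) (\<lambda>U s. s))"
  by (simp add: inf_sheaf_proj_def stalkwise_def quot_map_def[abs_def] fun_eq_iff)

lemma id_morphism: "same_space_morphism (base W) (additive_sheaf M) (additive_sheaf M) (\<lambda>U s. s)"
  unfolding same_space_morphism_def
  by (rule presheaf_morphism_topspaceI) (auto simp: M.additive_ab_presheaf hom_def)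

lemma proj_same_space_morphism:
  "same_space_morphism (base W) (inf_presheaf W I M (k + j)) (inf_presheaf W I M k)
     (quot_map (additive_sheaf M) (IM (k + 1)) (\<lambda>U s. s))"
  unfolding inf_presheaf_def
  using IM_antimono[of _ _ j "k + 1"]
  by (intro quot_map_morphism[OF IM_subgroup_presheaf IM_subgroup_presheaf id_morphism])
    (auto simp: ac_simps)

lemma proj_coset:
  assumes "opn U" "s \<in> carrier (sect M U)"
  shows "quot_map (additive_sheaf M) (IM (k + 1)) (\<lambda>U s. s) U (IM (k + j + 1) U #>\<^bsub>sect (additive_sheaf M) U\<^esub> s)
    = IM (k + 1) U #>\<^bsub>sect (additive_sheaf M) U\<^esub> s"
  using IM_antimono[OF assms(1), of _ j "k + 1"] assms
  by (intro quot_map_coset[OF IM_subgroup_presheaf IM_subgroup_presheaf id_morphism])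
    (auto simp: ac_simps)

lemma inf_presheaf_carrier:
  "carrier (sect (inf_presheaf W I M k) U) =
    {IM (k + 1) U #>\<^bsub>sect (additive_sheaf M) U\<^esub> s | s. s \<in> carrier (sect M U)}"
  unfolding inf_presheaf_def subgroup_presheaf.quot_carrier[OF IM_subgroup_presheaf] by simp

end

context ideal_sheaf_module_pair
begin

lemma quot_same_space_morphism:
  assumes "same_space_morphism (base W) (additive_sheaf M) (additive_sheaf N) \<phi>"
    and "\<And>U s. M.opn U \<Longrightarrow> s \<in> M.IM (k + 1) U \<Longrightarrow> \<phi> U s \<in> N.IM (j + 1) U"
  shows "same_space_morphism (base W) (inf_presheaf W I M k) (inf_presheaf W I N j)
     (quot_map (additive_sheaf N) (N.IM (j + 1)) \<phi>)"
  unfolding inf_presheaf_def using assms(2)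
  by (intro quot_map_morphism[OF M.IM_subgroup_presheaf N.IM_subgroup_presheaf assms(1)]) auto

lemma quot_coset:
  assumes "same_space_morphism (base W) (additive_sheaf M) (additive_sheaf N) \<phi>"
    and "\<And>U s. M.opn U \<Longrightarrow> s \<in> M.IM (k + 1) U \<Longrightarrow> \<phi> U s \<in> N.IM (j + 1) U"
    and "M.opn U" "s \<in> carrier (sect M U)"
  shows "quot_map (additive_sheaf N) (N.IM (j + 1)) \<phi> U (M.IM (k + 1) U #>\<^bsub>sect (additive_sheaf M) U\<^esub> s)
    = N.IM (j + 1) U #>\<^bsub>sect (additive_sheaf N) U\<^esub> \<phi> U s"
  using assms
  by (intro quot_map_coset[OF M.IM_subgroup_presheaf N.IM_subgroup_presheaf assms(1)]) auto

end

lemma same_space_morphism_comp: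
  assumes "same_space_morphism T F F' \<phi>" "same_space_morphism T F' F'' \<psi>"
  shows "same_space_morphism T F F'' (\<lambda>U s. \<psi> U (\<phi> U s))"
  unfolding same_space_morphism_def
proof (rule presheaf_morphism_topspaceI)
  interpret \<phi>: same_space_morphism T F F' \<phi> by fact
  interpret \<psi>: same_space_morphism T F' F'' \<psi> by fact
  show "ab_presheaf T F" "ab_presheaf T F''"
    by (rule \<phi>.source.ab_presheaf_axioms \<psi>.target_ab_presheaf)+
  show "openin T U \<Longrightarrow> (\<lambda>s. \<psi> U (\<phi> U s)) \<in> hom (sect F U) (sect F'' U)" for U
    using \<phi>.hom_same[of U] \<psi>.hom_same[of U] by (simp add: hom_def Pi_iff)
  show "openin T U \<Longrightarrow> openin T V \<Longrightarrow> V \<subseteq> U \<Longrightarrow> s \<in> carrier (sect F U) \<Longrightarrow>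
      \<psi> V (\<phi> V (rstr F U V s)) = rstr F'' U V (\<psi> U (\<phi> U s))" for U V s
    by (simp add: \<phi>.rstr_same \<psi>.rstr_same \<phi>.closed_same)
qed

text \<open>
  The next three lemmas transport identities between presheaf maps on the whole space to cochains on
  the subspace, for each kind of composition that occurs below.
\<close>

lemma cochain_map_stalkwise_comp:
  assumes \<phi>: "same_space_morphism T F F' \<phi>" and \<psi>: "same_space_morphism T F' F'' \<psi>"
    and \<omega>: "\<And>U s. openin T U \<Longrightarrow> s \<in> carrier (sect F U) \<Longrightarrow> \<psi> U (\<phi> U s) = \<omega> U s"
    and T': "T' = subtopology T S"
    and f: "f \<in> carrier (cochains T' (subspace_sheaf T F) n)"
  shows "cochain_map T' (topspace T') (subspace_sheaf T F'') (stalkwise T F'' \<psi>) n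
      (cochain_map T' (topspace T') (subspace_sheaf T F') (stalkwise T F' \<phi>) n f) =
    cochain_map T' (topspace T') (subspace_sheaf T F'') (stalkwise T F'' \<omega>) n f"
proof -
  interpret \<phi>: same_space_morphism T F F' \<phi> by fact
  interpret \<psi>: same_space_morphism T F' F'' \<psi> by fact
  interpret F: ab_presheaf T' "subspace_sheaf T F"
    unfolding T' by (rule \<phi>.source.subspace_sheaf_ab_presheaf)
  have 1: "presheaf_morphism T' (topspace T') (subspace_sheaf T F) (subspace_sheaf T F') (stalkwise T F' \<phi>)"
    unfolding T' by (rule \<phi>.stalkwise_morphism)
  have 2: "presheaf_morphism (subtopology T' (topspace T')) (topspace T')
      (subspace_sheaf T F') (subspace_sheaf T F'') (stalkwise T F'' \<psi>)"
    unfolding subtopology_topspace unfolding T' by (rule \<psi>.stalkwise_morphism)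
  have "cochain_map T' (topspace T') (subspace_sheaf T F'') (stalkwise T F'' \<psi>) n
      (cochain_map T' (topspace T') (subspace_sheaf T F') (stalkwise T F' \<phi>) n f) =
    cochain_map T' (topspace T') (subspace_sheaf T F'')
      (\<lambda>V s. stalkwise T F'' \<psi> (V \<inter> topspace T') (stalkwise T F' \<phi> V s)) n f"
    using cochain_map_comp[OF 1 2 f] by (simp add: subtopology_topspace)
  also have "\<dots> = cochain_map T' (topspace T') (subspace_sheaf T F'') (stalkwise T F'' \<omega>) n f"
  proof (rule cochain_map_cong[OF F.ab_presheaf_axioms f])
    fix V s assume V: "openin T' V" and s: "s \<in> carrier (sect (subspace_sheaf T F) V)"
    have "V \<inter> topspace T' = V" using openin_subset[OF V] by blast
    then show "stalkwise T F'' \<psi> (V \<inter> topspace T') (stalkwise T F' \<phi> V s) = stalkwise T F'' \<omega> V s"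
      using stalkwise_comp[OF \<phi> \<psi> V[unfolded T'] s]
        stalkwise_cong[OF \<phi>.source.ab_presheaf_axioms s \<omega>] by simp
  qed
  finally show ?thesis .
qed

lemma cochain_map_germ_section_stalkwise:
  assumes \<theta>: "same_space_morphism T F F' \<theta>" and \<psi>: "same_space_morphism T F' F'' \<psi>"
    and \<omega>: "\<And>U s. openin T U \<Longrightarrow> s \<in> carrier (sect F U) \<Longrightarrow> \<psi> U (\<theta> U s) = \<omega> U s"
    and T': "T' = subtopology T S" and S: "S \<subseteq> topspace T"
    and f: "f \<in> carrier (cochains T F n)"
  shows "cochain_map T' (topspace T') (subspace_sheaf T F'') (stalkwise T F'' \<psi>) n
      (cochain_map T S (subspace_sheaf T F') (germ_section T S F' \<theta>) n f) =
    cochain_map T S (subspace_sheaf T F'') (germ_section T S F'' \<omega>) n f"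
proof -
  interpret \<theta>: same_space_morphism T F F' \<theta> by fact
  interpret \<psi>: same_space_morphism T F' F'' \<psi> by fact
  have top: "topspace T' = S" using S T' by auto
  have 2: "presheaf_morphism (subtopology T S) S (subspace_sheaf T F') (subspace_sheaf T F'') (stalkwise T F'' \<psi>)"
    using \<psi>.stalkwise_morphism[of S] S by (simp add: Int_absorb1)
  have "cochain_map T' (topspace T') (subspace_sheaf T F'') (stalkwise T F'' \<psi>) n
      (cochain_map T S (subspace_sheaf T F') (germ_section T S F' \<theta>) n f) =
    cochain_map T S (subspace_sheaf T F'')
      (\<lambda>U s. stalkwise T F'' \<psi> (U \<inter> S) (germ_section T S F' \<theta> U s)) n f"
    using cochain_map_comp[OF \<theta>.germ_section_morphism 2 f] unfolding top by (simp add: T')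
  also have "\<dots> = cochain_map T S (subspace_sheaf T F'') (germ_section T S F'' \<omega>) n f"
  proof (rule cochain_map_cong[OF \<theta>.source.ab_presheaf_axioms f])
    fix U s assume U: "openin T U" and s: "s \<in> carrier (sect F U)"
    show "stalkwise T F'' \<psi> (U \<inter> S) (germ_section T S F' \<theta> U s) = germ_section T S F'' \<omega> U s"
      unfolding germ_section_def
      using \<psi>.stalkwise_germs[OF U \<theta>.closed_same[OF U s]] \<omega>[OF U s] by simp
  qed
  finally show ?thesis .
qed

lemma cochain_map_then_germ_section:
  assumes \<phi>: "same_space_morphism T F F' \<phi>" and \<theta>: "same_space_morphism T F' F'' \<theta>"
    and \<omega>: "\<And>U s. openin T U \<Longrightarrow> s \<in> carrier (sect F U) \<Longrightarrow> \<theta> U (\<phi> U s) = \<omega> U s"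
    and S: "S \<subseteq> topspace T" and f: "f \<in> carrier (cochains T F n)"
  shows "cochain_map T S (subspace_sheaf T F'') (germ_section T S F'' \<theta>) n
      (cochain_map T (topspace T) F' \<phi> n f) =
    cochain_map T S (subspace_sheaf T F'') (germ_section T S F'' \<omega>) n f"
proof -
  interpret \<phi>: same_space_morphism T F F' \<phi> by fact
  interpret \<theta>: same_space_morphism T F' F'' \<theta> by fact
  have 2: "presheaf_morphism (subtopology T (topspace T)) S F' (subspace_sheaf T F'') (germ_section T S F'' \<theta>)"
    using \<theta>.germ_section_morphism by (simp add: subtopology_topspace)
  have "cochain_map T S (subspace_sheaf T F'') (germ_section T S F'' \<theta>) n
      (cochain_map T (topspace T) F' \<phi> n f) =
    cochain_map T S (subspace_sheaf T F'')
      (\<lambda>U s. germ_section T S F'' \<theta> (U \<inter> topspace T) (\<phi> U s)) n f"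
    using cochain_map_comp[OF \<phi>.presheaf_morphism_axioms 2 f] S
    by (simp add: subtopology_topspace Int_absorb1)
  also have "\<dots> = cochain_map T S (subspace_sheaf T F'') (germ_section T S F'' \<omega>) n f"
    by (rule cochain_map_cong[OF \<phi>.source.ab_presheaf_axioms f])
      (simp add: germ_section_def \<phi>.open_Int_topspace \<omega>)
  finally show ?thesis .
qed

text \<open>
  The diagram chase of the introduction, carried out with cocycles.
\<close>

lemma lifting_criterion_of_splitting:
  assumes F: "ideal_sheaf_module W I F" and E: "ideal_sheaf_module W I E"
    and \<beta>: "O_linear_hom W F E \<beta>" and split: "splits_differentially W F E \<beta> l"
    and glc: "global_lifting_criterion W I F p \<mu> \<nu>"
  shows "global_lifting_criterion W I E p (l + \<mu>) \<nu>"
proof -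
  interpret F: ideal_sheaf_module W I F by fact
  interpret E: ideal_sheaf_module W I E by fact
  interpret FE: ideal_sheaf_module_pair W I F E ..
  interpret EF: ideal_sheaf_module_pair W I E F ..
  let ?T = "base W" and ?X = "subscheme_space W I" and ?T' = "inf_space W I"
  note T' = inf_space_def[of W I]
  note X = F.subscheme_space_subset
  obtain D where D_op: "differential_operator W E F l D"
    and D_sec: "\<And>U s. F.opn U \<Longrightarrow> s \<in> carrier (sect E U) \<Longrightarrow> \<beta> U (D U s) = s"
    using split unfolding splits_differentially_def by blast
  have D_hom: "sheaf_hom ?T E F D" and D_ord: "diff_order_le W E F l (topspace ?T) D"
    using D_op by (auto simp: differential_operator_def)
  have \<beta>_hom: "sheaf_hom ?T F E \<beta>" and \<beta>_ord: "diff_order_le W F E 0 (topspace ?T) \<beta>"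
    using \<beta> by (auto simp: O_linear_hom_def)
  have D_IM: "D U s \<in> F.IM (k + 1) U" if "F.opn U" "s \<in> E.IM (l + k + 1) U" for U s k
    using EF.diff_operator_IM[of "topspace ?T" D l U s "k + 1"] D_hom D_ord that openin_subset[OF that(1)]
    by (simp add: subtopology_topspace add.assoc)
  \<comment> \<open>A linear map is a differential operator of order zero, so it preserves the filtration.\<close>
  have \<beta>_IM: "\<beta> U s \<in> E.IM k U" if "F.opn U" "s \<in> F.IM k U" for U s k
    using FE.diff_operator_IM[of "topspace ?T" \<beta> 0 U s k] \<beta>_hom \<beta>_ord that openin_subset[OF that(1)]
    by (simp add: subtopology_topspace)
  have D: "same_space_morphism ?T (additive_sheaf E) (additive_sheaf F) D"
    and \<beta>_morphism: "same_space_morphism ?T (additive_sheaf F) (additive_sheaf E) \<beta>"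
    using sheaf_hom_morphism E.M.module_sheaf_axioms F.M.module_sheaf_axioms D_hom \<beta>_hom by blast+

  let ?m = "\<nu> + (l + \<mu>)" and ?k = "\<nu> + \<mu>"
  let ?cE = "\<lambda>j U s. E.IM (j + 1) U #>\<^bsub>sect (additive_sheaf E) U\<^esub> s"
  let ?cF = "\<lambda>j U s. F.IM (j + 1) U #>\<^bsub>sect (additive_sheaf F) U\<^esub> s"
  let ?pE = "quot_map (additive_sheaf E) (E.IM (\<nu> + 1)) (\<lambda>U s. s)"
  let ?pF = "quot_map (additive_sheaf F) (F.IM (\<nu> + 1)) (\<lambda>U s. s)"
  let ?D = "quot_map (additive_sheaf F) (F.IM (?k + 1)) D"
  let ?\<beta> = "quot_map (additive_sheaf E) (E.IM (\<nu> + 1)) \<beta>"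
  let ?QE = "inf_presheaf W I E" and ?QF = "inf_presheaf W I F"
  let ?SE = "inf_sheaf W I E" and ?SF = "inf_sheaf W I F"
  note pE = E.proj_same_space_morphism[of \<nu> "l + \<mu>"]
  note pF = F.proj_same_space_morphism[of \<nu> \<mu>]
  have D_IM': "D U s \<in> F.IM (?k + 1) U" if "F.opn U" "s \<in> E.IM (?m + 1) U" for U s
    using D_IM[of U s ?k] that by (simp add: ac_simps)
  have Dq: "same_space_morphism ?T (?QE ?m) (?QF ?k) ?D"
    using D D_IM' by (rule EF.quot_same_space_morphism)
  have \<beta>q: "same_space_morphism ?T (?QF \<nu>) (?QE \<nu>) ?\<beta>"
    using \<beta>_morphism \<beta>_IM by (rule FE.quot_same_space_morphism)

  \<comment> \<open>On the infinitesimal neighbourhoods \<open>\<beta> \<circ> D\<close> becomes a projection, because \<open>D\<close> lowers the level.\<close>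
  have \<beta>_proj_D: "?\<beta> U (?pF U (?D U c)) = ?pE U c" if U: "F.opn U" and c: "c \<in> carrier (sect (?QE ?m) U)" for U c
  proof -
    obtain s where s: "s \<in> carrier (sect E U)" and c_eq: "c = ?cE ?m U s"
      using c by (auto simp: E.inf_presheaf_carrier)
    have Ds: "D U s \<in> carrier (sect F U)"
      using same_space_morphism.closed_same[OF D U] s by simp
    have "?D U c = ?cF ?k U (D U s)"
      unfolding c_eq using D D_IM' U s by (rule EF.quot_coset)
    also have "?pF U \<dots> = ?cF \<nu> U (D U s)"
      by (rule F.proj_coset[OF U Ds])
    also have "?\<beta> U \<dots> = ?cE \<nu> U (\<beta> U (D U s))"
      using \<beta>_morphism \<beta>_IM U Ds by (rule FE.quot_coset)
    also have "\<dots> = ?pE U c"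
      unfolding c_eq using D_sec[OF U s] E.proj_coset[OF U s, of \<nu> "l + \<mu>"] by simp
    finally show ?thesis .
  qed

  interpret resE: presheaf_morphism ?T ?X "additive_sheaf E" "?SE \<nu>" "to_inf_sheaf W I E \<nu>"
    unfolding E.to_inf_sheaf_eq E.inf_sheaf_eq
    by (rule same_space_morphism.germ_section_morphism[OF E.coset_same_space_morphism])
  interpret resE': presheaf_morphism ?T ?X "additive_sheaf E" "?SE ?m" "to_inf_sheaf W I E ?m"
    unfolding E.to_inf_sheaf_eq E.inf_sheaf_eq
    by (rule same_space_morphism.germ_section_morphism[OF E.coset_same_space_morphism])
  interpret resF: presheaf_morphism ?T ?X "additive_sheaf F" "?SF \<nu>" "to_inf_sheaf W I F \<nu>"
    unfolding F.to_inf_sheaf_eq F.inf_sheaf_eq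
    by (rule same_space_morphism.germ_section_morphism[OF F.coset_same_space_morphism])
  interpret projE: presheaf_morphism ?T' "topspace ?T'" "?SE ?m" "?SE \<nu>" "inf_sheaf_proj W I E \<nu>"
    unfolding E.inf_sheaf_proj_eq E.inf_sheaf_eq T'
    by (rule same_space_morphism.stalkwise_morphism[OF pE])
  interpret projF: presheaf_morphism ?T' "topspace ?T'" "?SF ?k" "?SF \<nu>" "inf_sheaf_proj W I F \<nu>"
    unfolding F.inf_sheaf_proj_eq F.inf_sheaf_eq T'
    by (rule same_space_morphism.stalkwise_morphism[OF pF])
  let ?D' = "stalkwise ?T (?QF ?k) ?D" and ?\<beta>' = "stalkwise ?T (?QE \<nu>) ?\<beta>"
  interpret D': presheaf_morphism ?T' "topspace ?T'" "?SE ?m" "?SF ?k" ?D'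
    unfolding E.inf_sheaf_eq F.inf_sheaf_eq T'
    by (rule same_space_morphism.stalkwise_morphism[OF Dq])
  interpret \<beta>': presheaf_morphism ?T' "topspace ?T'" "?SF \<nu>" "?SE \<nu>" ?\<beta>'
    unfolding E.inf_sheaf_eq F.inf_sheaf_eq T'
    by (rule same_space_morphism.stalkwise_morphism[OF \<beta>q])
  interpret \<beta>: same_space_morphism ?T "additive_sheaf F" "additive_sheaf E" \<beta> by fact

  let ?resE = "\<lambda>j. cochain_map ?T ?X (?SE j) (to_inf_sheaf W I E j) p"
  let ?resF = "cochain_map ?T ?X (?SF \<nu>) (to_inf_sheaf W I F \<nu>) p"
  let ?projE = "cochain_map ?T' (topspace ?T') (?SE \<nu>) (inf_sheaf_proj W I E \<nu>) p"
  let ?projF = "cochain_map ?T' (topspace ?T') (?SF \<nu>) (inf_sheaf_proj W I F \<nu>) p"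
  let ?Dc = "cochain_map ?T' (topspace ?T') (?SF ?k) ?D' p"
  let ?\<beta>c = "cochain_map ?T' (topspace ?T') (?SE \<nu>) ?\<beta>' p"
  let ?\<beta>g = "cochain_map ?T (topspace ?T) (additive_sheaf E) \<beta> p"
  let ?clE = "\<lambda>f. coboundaries ?T' (?SE \<nu>) p #>\<^bsub>cochains ?T' (?SE \<nu>) p\<^esub> f"
  let ?clF = "\<lambda>f. coboundaries ?T' (?SF \<nu>) p #>\<^bsub>cochains ?T' (?SF \<nu>) p\<^esub> f"

  \<comment> \<open>The cochain versions of the commuting squares, beginning with restriction in two steps.\<close>
  have res_proj: "?projE (?resE ?m f) = ?resE \<nu> f" if "f \<in> carrier (cochains ?T (additive_sheaf E) p)" for f
    unfolding E.to_inf_sheaf_eq E.inf_sheaf_proj_eq E.inf_sheaf_eq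
    using that E.proj_coset[of _ _ \<nu> "l + \<mu>"]
    by (intro cochain_map_germ_section_stalkwise[OF E.coset_same_space_morphism pE _ T' X]) auto
  have res_\<beta>: "?\<beta>c (?resF f) = ?resE \<nu> (?\<beta>g f)" if f: "f \<in> carrier (cochains ?T (additive_sheaf F) p)" for f
  proof -
    have q: "?\<beta> U (?cF \<nu> U s) = ?cE \<nu> U (\<beta> U s)" if "F.opn U" "s \<in> carrier (sect (additive_sheaf F) U)" for U s
      using \<beta>_morphism \<beta>_IM that(1) that(2)[simplified] by (rule FE.quot_coset)
    show ?thesis
      unfolding E.to_inf_sheaf_eq F.to_inf_sheaf_eq E.inf_sheaf_eq F.inf_sheaf_eq
      by (rule trans[OF cochain_map_germ_section_stalkwise[OF F.coset_same_space_morphism \<beta>q q T' X f]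
            cochain_map_then_germ_section[OF \<beta>_morphism E.coset_same_space_morphism refl X f, symmetric]])
  qed
  have \<beta>_proj_D_cochain: "?\<beta>c (?projF (?Dc e)) = ?projE e" if e: "e \<in> carrier (cochains ?T' (?SE ?m) p)" for e
  proof -
    have Dpq: "same_space_morphism ?T (?QE ?m) (?QF \<nu>) (\<lambda>U c. ?pF U (?D U c))"
      using Dq pF by (rule same_space_morphism_comp)
    show ?thesis
      unfolding E.inf_sheaf_eq F.inf_sheaf_eq E.inf_sheaf_proj_eq F.inf_sheaf_proj_eq
        cochain_map_stalkwise_comp[OF Dq pF refl T' e[unfolded E.inf_sheaf_eq]]
      by (rule cochain_map_stalkwise_comp[OF Dpq \<beta>q \<beta>_proj_D T' e[unfolded E.inf_sheaf_eq]])
  qed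

  have sub: "subtopology ?T ?X = ?T'" "subtopology ?T' (topspace ?T') = ?T'"
    by (simp add: T', rule subtopology_topspace)
  note imgs = image_cohomology_map[OF resE.presheaf_morphism_axioms, of p]
    image_cohomology_map[OF resF.presheaf_morphism_axioms, of p]
    image_cohomology_map[OF projE.presheaf_morphism_axioms, of p]
    image_cohomology_map[OF projF.presheaf_morphism_axioms, of p]
  note imgs = imgs[unfolded sub]
  have glc': "{?clF (?resF f) | f. f \<in> cocycles ?T (additive_sheaf F) p} =
      {?clF (?projF e) | e. e \<in> cocycles ?T' (?SF ?k) p}"
    using glc unfolding global_lifting_criterion_def restrict_global_def restrict_inf_def imgs .
  have "{?clE (?resE \<nu> f) | f. f \<in> cocycles ?T (additive_sheaf E) p} =
      {?clE (?projE e) | e. e \<in> cocycles ?T' (?SE ?m) p}" (is "?L = ?R")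
  proof
    show "?L \<subseteq> ?R"
    proof clarify
      fix f assume f: "f \<in> cocycles ?T (additive_sheaf E) p"
      then have "?projE (?resE ?m f) = ?resE \<nu> f" by (intro res_proj) (simp add: cocycles_def)
      moreover have "?resE ?m f \<in> cocycles ?T' (?SE ?m) p"
        using resE'.cochain_map_cocycles[OF f] unfolding sub .
      ultimately show "\<exists>e. ?clE (?resE \<nu> f) = ?clE (?projE e) \<and> e \<in> cocycles ?T' (?SE ?m) p"
        by metis
    qed
    show "?R \<subseteq> ?L"
    proof clarify
      fix e assume e: "e \<in> cocycles ?T' (?SE ?m) p"
      have De: "?Dc e \<in> cocycles ?T' (?SF ?k) p"
        using D'.cochain_map_cocycles[OF e] unfolding sub .
      then obtain f where f: "f \<in> cocycles ?T (additive_sheaf F) p"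
        and eq: "?clF (?projF (?Dc e)) = ?clF (?resF f)"
        using glc' by blast
      have c: "?projF (?Dc e) \<in> cocycles ?T' (?SF \<nu>) p" "?resF f \<in> cocycles ?T' (?SF \<nu>) p"
        using projF.cochain_map_cocycles[OF De] resF.cochain_map_cocycles[OF f] unfolding sub by auto
      have "?clE (?projE e) = ?clE (?\<beta>c (?projF (?Dc e)))"
        using \<beta>_proj_D_cochain e by (simp add: cocycles_def)
      also have "\<dots> = ?clE (?\<beta>c (?resF f))"
        using eq \<beta>'.cohomology_map_class[OF c(1), unfolded sub] \<beta>'.cohomology_map_class[OF c(2), unfolded sub]
        by simp
      also have "\<dots> = ?clE (?resE \<nu> (?\<beta>g f))"
        using res_\<beta> f by (simp add: cocycles_def)
      finally have "?clE (?projE e) = ?clE (?resE \<nu> (?\<beta>g f))" .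
      moreover have "?\<beta>g f \<in> cocycles ?T (additive_sheaf E) p"
        using \<beta>.cochain_map_cocycles[OF f] by (simp add: subtopology_topspace)
      ultimately show "\<exists>f. ?clE (?projE e) = ?clE (?resE \<nu> f) \<and> f \<in> cocycles ?T (additive_sheaf E) p"
        by blast
    qed
  qed
  then show ?thesis
    unfolding global_lifting_criterion_def restrict_global_def restrict_inf_def imgs .
qed

theorem theorem3p4:
  fixes W :: "('x, 'r) cspace" and I :: "'x set \<Rightarrow> 'r set"
    and G :: "('x, 'r, 'g) module_presheaf"
    and F :: "('x, 'r, 'f) module_presheaf"
    and E :: "('x, 'r, 'e) module_presheaf"
    and \<alpha> :: "'x set \<Rightarrow> 'g \<Rightarrow> 'f" and \<beta> :: "'x set \<Rightarrow> 'f \<Rightarrow> 'e"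
    and p l \<mu> \<nu> :: nat
  assumes "complex_algebraic_scheme W"
    and "closed_subscheme W I"
    and "coherent W G" and "coherent W F" and "coherent W E"
    and "O_linear_hom W G F \<alpha>" and "O_linear_hom W F E \<beta>"
    and "short_exact W G F E \<alpha> \<beta>"
    and "splits_differentially W F E \<beta> l"
    and "global_lifting_criterion W I F p \<mu> \<nu>"
  shows "global_lifting_criterion W I E p (l + \<mu>) \<nu>"
proof (rule lifting_criterion_of_splitting)
  have W: "is_ringed_cspace W"
    using assms(1) by (simp add: complex_algebraic_scheme_def)
  have "ideal_sheaf W I" by (rule ideal_sheafI[OF W assms(2)])
  moreover have "module_sheaf W F" "module_sheaf W E"
    using W assms(4,5)
    by (simp_all add: module_sheaf_def module_sheaf_axioms_def ringed_cspace_def coherent_def)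
  ultimately show "ideal_sheaf_module W I F" "ideal_sheaf_module W I E"
    by (simp_all add: ideal_sheaf_module_def)
qed (use assms in auto)

end
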